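(* Let $X$ be a càdlàg process and $(X^n)_n$ a sequence of càdlàg processes on $(\Omega,\mathcal{A},\mathbb{P})$. Let $\mathcal{F}$ be the right-continuous filtration associated to the natural filtration of $X$, and let $\mathcal{F}^n$ be the natural filtration of $X^n$. Let $\gamma:[0,T]\times\mathbb{R}\to\mathbb{R}$ be bounded and continuous. Assume that $X^n\to X$ in probability (for the Skorokhod topology), that Aldous' criterion for tightness holds, i.e. $$\forall \varepsilon>0,\quad \lim_{\delta\downarrow 0}\ \limsup_{n\to+\infty}\ \sup_{\sigma,\nu\in\mathcal{T}^n_T,\ \sigma\leqslant\nu\leqslant\sigma+\delta}\ \mathbb{P}\big[|X^n_\sigma-X^n_\nu|\geqslant\varepsilon\big]=0,$$ and that one of the following assertions holds: - for all $n$, $\mathcal{F}^n\subset\mathcal{F}$ (i.e. $\mathcal{F}^n_t\subset\mathcal{F}_t$ for all $t\in[0,T]$); - $\mathcal{F}^n\xrightarrow{w}\mathcal{F}$ (weak convergence of filtrations). Then $\Gamma_n(T)\to\Gamma(T)$ as $n\to\infty$, where $$\Gamma(T)=\sup_{\tau\in\mathcal{T}_T}\mathbb{E}[\gamma(\tau,X_\tau)],\qquad \Gamma_n(T)=\sup_{\tau\in\mathcal{T}^n_T}\mathbb{E}[\gamma(\tau,X^n_\tau)].$$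
   Context: $(\Omega,\mathcal{A},\mathbb{P})$ is a probability space, $T>0$ is fixed, all processes are real-valued and indexed by $[0,T]$, and all filtrations are indexed by $[0,T]$ and consist of sub-$\sigma$-fields of $\mathcal{A}$. $\mathbb{D}=\mathbb{D}([0,T])$ is the space of càdlàg functions $[0,T]\to\mathbb{R}$ with the Skorokhod ($J_1$) topology; convergence in probability of càdlàg processes is for this topology. The natural filtration of a process $Y$ is $\mathcal{F}^Y_t=\sigma(Y_s,\,s\leqslant t)$. The right-continuous filtration associated to the natural filtration of $X$ is $\mathcal{F}_t=\mathcal{F}^X_{t^+}=\bigcap_{s>t}\mathcal{F}^X_s$ for $t<T$, with $\mathcal{F}_T=\mathcal{F}^X_T$. $\mathcal{T}_T$ (resp. $\mathcal{T}^n_T$) is the set of $\mathcal{F}$-stopping times (resp. $\mathcal{F}^n$-stopping times) bounded by $T$. Weak convergence of filtrations $\mathcal{F}^n\xrightarrow{w}\mathcal{F}$ means: for every $A\in\mathcal{F}_T$, the sequence of processes $(\mathbb{E}[1_A|\mathcal{F}^n_\cdot])_n$ converges in probability to $\mathbb{E}[1_A|\mathcal{F}_\cdot]$ for the Skorokhod topology. *)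

theory Defs
  imports "HOL-Probability.Probability"
begin

text \<open>
  Processes are functions \<open>Y t \<omega>\<close> of a real time \<open>t\<close>; only the values for \<open>t\<close> in \<open>{0..T}\<close> matter.
  Filtrations are families of measures indexed by the reals, of which only the spaces and the
  \<open>\<sigma>\<close>-algebras for indices in \<open>{0..T}\<close> matter.
\<close>

subsection \<open>Cadlag processes and the Skorokhod distance\<close>

definition cadlag_on :: "real \<Rightarrow> (real \<Rightarrow> real) \<Rightarrow> bool" where
  "cadlag_on T f \<longleftrightarrow>
     (\<forall>t\<in>{0..<T}. (f \<longlongrightarrow> f t) (at_right t)) \<and>
     (\<forall>t\<in>{0<..T}. \<exists>l. (f \<longlongrightarrow> l) (at_left t))"

definition cadlag_process :: "'a measure \<Rightarrow> real \<Rightarrow> (real \<Rightarrow> 'a \<Rightarrow> real) \<Rightarrow> bool" where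
  "cadlag_process M T Y \<longleftrightarrow>
     (\<forall>t\<in>{0..T}. Y t \<in> borel_measurable M) \<and>
     (\<forall>\<omega>\<in>space M. cadlag_on T (\<lambda>t. Y t \<omega>))"

definition time_changes :: "real \<Rightarrow> (real \<Rightarrow> real) set" where
  "time_changes T =
     {l. continuous_on {0..T} l \<and> strict_mono_on {0..T} l \<and> l ` {0..T} = {0..T}}"

text \<open>
  The standard metric inducing the \<open>J\<^sub>1\<close> topology. Cadlag functions on a compact interval are
  bounded, so for them all suprema and infima below are taken over bounded nonempty sets.
\<close>

definition skorokhod_dist :: "real \<Rightarrow> (real \<Rightarrow> real) \<Rightarrow> (real \<Rightarrow> real) \<Rightarrow> real" where
  "skorokhod_dist T f g =
     (INF l\<in>time_changes T.
        max (SUP t\<in>{0..T}. \<bar>l t - t\<bar>) (SUP t\<in>{0..T}. \<bar>f t - g (l t)\<bar>))"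

text \<open>
  To be used for cadlag processes only. The events below are then measurable: the \<open>J\<^sub>1\<close> topology is
  separable and its Borel \<open>\<sigma>\<close>-algebra is generated by the coordinate maps.
\<close>

definition skorokhod_tendsto_in_prob ::
  "'a measure \<Rightarrow> real \<Rightarrow> (nat \<Rightarrow> real \<Rightarrow> 'a \<Rightarrow> real) \<Rightarrow> (real \<Rightarrow> 'a \<Rightarrow> real) \<Rightarrow> bool" where
  "skorokhod_tendsto_in_prob M T Yn Y \<longleftrightarrow>
     (\<forall>\<epsilon>>0. (\<lambda>n. measure M {\<omega>\<in>space M.
        skorokhod_dist T (\<lambda>t. Yn n t \<omega>) (\<lambda>t. Y t \<omega>) \<ge> \<epsilon>}) \<longlonglongrightarrow> 0)"

subsection \<open>Filtrations and stopping times\<close>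

definition natural_filtration :: "'a measure \<Rightarrow> (real \<Rightarrow> 'a \<Rightarrow> real) \<Rightarrow> real \<Rightarrow> 'a measure" where
  "natural_filtration M Y t =
     sigma (space M) {Y s -` B \<inter> space M | s B. s \<in> {0..t} \<and> B \<in> sets borel}"

text \<open>The intersection is already a \<open>\<sigma>\<close>-algebra; \<open>sigma\<close> only packages it as a measure.\<close>

definition right_continuous_filtration :: "real \<Rightarrow> (real \<Rightarrow> 'a measure) \<Rightarrow> real \<Rightarrow> 'a measure" where
  "right_continuous_filtration T G t =
     (if t < T then sigma (space (G T)) (\<Inter>s\<in>{t<..T}. sets (G s)) else G T)"

text \<open>
  \<open>stopping_time\<close> asks for \<open>{\<tau> \<le> t} \<in> G t\<close> for all real \<open>t\<close>. For \<open>\<tau>\<close> with values in \<open>{0..T}\<close> this is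
  trivially true when \<open>t < 0\<close> or \<open>t \<ge> T\<close>.
\<close>

definition stopping_times ::
  "'a measure \<Rightarrow> real \<Rightarrow> (real \<Rightarrow> 'a measure) \<Rightarrow> ('a \<Rightarrow> real) set" where
  "stopping_times M T G = {\<tau>. stopping_time G \<tau> \<and> (\<forall>\<omega>\<in>space M. \<tau> \<omega> \<in> {0..T})}"

text \<open>\<open>N\<close> is a cadlag version of the martingale \<open>E[1\<^sub>A | G\<^sub>t]\<close>; it is unique up to indistinguishability.\<close>

definition cadlag_cond_prob ::
  "'a measure \<Rightarrow> real \<Rightarrow> (real \<Rightarrow> 'a measure) \<Rightarrow> 'a set \<Rightarrow> (real \<Rightarrow> 'a \<Rightarrow> real) \<Rightarrow> bool" where
  "cadlag_cond_prob M T G A N \<longleftrightarrow>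
     cadlag_process M T N \<and>
     (\<forall>t\<in>{0..T}. AE \<omega> in M. N t \<omega> = real_cond_exp M (G t) (indicator A) \<omega>)"

definition weak_conv_filtrations ::
  "'a measure \<Rightarrow> real \<Rightarrow> (nat \<Rightarrow> real \<Rightarrow> 'a measure) \<Rightarrow> (real \<Rightarrow> 'a measure) \<Rightarrow> bool" where
  "weak_conv_filtrations M T Gn G \<longleftrightarrow>
     (\<forall>A\<in>sets (G T). \<exists>Nn N.
        (\<forall>n. cadlag_cond_prob M T (Gn n) A (Nn n)) \<and>
        cadlag_cond_prob M T G A N \<and>
        skorokhod_tendsto_in_prob M T Nn N)"

subsection \<open>Aldous' criterion and optimal stopping values\<close>

definition aldous_criterion ::
  "'a measure \<Rightarrow> real \<Rightarrow> (nat \<Rightarrow> real \<Rightarrow> 'a measure) \<Rightarrow> (nat \<Rightarrow> real \<Rightarrow> 'a \<Rightarrow> real) \<Rightarrow> bool" where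
  "aldous_criterion M T Gn Yn \<longleftrightarrow>
     (\<forall>\<epsilon>>0.
       ((\<lambda>\<delta>. limsup (\<lambda>n.
          SUP (\<sigma>, \<nu>) \<in> {(\<sigma>, \<nu>). \<sigma> \<in> stopping_times M T (Gn n) \<and> \<nu> \<in> stopping_times M T (Gn n) \<and>
                                (\<forall>\<omega>\<in>space M. \<sigma> \<omega> \<le> \<nu> \<omega> \<and> \<nu> \<omega> \<le> \<sigma> \<omega> + \<delta>)}.
            emeasure M {\<omega>\<in>space M. \<bar>Yn n (\<sigma> \<omega>) \<omega> - Yn n (\<nu> \<omega>) \<omega>\<bar> \<ge> \<epsilon>}))
        \<longlongrightarrow> 0) (at_right 0))"

definition optimal_value ::
  "'a measure \<Rightarrow> real \<Rightarrow> (real \<Rightarrow> 'a measure) \<Rightarrow> (real \<times> real \<Rightarrow> real) \<Rightarrow> (real \<Rightarrow> 'a \<Rightarrow> real) \<Rightarrow> real"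
  where
  "optimal_value M T G \<gamma> Y =
     (SUP \<tau>\<in>stopping_times M T G. \<integral>\<omega>. \<gamma> (\<tau> \<omega>, Y (\<tau> \<omega>) \<omega>) \<partial>M)"

subsection \<open>Basic facts\<close>

lemma space_natural_filtration [simp]: "space (natural_filtration M Y t) = space M"
  by (auto simp: natural_filtration_def intro!: space_measure_of)

lemma sets_natural_filtration:
  "sets (natural_filtration M Y t) =
     sigma_sets (space M) {Y s -` B \<inter> space M | s B. s \<in> {0..t} \<and> B \<in> sets borel}"
  unfolding natural_filtration_def by (rule sets_measure_of) auto

lemma sets_natural_filtration_mono:
  assumes "s \<le> t"
  shows "sets (natural_filtration M Y s) \<subseteq> sets (natural_filtration M Y t)"
  unfolding sets_natural_filtration using assms
  by (intro sigma_sets_mono') force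

lemma subalgebra_natural_filtration:
  assumes "cadlag_process M T Y" "t \<le> T"
  shows "subalgebra M (natural_filtration M Y t)"
proof -
  have "{Y s -` B \<inter> space M | s B. s \<in> {0..t} \<and> B \<in> sets borel} \<subseteq> sets M"
    using assms by (auto simp: cadlag_process_def intro!: measurable_sets)
  then show ?thesis
    unfolding subalgebra_def sets_natural_filtration
    by (simp add: sets.sigma_sets_subset)
qed

lemma sets_right_continuous_filtration:
  assumes sp: "\<And>s. space (G s) = \<Omega>" and "t < T"
  shows "sets (right_continuous_filtration T G t) = (\<Inter>s\<in>{t<..T}. sets (G s))"
proof -
  have T: "T \<in> {t<..T}" using assms by auto
  have G: "sigma_algebra \<Omega> (sets (G s))" for s
    using sets.sigma_algebra_axioms[of "G s"] sp by simp
  have "sigma_algebra \<Omega> (\<Inter>s\<in>{t<..T}. sets (G s))"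
    unfolding sigma_algebra_iff2
  proof (intro conjI ballI allI impI)
    show "(\<Inter>s\<in>{t<..T}. sets (G s)) \<subseteq> Pow \<Omega>"
      using T sets.sets_into_space[of _ "G T"] sp by blast
    show "{} \<in> (\<Inter>s\<in>{t<..T}. sets (G s))" by simp
    show "\<Omega> - A \<in> (\<Inter>s\<in>{t<..T}. sets (G s))"
      if "A \<in> (\<Inter>s\<in>{t<..T}. sets (G s))" for A
      using that sets.compl_sets[of A] sp by fastforce
    show "(\<Union>i. A i) \<in> (\<Inter>s\<in>{t<..T}. sets (G s))"
      if "range A \<subseteq> (\<Inter>s\<in>{t<..T}. sets (G s))" for A :: "nat \<Rightarrow> _"
      using that by (intro INT_I sets.countable_UN) auto
  qed
  then show ?thesis
    using assms by (simp add: right_continuous_filtration_def sigma_algebra.sets_measure_of_eq)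
qed

lemma subalgebra_right_continuous_filtration:
  assumes "cadlag_process M T Y" "t \<le> T"
  shows "subalgebra M (right_continuous_filtration T (natural_filtration M Y) t)"
proof (cases "t < T")
  case True
  have "sets (right_continuous_filtration T (natural_filtration M Y) t)
      \<subseteq> sets (natural_filtration M Y T)"
    using sets_right_continuous_filtration[of "natural_filtration M Y" "space M" t T] True by auto
  moreover have "space (right_continuous_filtration T (natural_filtration M Y) t) = space M"
    by (simp add: right_continuous_filtration_def space_measure_of_conv)
  ultimately show ?thesis
    using subalgebra_natural_filtration[OF assms(1), of T] by (auto simp: subalgebra_def)
next
  case False
  then show ?thesis
    using subalgebra_natural_filtration[OF assms(1), of T]
    by (simp add: right_continuous_filtration_def)
qed

end

theory Submission
  imports Defs
begin

text \<open>
  Both bounds reduce the problem to finitely many times, where convergence of the processes is just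
  convergence in probability of finitely many random variables.

  A time change moves times by little. Hence the Skorokhod convergence gives \<open>X\<^sup>n\<^sub>t \<rightarrow> X\<^sub>t\<close> in
  probability at every time \<open>t\<close> at which \<open>X\<close> almost surely does not jump, and at \<open>T\<close>, which time changes
  fix. A cadlag process has only countably many fixed times of discontinuity
  (\<open>countable_fixed_discontinuities\<close>), so there are arbitrarily fine grids \<open>S\<close> containing \<open>T\<close> and
  consisting of good times. On such a grid \<open>E[\<gamma>(\<tau>, X\<^sup>n\<^sub>\<tau>)]\<close> and \<open>E[\<gamma>(\<tau>, X\<^sub>\<tau>)]\<close> differ by an error that is
  uniform in the \<open>S\<close>-valued random time \<open>\<tau>\<close> (\<open>expected_reward_exchange\<close>).

  For the lower bound (\<open>expected_reward_liminf\<close>), a stopping time \<open>\<tau>\<close> of \<open>F\<close> is rounded up to the first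
  grid point strictly after it; by right-continuity this costs little when the grid is fine. The
  rounded time is described by the events \<open>{\<tau> < s}\<close>, \<open>s \<in> S\<close>, which belong to the natural filtration
  of \<open>X\<close> at time \<open>s\<close>, and every event of this kind is approximated in probability by events that
  \<open>X\<^sup>n\<close> has revealed by time \<open>s\<close> (\<open>approximable_natural_filtration\<close>). The approximating events define a
  stopping time of the natural filtration of \<open>X\<^sup>n\<close> with nearly the same reward.

  For the upper bound, a stopping time of \<open>F\<^sup>n\<close> is rounded up to the next grid point. By Aldous'
  criterion this changes the expected reward little, uniformly (\<open>expected_reward_rounding\<close>). After that only
  grid-valued stopping times \<open>\<tau>\<close> of \<open>F\<^sup>n\<close> and the rewards \<open>E[\<gamma>(\<tau>, X\<^sub>\<tau>)]\<close> of the limit process remain.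
  If \<open>F\<^sup>n \<subseteq> F\<close>, these \<open>\<tau>\<close> are stopping times of \<open>F\<close>. If \<open>F\<^sup>n\<close> converges weakly to \<open>F\<close>, then, outside
  a countable set of times \<open>t\<close>, \<open>E[U | F\<^sup>n\<^sub>t] \<rightarrow> E[U | F\<^sub>t]\<close> in \<open>L\<^sup>1\<close> for all integrable \<open>F\<^sub>T\<close>-measurable \<open>U\<close>
  (\<open>weak_conv_filtrations_cond_exp\<close>). Backward induction along the grid then carries the Snell envelopes
  for \<open>F\<^sup>n\<close> to the Snell envelope for \<open>F\<close>, whose expectation is the reward of a stopping time of \<open>F\<close>
  (\<open>expected_reward_finite_weak_conv\<close>).

  A preliminary point is that the Skorokhod distance of two cadlag processes is a random variable
  (\<open>skorokhod_dist_measurable\<close>): the measure of a non-measurable set is zero, so otherwise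
  convergence in probability would carry no information.
\<close>

section \<open>Cadlag paths\<close>

text \<open>One-sided limits in Cauchy form: compactness arguments need only the oscillation on either side
  of \<open>x\<close>, and the value of the left limit does not have to be named.\<close>

lemma cadlag_on_oscillation:
  assumes f: "cadlag_on T f" and x: "x \<in> {0..T}" and e: "e > 0"
  obtains d where "d > 0"
    "\<And>s t. s \<in> {x..<x+d} \<Longrightarrow> t \<in> {x..<x+d} \<Longrightarrow> s \<le> T \<Longrightarrow> t \<le> T \<Longrightarrow> \<bar>f s - f t\<bar> < e"
    "\<And>s t. s \<in> {x-d<..<x} \<Longrightarrow> t \<in> {x-d<..<x} \<Longrightarrow> 0 \<le> s \<Longrightarrow> 0 \<le> t \<Longrightarrow> \<bar>f s - f t\<bar> < e"
proof -
  have "\<exists>d>0. \<forall>s t. s \<in> {x..<x+d} \<longrightarrow> t \<in> {x..<x+d} \<longrightarrow> s \<le> T \<longrightarrow> t \<le> T \<longrightarrow> \<bar>f s - f t\<bar> < e"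
  proof (cases "x < T")
    case True
    then have "(f \<longlongrightarrow> f x) (at_right x)"
      using f x by (auto simp: cadlag_on_def)
    then have "\<forall>\<^sub>F s in at_right x. dist (f s) (f x) < e/2"
      using e by (intro tendstoD) auto
    then obtain b where b: "b > x" "\<And>s. s > x \<Longrightarrow> s < b \<Longrightarrow> dist (f s) (f x) < e/2"
      unfolding eventually_at_right_field by auto
    have c: "dist (f s) (f x) < e/2" if "x \<le> s" "s < b" for s
      using b(2)[of s] that e by (cases "s = x") auto
    show ?thesis
    proof (intro exI[of _ "b-x"] conjI allI impI)
      show "\<bar>f s - f t\<bar> < e" if "s \<in> {x..<x+(b-x)}" "t \<in> {x..<x+(b-x)}" for s t
        using dist_triangle_half_l[OF c[of s] c[of t]] that by (simp add: dist_real_def)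
    qed (use b in auto)
  next
    case False
    then show ?thesis
      using x e by (intro exI[of _ 1]) auto
  qed
  then obtain d1 where d1: "d1 > 0"
    "\<And>s t. s \<in> {x..<x+d1} \<Longrightarrow> t \<in> {x..<x+d1} \<Longrightarrow> s \<le> T \<Longrightarrow> t \<le> T \<Longrightarrow> \<bar>f s - f t\<bar> < e"
    by blast
  have "\<exists>d>0. \<forall>s t. s \<in> {x-d<..<x} \<longrightarrow> t \<in> {x-d<..<x} \<longrightarrow> 0 \<le> s \<longrightarrow> 0 \<le> t \<longrightarrow> \<bar>f s - f t\<bar> < e"
  proof (cases "0 < x")
    case True
    then have "\<exists>l. (f \<longlongrightarrow> l) (at_left x)"
      using f x by (simp add: cadlag_on_def)
    then obtain l where "(f \<longlongrightarrow> l) (at_left x)" ..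
    then have "\<forall>\<^sub>F s in at_left x. dist (f s) l < e/2"
      using e by (intro tendstoD) auto
    then obtain b where b: "b < x" "\<And>s. s > b \<Longrightarrow> s < x \<Longrightarrow> dist (f s) l < e/2"
      unfolding eventually_at_left_field by auto
    show ?thesis
    proof (intro exI[of _ "x-b"] conjI allI impI)
      show "\<bar>f s - f t\<bar> < e" if "s \<in> {x-(x-b)<..<x}" "t \<in> {x-(x-b)<..<x}" for s t
        using dist_triangle_half_l[OF b(2)[of s] b(2)[of t]] that by (simp add: dist_real_def)
    qed (use b in auto)
  next
    case False
    then show ?thesis
      using x e by (intro exI[of _ 1]) auto
  qed
  then obtain d2 where d2: "d2 > 0"
    "\<And>s t. s \<in> {x-d2<..<x} \<Longrightarrow> t \<in> {x-d2<..<x} \<Longrightarrow> 0 \<le> s \<Longrightarrow> 0 \<le> t \<Longrightarrow> \<bar>f s - f t\<bar> < e"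
    by blast
  show ?thesis
    by (rule that[of "min d1 d2"]) (use d1 d2 in auto)
qed

lemma cadlag_on_bounded:
  assumes f: "cadlag_on T f"
  obtains K where "\<And>t. t \<in> {0..T} \<Longrightarrow> \<bar>f t\<bar> \<le> K"
proof (cases "0 \<le> T")
  case True
  define P where "P a b \<longleftrightarrow> (0 \<le> a \<longrightarrow> b \<le> T \<longrightarrow> (\<exists>K. \<forall>t\<in>{a..b}. \<bar>f t\<bar> \<le> K))" for a b
  have "P 0 T"
    using True
  proof (induction rule: Bolzano)
    case (trans a b c)
    show ?case
      unfolding P_def
    proof (intro impI)
      assume "0 \<le> a" "c \<le> T"
      then obtain K1 K2 where "\<forall>t\<in>{a..b}. \<bar>f t\<bar> \<le> K1" "\<forall>t\<in>{b..c}. \<bar>f t\<bar> \<le> K2"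
        using trans unfolding P_def by force
      then show "\<exists>K. \<forall>t\<in>{a..c}. \<bar>f t\<bar> \<le> K"
        by (intro exI[of _ "max K1 K2"]) (force simp: le_max_iff_disj)
    qed
  next
    case (local x)
    then have "x \<in> {0..T}" by auto
    from cadlag_on_oscillation[OF f this, of 1] obtain d where d: "d > 0"
      "\<And>s t. s \<in> {x..<x+d} \<Longrightarrow> t \<in> {x..<x+d} \<Longrightarrow> s \<le> T \<Longrightarrow> t \<le> T \<Longrightarrow> \<bar>f s - f t\<bar> < 1"
      "\<And>s t. s \<in> {x-d<..<x} \<Longrightarrow> t \<in> {x-d<..<x} \<Longrightarrow> 0 \<le> s \<Longrightarrow> 0 \<le> t \<Longrightarrow> \<bar>f s - f t\<bar> < 1"
      by auto
    show ?case
    proof (intro exI[of _ d] conjI allI impI)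
      fix a b assume ab: "a \<le> x \<and> x \<le> b \<and> b - a < d"
      show "P a b"
        unfolding P_def
      proof (intro impI exI[of _ "max (\<bar>f a\<bar> + 1) (\<bar>f x\<bar> + 1)"] ballI)
        fix t assume "0 \<le> a" "b \<le> T" "t \<in> {a..b}"
        then show "\<bar>f t\<bar> \<le> max (\<bar>f a\<bar> + 1) (\<bar>f x\<bar> + 1)"
          using d(2)[of x t] d(3)[of a t] ab d(1) by (cases "t < x") auto
      qed
    qed (use d in auto)
  qed
  then obtain K where "\<forall>t\<in>{0..T}. \<bar>f t\<bar> \<le> K"
    by (auto simp: P_def)
  then show ?thesis by (intro that) blast
qed (use that[of 0] in auto)

text \<open>The values on this countable set determine a cadlag function on \<open>[0,T]\<close>. The point \<open>T\<close> is added
  because it cannot be approached from the right.\<close>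

definition dense_times :: "real \<Rightarrow> real set" where
  "dense_times T = insert T (\<rat> \<inter> {0..<T})"

lemma countable_dense_times: "countable (dense_times T)"
  by (auto simp: dense_times_def intro: countable_rat)

lemma dense_times_subset: "0 \<le> T \<Longrightarrow> dense_times T \<subseteq> {0..T}"
  by (auto simp: dense_times_def)

lemma cadlag_on_dense_times:
  assumes f: "cadlag_on T f" and t: "t \<in> {0..T}" and e: "e > 0"
  obtains q where "q \<in> dense_times T" "t \<le> q" "q < t + e" "\<bar>f q - f t\<bar> < e"
proof (cases "t = T")
  case True
  then show ?thesis using that[of T] e by (auto simp: dense_times_def)
next
  case False
  then have tT: "t < T" using t by auto
  from cadlag_on_oscillation[OF f t e] obtain d where d: "d > 0"
    "\<And>s u. s \<in> {t..<t+d} \<Longrightarrow> u \<in> {t..<t+d} \<Longrightarrow> s \<le> T \<Longrightarrow> u \<le> T \<Longrightarrow> \<bar>f s - f u\<bar> < e"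
    by metis
  obtain q where q: "q \<in> \<rat>" "t < q" "q < min T (min (t+e) (t+d))"
    using Rats_dense_in_real[of t "min T (min (t+e) (t+d))"] tT d e by auto
  show ?thesis
    by (rule that[of q]) (use q t d(2)[of q t] in \<open>auto simp: dense_times_def\<close>)
qed

section \<open>The Skorokhod distance\<close>

text \<open>The metric with its suprema and its infimum replaced by an explicit time change. The relation is
  symmetric, and bounds add up under composition.\<close>

definition skorokhod_close :: "real \<Rightarrow> (real \<Rightarrow> real) \<Rightarrow> (real \<Rightarrow> real) \<Rightarrow> real \<Rightarrow> bool" where
  "skorokhod_close T f g c \<longleftrightarrow>
     (\<exists>l\<in>time_changes T. \<forall>t\<in>{0..T}. \<bar>l t - t\<bar> \<le> c \<and> \<bar>f t - g (l t)\<bar> \<le> c)"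

lemma time_changesD:
  assumes "l \<in> time_changes T"
  shows "continuous_on {0..T} l" "strict_mono_on {0..T} l" "l ` {0..T} = {0..T}"
  using assms unfolding time_changes_def by blast+

lemma time_changesI:
  assumes "continuous_on {0..T} l" "strict_mono_on {0..T} l" "l ` {0..T} = {0..T}"
  shows "l \<in> time_changes T"
  using assms unfolding time_changes_def by blast

lemma time_changes_mem: "l \<in> time_changes T \<Longrightarrow> t \<in> {0..T} \<Longrightarrow> l t \<in> {0..T}"
  unfolding time_changes_def by blast

lemma time_changes_inj: "l \<in> time_changes T \<Longrightarrow> inj_on l {0..T}"
  unfolding time_changes_def by (auto intro: strict_mono_on_imp_inj_on)

lemma time_changes_id: "(\<lambda>t. t) \<in> time_changes T"
  by (rule time_changesI) (auto simp: strict_mono_on_def)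

lemma time_changes_comp:
  assumes l: "l \<in> time_changes T" and k: "k \<in> time_changes T"
  shows "(\<lambda>t. k (l t)) \<in> time_changes T"
proof (rule time_changesI)
  show "continuous_on {0..T} (\<lambda>t. k (l t))"
    using time_changesD[OF k] time_changesD[OF l] by (metis continuous_on_compose2 order_refl)
  show "strict_mono_on {0..T} (\<lambda>t. k (l t))"
  proof (rule strict_mono_onI)
    fix s t assume st: "s \<in> {0..T}" "t \<in> {0..T}" "s < t"
    from strict_mono_onD[OF time_changesD(2)[OF l] this] have "l s < l t" .
    with strict_mono_onD[OF time_changesD(2)[OF k]] st time_changes_mem[OF l]
    show "k (l s) < k (l t)" by blast
  qed
  show "(\<lambda>t. k (l t)) ` {0..T} = {0..T}"
    using time_changesD(3)[OF k] time_changesD(3)[OF l] by (metis image_image)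
qed

lemma time_changes_inverse:
  assumes l: "l \<in> time_changes T"
  shows "the_inv_into {0..T} l \<in> time_changes T"
proof (rule time_changesI)
  let ?k = "the_inv_into {0..T} l"
  note im = time_changesD(3)[OF l]
  note inj = time_changes_inj[OF l]
  have k: "?k r \<in> {0..T}" "l (?k r) = r" if "r \<in> {0..T}" for r
    using that f_the_inv_into_f[OF inj] the_inv_into_into[OF inj, of r] unfolding im by blast+
  have "continuous_on (l ` {0..T}) ?k"
    by (intro continuous_on_inv time_changesD(1)[OF l] compact_Icc ballI the_inv_into_f_f[OF inj])
  then show "continuous_on {0..T} ?k" unfolding im .
  show "?k ` {0..T} = {0..T}"
    using the_inv_into_onto[OF inj] unfolding im .
  show "strict_mono_on {0..T} ?k"
  proof (rule strict_mono_onI)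
    fix s t assume st: "s \<in> {0..T}" "t \<in> {0..T}" "s < t"
    show "?k s < ?k t"
    proof (rule ccontr)
      assume "\<not> ?k s < ?k t"
      then consider "?k t < ?k s" | "?k t = ?k s" by linarith
      then have "l (?k t) \<le> l (?k s)"
        using strict_mono_onD[OF time_changesD(2)[OF l], of "?k t" "?k s"] k st
        by cases auto
      then show False using k st by simp
    qed
  qed
qed

text \<open>Hence Skorokhod convergence implies convergence of the values at \<open>T\<close>, even if the limit jumps there.\<close>

lemma time_changes_endpoint:
  assumes "0 \<le> T" "l \<in> time_changes T"
  shows "l T = T"
proof -
  have "T \<in> l ` {0..T}"
    using assms unfolding time_changesD(3)[OF assms(2)] by simp
  then obtain s where s: "s \<in> {0..T}" "l s = T" by auto
  have "l s < l T" if "s < T"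
    using s assms(1) that by (intro strict_mono_onD[OF time_changesD(2)[OF assms(2)]]) auto
  moreover have "l T \<le> T"
    using time_changes_mem[OF assms(2), of T] assms(1) by simp
  ultimately show ?thesis
    using s by (cases "s = T") auto
qed

lemma skorokhod_close_uniform:
  assumes "\<And>t. t \<in> {0..T} \<Longrightarrow> \<bar>f t - g t\<bar> \<le> c" "0 \<le> c"
  shows "skorokhod_close T f g c"
  unfolding skorokhod_close_def using assms by (intro bexI[OF _ time_changes_id]) auto

lemma skorokhod_close_mono: "skorokhod_close T f g c \<Longrightarrow> c \<le> d \<Longrightarrow> skorokhod_close T f g d"
  unfolding skorokhod_close_def by force

lemma skorokhod_close_trans:
  assumes "skorokhod_close T f g c" "skorokhod_close T g h d"
  shows "skorokhod_close T f h (c + d)"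
proof -
  obtain l where l: "l \<in> time_changes T" "\<And>t. t \<in> {0..T} \<Longrightarrow> \<bar>l t - t\<bar> \<le> c \<and> \<bar>f t - g (l t)\<bar> \<le> c"
    using assms(1) unfolding skorokhod_close_def by blast
  obtain k where k: "k \<in> time_changes T" "\<And>t. t \<in> {0..T} \<Longrightarrow> \<bar>k t - t\<bar> \<le> d \<and> \<bar>g t - h (k t)\<bar> \<le> d"
    using assms(2) unfolding skorokhod_close_def by blast
  show ?thesis
    unfolding skorokhod_close_def
  proof (intro bexI[OF _ time_changes_comp[OF l(1) k(1)]] ballI)
    fix t assume "t \<in> {0..T}"
    then show "\<bar>k (l t) - t\<bar> \<le> c + d \<and> \<bar>f t - h (k (l t))\<bar> \<le> c + d"
      using l(2)[of t] k(2)[of "l t"] time_changes_mem[OF l(1), of t] by auto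
  qed
qed

lemma skorokhod_close_sym:
  assumes "skorokhod_close T f g c"
  shows "skorokhod_close T g f c"
proof -
  obtain l where l: "l \<in> time_changes T" "\<And>t. t \<in> {0..T} \<Longrightarrow> \<bar>l t - t\<bar> \<le> c \<and> \<bar>f t - g (l t)\<bar> \<le> c"
    using assms(1) unfolding skorokhod_close_def by blast
  note inj = time_changes_inj[OF l(1)]
  note im = time_changesD(3)[OF l(1)]
  show ?thesis
    unfolding skorokhod_close_def
  proof (intro bexI[OF _ time_changes_inverse[OF l(1)]] ballI)
    fix t assume t: "t \<in> {0..T}"
    let ?s = "the_inv_into {0..T} l t"
    have "?s \<in> {0..T}" "l ?s = t"
      using t f_the_inv_into_f[OF inj] the_inv_into_into[OF inj, of t] unfolding im by blast+
    then show "\<bar>?s - t\<bar> \<le> c \<and> \<bar>g t - f ?s\<bar> \<le> c"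
      using l(2)[of ?s] by auto
  qed
qed

lemma skorokhod_dist_less_iff:
  assumes T: "0 \<le> T" and f: "cadlag_on T f" and g: "cadlag_on T g"
  shows "skorokhod_dist T f g < e \<longleftrightarrow> (\<exists>c<e. skorokhod_close T f g c)"
proof -
  define m where "m l = max (SUP t\<in>{0..T}. \<bar>l t - t\<bar>) (SUP t\<in>{0..T}. \<bar>f t - g (l t)\<bar>)" for l
  obtain K where K: "\<And>t. t \<in> {0..T} \<Longrightarrow> \<bar>f t\<bar> \<le> K" using cadlag_on_bounded[OF f] by blast
  obtain L where L: "\<And>t. t \<in> {0..T} \<Longrightarrow> \<bar>g t\<bar> \<le> L" using cadlag_on_bounded[OF g] by blast
  have ne: "{0..T} \<noteq> {}" using T by auto
  have le: "m l \<le> c \<longleftrightarrow> (\<forall>t\<in>{0..T}. \<bar>l t - t\<bar> \<le> c \<and> \<bar>f t - g (l t)\<bar> \<le> c)"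
    if l: "l \<in> time_changes T" for l c
  proof -
    have "\<bar>l t - t\<bar> \<le> T" if "t \<in> {0..T}" for t
      using time_changes_mem[OF l that] that by auto
    then have b1: "bdd_above ((\<lambda>t. \<bar>l t - t\<bar>) ` {0..T})" by (intro bdd_aboveI2)
    have "\<bar>f t - g (l t)\<bar> \<le> K + L" if "t \<in> {0..T}" for t
      using K[OF that] L[OF time_changes_mem[OF l that]] by auto
    then have b2: "bdd_above ((\<lambda>t. \<bar>f t - g (l t)\<bar>) ` {0..T})" by (intro bdd_aboveI2)
    show ?thesis
      unfolding m_def max.bounded_iff cSUP_le_iff[OF ne b1] cSUP_le_iff[OF ne b2] by blast
  qed
  have pos: "0 \<le> m l" if "l \<in> time_changes T" for l
    using le[OF that, of "m l"] T by force
  have "skorokhod_dist T f g = (INF l\<in>time_changes T. m l)"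
    by (simp add: skorokhod_dist_def m_def)
  also have "\<dots> < e \<longleftrightarrow> (\<exists>l\<in>time_changes T. m l < e)"
    using pos time_changes_id by (intro cINF_less_iff) (auto intro!: bdd_belowI2[of _ 0])
  also have "\<dots> \<longleftrightarrow> (\<exists>l\<in>time_changes T. \<exists>c<e. m l \<le> c)" by force
  also have "\<dots> \<longleftrightarrow> (\<exists>c<e. skorokhod_close T f g c)"
    unfolding skorokhod_close_def using le by blast
  finally show ?thesis .
qed

section \<open>Sampling on a grid, and measurability of the Skorokhod distance\<close>

definition grid_floor :: "real \<Rightarrow> nat \<Rightarrow> real \<Rightarrow> real" where
  "grid_floor T N t = of_int \<lfloor>t * N / T\<rfloor> * T / N"

definition grid_ceiling :: "real \<Rightarrow> nat \<Rightarrow> real \<Rightarrow> real" where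
  "grid_ceiling T N t = of_int \<lceil>t * N / T\<rceil> * T / N"

lemma grid_floor_bounds:
  assumes "T > 0" "N > 0" "grid_ceiling T N a \<le> t" "t < grid_ceiling T N b"
  shows "a \<le> grid_floor T N t" "grid_floor T N t < b"
proof -
  have "of_int \<lceil>a * N / T\<rceil> \<le> t * N / T"
    using assms by (simp add: grid_ceiling_def field_simps)
  then have "\<lceil>a * N / T\<rceil> \<le> \<lfloor>t * N / T\<rfloor>" by (simp add: le_floor_iff)
  then have "a * N / T \<le> of_int \<lfloor>t * N / T\<rfloor>" by (simp add: ceiling_le_iff)
  then show "a \<le> grid_floor T N t"
    using assms by (simp add: grid_floor_def field_simps)
  have "t * N / T < of_int \<lceil>b * N / T\<rceil>"
    using assms by (simp add: grid_ceiling_def field_simps)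
  then have "\<lfloor>t * N / T\<rfloor> < \<lceil>b * N / T\<rceil>" by (simp add: floor_less_iff)
  then have "of_int \<lfloor>t * N / T\<rfloor> < b * N / T" by (simp add: less_ceiling_iff)
  then show "grid_floor T N t < b"
    using assms by (simp add: grid_floor_def field_simps)
qed

lemma grid_ceiling_bounds:
  assumes "T > 0" "N > 0"
  shows "a \<le> grid_ceiling T N a" "grid_ceiling T N a < a + T / N"
proof -
  have 1: "a * N / T \<le> of_int \<lceil>a * N / T\<rceil>" "of_int \<lceil>a * N / T\<rceil> < a * N / T + 1"
    by linarith+
  have "a = (a * N / T) * (T / N)" using assms by simp
  also have "\<dots> \<le> of_int \<lceil>a * N / T\<rceil> * (T / N)"
    using 1(1) assms by (intro mult_right_mono) auto
  finally show "a \<le> grid_ceiling T N a"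
    by (simp add: grid_ceiling_def)
  have "of_int \<lceil>a * N / T\<rceil> * (T / N) < (a * N / T + 1) * (T / N)"
    using 1(2) assms by (intro mult_strict_right_mono) auto
  also have "\<dots> = a + T / N" using assms by (simp add: field_simps)
  finally show "grid_ceiling T N a < a + T / N"
    by (simp add: grid_ceiling_def)
qed

lemma grid_ceiling_less:
  assumes "T > 0" "N > 0" "T / N < b - a"
  shows "grid_ceiling T N a < grid_ceiling T N b"
  using grid_ceiling_bounds(2)[OF assms(1,2), of a] grid_ceiling_bounds(1)[OF assms(1,2), of b] assms(3)
  by linarith

text \<open>The piece over \<open>[a,b]\<close> of a time change that matches the sampled function with \<open>f\<close>. The ends are
  moved to the next grid point on the right, since sampling notices a jump only there. At the right end
  of the piece the sampled function may have jumped already, so the values are compared on a half-open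
  interval.\<close>

definition grid_matching :: "real \<Rightarrow> nat \<Rightarrow> (real \<Rightarrow> real) \<Rightarrow> real \<Rightarrow> real \<Rightarrow> real \<Rightarrow> (real \<Rightarrow> real) \<Rightarrow> bool" where
  "grid_matching T N f e a b l \<longleftrightarrow>
     (let u = grid_ceiling T N a; v = grid_ceiling T N b in
       u < v \<and> continuous_on {u..v} l \<and> strict_mono_on {u..v} l \<and> l u = a \<and> l v = b \<and>
       (\<forall>t\<in>{u..v}. \<bar>l t - t\<bar> \<le> T / N) \<and>
       (\<forall>t\<in>{u..<v}. \<bar>f (grid_floor T N t) - f (l t)\<bar> \<le> e))"

lemma grid_matching_glue:
  assumes "grid_matching T N f e a b l" "grid_matching T N f e b c k"
  shows "grid_matching T N f e a c (\<lambda>t. if t \<le> grid_ceiling T N b then l t else k t)"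
proof -
  let ?u = "grid_ceiling T N a" and ?v = "grid_ceiling T N b" and ?w = "grid_ceiling T N c"
  let ?m = "\<lambda>t. if t \<le> ?v then l t else k t"
  have l: "?u < ?v" "continuous_on {?u..?v} l" "strict_mono_on {?u..?v} l" "l ?u = a" "l ?v = b"
      "\<And>t. t \<in> {?u..?v} \<Longrightarrow> \<bar>l t - t\<bar> \<le> T / N"
      "\<And>t. t \<in> {?u..<?v} \<Longrightarrow> \<bar>f (grid_floor T N t) - f (l t)\<bar> \<le> e"
    using assms(1) by (auto simp: grid_matching_def Let_def)
  have k: "?v < ?w" "continuous_on {?v..?w} k" "strict_mono_on {?v..?w} k" "k ?v = b" "k ?w = c"
      "\<And>t. t \<in> {?v..?w} \<Longrightarrow> \<bar>k t - t\<bar> \<le> T / N"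
      "\<And>t. t \<in> {?v..<?w} \<Longrightarrow> \<bar>f (grid_floor T N t) - f (k t)\<bar> \<le> e"
    using assms(2) by (auto simp: grid_matching_def Let_def)
  have mk: "?m t = k t" if "?v \<le> t" for t using that l(5) k(4) by (cases "t = ?v") auto
  have "continuous_on ({?u..?v} \<union> {?v..?w}) ?m"
    using l k by (intro continuous_on_If) auto
  moreover have "{?u..?v} \<union> {?v..?w} = {?u..?w}" using l(1) k(1) by auto
  ultimately have "continuous_on {?u..?w} ?m" by simp
  moreover have "strict_mono_on {?u..?w} ?m"
  proof (rule strict_mono_onI)
    fix s t assume st: "s \<in> {?u..?w}" "t \<in> {?u..?w}" "s < t"
    have A: "?m s < ?m t" if "s < t" "?u \<le> s" "t \<le> ?v" for s t
      using that strict_mono_onD[OF l(3), of s t] by simp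
    have B: "?m s < ?m t" if "s < t" "?v \<le> s" "t \<le> ?w" for s t
      using that strict_mono_onD[OF k(3), of s t] mk[of s] mk[of t] by simp
    show "?m s < ?m t"
    proof (cases "t \<le> ?v \<or> ?v \<le> s")
      case True
      then show ?thesis using A[of s t] B[of s t] st by auto
    next
      case False
      then have "?m s < ?m ?v" "?m ?v < ?m t" using A[of s ?v] B[of ?v t] st by auto
      then show ?thesis by linarith
    qed
  qed
  moreover have "\<bar>?m t - t\<bar> \<le> T / N" if "t \<in> {?u..?w}" for t
    using that l(6)[of t] k(6)[of t] by auto
  moreover have "\<bar>f (grid_floor T N t) - f (?m t)\<bar> \<le> e" if "t \<in> {?u..<?w}" for t
    using that l(7)[of t] k(7)[of t] mk[of t] by (cases "t < ?v") auto
  ultimately show ?thesis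
    unfolding grid_matching_def Let_def using l k mk[of ?w] by auto
qed

lemma grid_matching_linear:
  assumes "T > 0" "N > 0" "T / N < b - a"
    and osc: "\<And>s t. s \<in> {a..<b} \<Longrightarrow> t \<in> {a..<b} \<Longrightarrow> \<bar>f s - f t\<bar> \<le> e"
  shows "\<exists>l. grid_matching T N f e a b l"
proof -
  let ?u = "grid_ceiling T N a" and ?v = "grid_ceiling T N b"
  define l where "l t = a + (t - ?u) * ((b - a) / (?v - ?u))" for t
  note uv = grid_ceiling_less[OF assms(1-3)]
  have ab: "a < b" using assms by (smt (verit) divide_pos_pos of_nat_0_less_iff)
  have sl: "0 < (b - a) / (?v - ?u)" using uv ab by simp
  have mono: "strict_mono_on {?u..?v} l"
    unfolding l_def by (intro strict_mono_onI add_strict_left_mono mult_strict_right_mono sl) simp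
  have ends: "l ?u = a" "l ?v = b" using uv by (auto simp: l_def)
  have dist: "\<bar>l t - t\<bar> \<le> T / N" if t: "t \<in> {?u..?v}" for t
  proof -
    define \<theta> where "\<theta> = (t - ?u) / (?v - ?u)"
    have th: "0 \<le> \<theta>" "\<theta> \<le> 1" using t uv by (auto simp: \<theta>_def field_simps)
    have "(?v - ?u) * \<theta> = t - ?u" using uv by (simp add: \<theta>_def)
    then have "t = ?u + (?v - ?u) * \<theta>" by simp
    moreover have "l t = a + (b - a) * \<theta>" by (simp add: l_def \<theta>_def)
    \<comment> \<open>Both ends are moved by at most the mesh, and linear interpolation is a convex combination.\<close>
    ultimately have "t - l t = (1 - \<theta>) * (?u - a) + \<theta> * (?v - b)"
      by (simp add: algebra_simps)
    moreover have "0 \<le> (1 - \<theta>) * (?u - a)" "0 \<le> \<theta> * (?v - b)"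
      using th grid_ceiling_bounds(1)[OF assms(1,2)] by auto
    moreover have "(1 - \<theta>) * (?u - a) \<le> (1 - \<theta>) * (T / N)" "\<theta> * (?v - b) \<le> \<theta> * (T / N)"
      using th grid_ceiling_bounds(2)[OF assms(1,2), of a] grid_ceiling_bounds(2)[OF assms(1,2), of b]
      by (intro mult_left_mono; simp)+
    moreover have "(1 - \<theta>) * (T / N) + \<theta> * (T / N) = T / N" by (simp add: left_diff_distrib flip: add_divide_distrib)
    ultimately show ?thesis by linarith
  qed
  have "\<bar>f (grid_floor T N t) - f (l t)\<bar> \<le> e" if t: "t \<in> {?u..<?v}" for t
  proof (rule osc)
    show "grid_floor T N t \<in> {a..<b}"
      using grid_floor_bounds[OF assms(1,2)] t by auto
    have "l t < l ?v" using t by (intro strict_mono_onD[OF mono]) auto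
    moreover have "l ?u \<le> l t"
      using t strict_mono_onD[OF mono, of ?u t] by (cases "t = ?u") auto
    ultimately show "l t \<in> {a..<b}" using ends by auto
  qed
  moreover have "continuous_on {?u..?v} l" unfolding l_def by (intro continuous_intros)
  ultimately show ?thesis
    unfolding grid_matching_def Let_def using uv mono ends dist by blast
qed

text \<open>Sampling a cadlag function on a fine uniform grid moves it little: cut \<open>[0,T]\<close> into finitely many
  intervals on which the function oscillates little (the compactness argument is \<open>Bolzano\<close>), and
  let the time change move each cutting point to the next grid point, linearly in between.\<close>

lemma skorokhod_close_sample:
  assumes T: "T > 0" and f: "cadlag_on T f" and e: "e > 0"
  shows "\<forall>\<^sub>F N in sequentially. skorokhod_close T (\<lambda>t. f (grid_floor T N t)) f e"
proof -
  define P where "P a b \<longleftrightarrow>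
    (0 \<le> a \<longrightarrow> a < b \<longrightarrow> b \<le> T \<longrightarrow> (\<forall>\<^sub>F N in sequentially. \<exists>l. grid_matching T N f e a b l))" for a b
  have small: "\<forall>\<^sub>F N in sequentially. N > 0 \<and> T / real N < d" if "d > 0" for d
  proof -
    have "(\<lambda>N. T / real N) \<longlonglongrightarrow> 0" by (rule lim_const_over_n)
    then have "\<forall>\<^sub>F N in sequentially. T / real N < d" using that by (rule order_tendstoD(2))
    then show ?thesis using eventually_gt_at_top[of 0] by eventually_elim auto
  qed
  have trans: "P a c" if "P a b" "P b c" "a \<le> b" "b \<le> c" for a b c
  proof (cases "a = b \<or> b = c")
    case False
    then have ab: "a < b" "b < c" using that by auto
    show ?thesis
      unfolding P_def
    proof (intro impI)
      assume "0 \<le> a" "a < c" "c \<le> T"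
      then have "\<forall>\<^sub>F N in sequentially. \<exists>l. grid_matching T N f e a b l"
        "\<forall>\<^sub>F N in sequentially. \<exists>l. grid_matching T N f e b c l"
        using that ab by (auto simp: P_def)
      then show "\<forall>\<^sub>F N in sequentially. \<exists>l. grid_matching T N f e a c l"
        by eventually_elim (use grid_matching_glue in blast)
    qed
  qed (use that in auto)
  have "P 0 T"
    using less_imp_le[OF T]
  proof (induction rule: Bolzano)
    case (local x)
    then have "x \<in> {0..T}" by auto
    from cadlag_on_oscillation[OF f this e] obtain d where d: "d > 0"
      "\<And>s t. s \<in> {x..<x+d} \<Longrightarrow> t \<in> {x..<x+d} \<Longrightarrow> s \<le> T \<Longrightarrow> t \<le> T \<Longrightarrow> \<bar>f s - f t\<bar> < e"
      "\<And>s t. s \<in> {x-d<..<x} \<Longrightarrow> t \<in> {x-d<..<x} \<Longrightarrow> 0 \<le> s \<Longrightarrow> 0 \<le> t \<Longrightarrow> \<bar>f s - f t\<bar> < e"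
      by metis
    show ?case
    proof (intro exI[of _ d] conjI allI impI)
      fix a b assume ab: "a \<le> x \<and> x \<le> b \<and> b - a < d"
      have Q: "P a b" if "a < b" and flat: "\<And>s t. 0 \<le> a \<Longrightarrow> b \<le> T \<Longrightarrow> s \<in> {a..<b} \<Longrightarrow> t \<in> {a..<b} \<Longrightarrow> \<bar>f s - f t\<bar> \<le> e" for a b
        unfolding P_def
      proof (intro impI)
        assume "0 \<le> a" "b \<le> T"
        then have osc: "\<bar>f s - f t\<bar> \<le> e" if "s \<in> {a..<b}" "t \<in> {a..<b}" for s t
          using that flat by blast
        show "\<forall>\<^sub>F N in sequentially. \<exists>l. grid_matching T N f e a b l"
          using small[of "b - a"] \<open>a < b\<close>
          by (auto elim!: eventually_mono intro!: grid_matching_linear[OF T] osc)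
      qed
      have "P a x"
      proof (cases "a < x")
        case True
        then show ?thesis
          by (rule Q) (use ab d(3) in \<open>fastforce intro: less_imp_le\<close>)
      qed (simp add: P_def)
      moreover have "P x b"
      proof (cases "x < b")
        case True
        then show ?thesis
          by (rule Q) (use ab d(2) in \<open>fastforce intro: less_imp_le\<close>)
      qed (simp add: P_def)
      ultimately show "P a b" using trans ab by blast
    qed (use d in auto)
  qed (use trans in blast)
  then have "\<forall>\<^sub>F N in sequentially. \<exists>l. grid_matching T N f e 0 T l"
    using T by (auto simp: P_def)
  then show ?thesis
    using small[OF e]
  proof eventually_elim
    case (elim N)
    have [simp]: "grid_ceiling T N 0 = 0" "grid_ceiling T N T = T" "grid_floor T N T = T"
      using T elim(2) by (auto simp: grid_ceiling_def grid_floor_def)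
    from elim(1) obtain l where l: "continuous_on {0..T} l" "strict_mono_on {0..T} l" "l 0 = 0" "l T = T"
      "\<And>t. t \<in> {0..T} \<Longrightarrow> \<bar>l t - t\<bar> \<le> T / N"
      "\<And>t. t \<in> {0..<T} \<Longrightarrow> \<bar>f (grid_floor T N t) - f (l t)\<bar> \<le> e"
      by (auto simp: grid_matching_def Let_def)
    have "l \<in> time_changes T"
    proof (rule time_changesI[OF l(1,2)])
      show "l ` {0..T} = {0..T}"
      proof (intro equalityI subsetI)
        fix y assume "y \<in> {0..T}"
        then show "y \<in> l ` {0..T}"
          using IVT'[of l 0 y T] l T by auto
      next
        fix y assume "y \<in> l ` {0..T}"
        then obtain t where t: "t \<in> {0..T}" "y = l t" by auto
        have "l 0 \<le> l t" "l t \<le> l T"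
          using strict_mono_on_leD[OF l(2), of 0 t] strict_mono_on_leD[OF l(2), of t T] t T by auto
        then show "y \<in> {0..T}" using t l by auto
      qed
    qed
    moreover have "\<bar>f (grid_floor T N t) - f (l t)\<bar> \<le> e" if "t \<in> {0..T}" for t
      using l(6)[of t] that l(4) e by (cases "t = T") simp_all
    then have "\<bar>l t - t\<bar> \<le> e \<and> \<bar>f (grid_floor T N t) - f (l t)\<bar> \<le> e" if "t \<in> {0..T}" for t
      using l(5)[OF that] that elim(2) by fastforce
    ultimately have "\<exists>l\<in>time_changes T. \<forall>t\<in>{0..T}. \<bar>l t - t\<bar> \<le> e \<and> \<bar>f (grid_floor T N t) - f (l t)\<bar> \<le> e"
      by blast
    then show ?case
      unfolding skorokhod_close_def .
  qed
qed

definition grid_step :: "real \<Rightarrow> nat \<Rightarrow> rat list \<Rightarrow> real \<Rightarrow> real" where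
  "grid_step T N p t = real_of_rat (p ! nat \<lfloor>t * N / T\<rfloor>)"

definition sample_near :: "real \<Rightarrow> nat \<Rightarrow> real \<Rightarrow> (real \<Rightarrow> real) \<Rightarrow> rat list \<Rightarrow> bool" where
  "sample_near T N e f p \<longleftrightarrow> (\<forall>i\<in>{..N}. \<bar>f (i * T / N) - real_of_rat (p ! i)\<bar> \<le> e)"

lemma sample_near_close:
  assumes T: "T > 0" and N: "N > 0" and e: "e \<ge> 0" and p: "sample_near T N e f p"
  shows "skorokhod_close T (\<lambda>t. f (grid_floor T N t)) (grid_step T N p) e"
proof (rule skorokhod_close_uniform[OF _ e])
  fix t assume t: "t \<in> {0..T}"
  define i where "i = nat \<lfloor>t * N / T\<rfloor>"
  have "0 \<le> t * N / T" "t * N / T \<le> N" using t T N by (auto simp: field_simps)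
  then have "of_int \<lfloor>t * N / T\<rfloor> = real i" "i \<le> N" by (auto simp: i_def nat_le_iff floor_le_iff)
  then show "\<bar>f (grid_floor T N t) - grid_step T N p t\<bar> \<le> e"
    using p by (simp add: sample_near_def grid_floor_def grid_step_def i_def)
qed

lemma ex_sample_near:
  assumes "e > 0"
  obtains p where "sample_near T N e f p"
proof -
  have "\<exists>q. \<bar>f (real i * T / N) - real_of_rat q\<bar> \<le> e" for i
  proof -
    obtain q where "f (real i * T / N) - e < real_of_rat q" "real_of_rat q < f (real i * T / N)"
      using of_rat_dense[of "f (real i * T / N) - e" "f (real i * T / N)"] assms by auto
    then show ?thesis by (intro exI[of _ q]) auto
  qed
  then obtain q where "\<And>i. \<bar>f (real i * T / N) - real_of_rat (q i)\<bar> \<le> e" by metis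
  then show ?thesis
    by (intro that[of "map q [0..<Suc N]"]) (auto simp: sample_near_def simp del: upt_Suc)
qed

definition samples_close :: "real \<Rightarrow> (real \<Rightarrow> real) \<Rightarrow> (real \<Rightarrow> real) \<Rightarrow> real \<Rightarrow> nat \<Rightarrow> nat \<Rightarrow> bool" where
  "samples_close T f g e m N \<longleftrightarrow>
     (\<exists>p q. sample_near T (Suc N) (1 / Suc m) f p \<and> sample_near T (Suc N) (1 / Suc m) g q \<and>
       skorokhod_close T (grid_step T (Suc N) p) (grid_step T (Suc N) q) (e - 5 / Suc m))"

text \<open>Sampling reduces closeness of two cadlag functions to closeness of rational step functions, of which
  there are countably many, and to the values of the functions at grid points. Only the latter depend on
  the functions, and for processes they are random variables.\<close>

lemma ex_skorokhod_close_iff: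
  assumes T: "T > 0" and f: "cadlag_on T f" and g: "cadlag_on T g"
  shows "(\<exists>c<e. skorokhod_close T f g c) \<longleftrightarrow> (\<exists>m N0. \<forall>N\<in>{N0..}. samples_close T f g e m N)"
    (is "?L \<longleftrightarrow> ?R")
proof
  assume ?L
  then obtain c where c: "c < e" "skorokhod_close T f g c" by blast
  \<comment> \<open>With \<open>h = 1 / Suc m\<close>, passing from a function to its sample and on to a rational step function costs
    \<open>2 h\<close>, so \<open>4 h\<close> for the pair, and a slack of \<open>5 h\<close> has to be left.\<close>
  obtain m where m: "1 / Suc m < (e - c) / 10"
    using nat_approx_posE[of "(e - c) / 10"] c by auto
  define h where "h = 1 / real (Suc m)"
  have h: "h > 0" by (simp add: h_def)
  from eventually_conj[OF skorokhod_close_sample[OF T f h] skorokhod_close_sample[OF T g h]]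
  obtain N0 where N0: "\<And>N. N \<ge> N0 \<Longrightarrow> skorokhod_close T (\<lambda>t. f (grid_floor T N t)) f h"
    "\<And>N. N \<ge> N0 \<Longrightarrow> skorokhod_close T (\<lambda>t. g (grid_floor T N t)) g h"
    unfolding eventually_sequentially by blast
  show ?R
  proof (rule exI[of _ m], rule exI[of _ N0], rule ballI)
    fix N assume N: "N \<in> {N0..}"
    obtain p where p: "sample_near T (Suc N) h f p" using ex_sample_near[OF h] .
    obtain q where q: "sample_near T (Suc N) h g q" using ex_sample_near[OF h] .
    have "skorokhod_close T (grid_step T (Suc N) p) f (h + h)"
      by (rule skorokhod_close_trans[OF skorokhod_close_sym[OF sample_near_close[OF T _ _ p]] N0(1)])
        (use h N in auto)
    moreover have "skorokhod_close T g (grid_step T (Suc N) q) (h + h)"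
      by (rule skorokhod_close_trans[OF skorokhod_close_sym[OF N0(2)] sample_near_close[OF T _ _ q]])
        (use h N in auto)
    ultimately have "skorokhod_close T (grid_step T (Suc N) p) (grid_step T (Suc N) q) (((h + h) + c) + (h + h))"
      using c(2) skorokhod_close_trans by blast
    then have "skorokhod_close T (grid_step T (Suc N) p) (grid_step T (Suc N) q) (e - 5 / Suc m)"
    proof (rule skorokhod_close_mono)
      have eq: "5 / Suc m = 5 * h" by (simp add: h_def)
      have "h < (e - c) / 10" using m by (simp add: h_def)
      then show "((h + h) + c) + (h + h) \<le> e - 5 / Suc m" using h unfolding eq by simp
    qed
    then show "samples_close T f g e m N"
      using p q unfolding samples_close_def h_def by blast
  qed
next
  assume ?R
  then obtain m N0 where m: "\<And>N. N \<in> {N0..} \<Longrightarrow> samples_close T f g e m N" by blast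
  define h where "h = 1 / real (Suc m)"
  have h: "h > 0" by (simp add: h_def)
  from eventually_conj[OF skorokhod_close_sample[OF T f h] skorokhod_close_sample[OF T g h]]
  obtain N1 where N1: "\<And>N. N \<ge> N1 \<Longrightarrow> skorokhod_close T (\<lambda>t. f (grid_floor T N t)) f h"
    "\<And>N. N \<ge> N1 \<Longrightarrow> skorokhod_close T (\<lambda>t. g (grid_floor T N t)) g h"
    unfolding eventually_sequentially by blast
  define N where "N = max N0 N1"
  obtain p q where pq: "sample_near T (Suc N) h f p" "sample_near T (Suc N) h g q"
      "skorokhod_close T (grid_step T (Suc N) p) (grid_step T (Suc N) q) (e - 5 * h)"
    using m[of N] by (auto simp: N_def h_def samples_close_def)
  have "skorokhod_close T f (grid_step T (Suc N) p) (h + h)"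
    by (rule skorokhod_close_trans[OF skorokhod_close_sym[OF N1(1)] sample_near_close[OF T _ less_imp_le[OF h] pq(1)]])
      (auto simp: N_def)
  moreover have "skorokhod_close T (grid_step T (Suc N) q) g (h + h)"
    by (rule skorokhod_close_sym, rule skorokhod_close_trans[OF skorokhod_close_sym[OF N1(2)] sample_near_close[OF T _ less_imp_le[OF h] pq(2)]])
      (auto simp: N_def)
  ultimately have "skorokhod_close T f g (((h + h) + (e - 5 * h)) + (h + h))"
    using pq(3) skorokhod_close_trans by blast
  \<comment> \<open>The fifth \<open>h\<close> of the slack makes the inequality strict.\<close>
  then show ?L
    using h by (intro exI[of _ "e - h"]) (simp add: algebra_simps)
qed

lemma skorokhod_dist_measurable:
  assumes T: "T > 0" and Y: "cadlag_process M T Y" and Z: "cadlag_process M T Z"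
  shows "{w\<in>space M. skorokhod_dist T (\<lambda>t. Y t w) (\<lambda>t. Z t w) < e} \<in> sets M"
proof -
  have near: "{w\<in>space M. sample_near T (Suc N) h (\<lambda>t. V t w) p} \<in> sets M"
    if V: "cadlag_process M T V" for V N h p
  proof -
    have "V (i * T / Suc N) \<in> borel_measurable M" if "i \<le> Suc N" for i
    proof -
      have "real i * T \<le> real (Suc N) * T" using that T by (intro mult_right_mono) auto
      then have "i * T / Suc N \<le> T" by (simp add: divide_le_eq mult.commute)
      then show ?thesis using V T by (auto simp: cadlag_process_def)
    qed
    then have "{w\<in>space M. \<bar>V (i * T / Suc N) w - real_of_rat (p ! i)\<bar> \<le> h} \<in> sets M" if "i \<le> Suc N" for i
      using that by measurable
    then show ?thesis
      unfolding sample_near_def by (intro sets.sets_Collect_finite_All) auto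
  qed
  have "{w\<in>space M. \<exists>m N0. \<forall>N\<in>{N0..}. samples_close T (\<lambda>t. Y t w) (\<lambda>t. Z t w) e m N} \<in> sets M"
    unfolding samples_close_def
    by (intro sets.sets_Collect_countable_Ex sets.sets_Collect_countable_Ball sets.sets_Collect_conj
        near Y Z sets.sets_Collect_const)
  also have "{w\<in>space M. \<exists>m N0. \<forall>N\<in>{N0..}. samples_close T (\<lambda>t. Y t w) (\<lambda>t. Z t w) e m N} =
     {w\<in>space M. skorokhod_dist T (\<lambda>t. Y t w) (\<lambda>t. Z t w) < e}"
    by (intro Collect_cong conj_cong refl, subst skorokhod_dist_less_iff, use Y Z T in
        \<open>auto simp only: cadlag_process_def ex_skorokhod_close_iff\<close>)
  finally show ?thesis .
qed

text \<open>Outside events of vanishing probability the paths are matched by a time change. By measurability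
  of the distance the exceptional sets are events.\<close>

lemma skorokhod_tendsto_in_prob_close:
  assumes "prob_space M" and T: "T > 0"
    and Yn: "\<And>n. cadlag_process M T (Yn n)" and Y: "cadlag_process M T Y"
    and conv: "skorokhod_tendsto_in_prob M T Yn Y" and e: "e > 0"
  obtains D where "\<And>n. D n \<in> sets M" "(\<lambda>n. measure M (D n)) \<longlonglongrightarrow> 0"
    "\<And>n w. w \<in> space M - D n \<Longrightarrow>
       \<exists>l\<in>time_changes T. \<forall>t\<in>{0..T}. \<bar>l t - t\<bar> < e \<and> \<bar>Yn n t w - Y (l t) w\<bar> < e"
proof
  interpret prob_space M by fact
  let ?D = "\<lambda>n. {w\<in>space M. skorokhod_dist T (\<lambda>t. Yn n t w) (\<lambda>t. Y t w) \<ge> e}"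
  show "?D n \<in> sets M" for n
  proof -
    have "?D n = space M - {w\<in>space M. skorokhod_dist T (\<lambda>t. Yn n t w) (\<lambda>t. Y t w) < e}" by auto
    then show ?thesis using skorokhod_dist_measurable[OF T Yn Y] by auto
  qed
  show "(\<lambda>n. prob (?D n)) \<longlonglongrightarrow> 0"
    using conv e by (auto simp: skorokhod_tendsto_in_prob_def)
  show "\<exists>l\<in>time_changes T. \<forall>t\<in>{0..T}. \<bar>l t - t\<bar> < e \<and> \<bar>Yn n t w - Y (l t) w\<bar> < e"
    if "w \<in> space M - ?D n" for n w
  proof -
    have "skorokhod_dist T (\<lambda>t. Yn n t w) (\<lambda>t. Y t w) < e" using that by auto
    then have "\<exists>c<e. skorokhod_close T (\<lambda>t. Yn n t w) (\<lambda>t. Y t w) c"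
      using T Yn[of n] Y that by (subst (asm) skorokhod_dist_less_iff) (auto simp: cadlag_process_def)
    then show ?thesis
      unfolding skorokhod_close_def by (meson le_less_trans)
  qed
qed

section \<open>Cadlag processes at random times and at fixed times\<close>

lemma tendsto_zero_if_eventually_small:
  fixes a :: "nat \<Rightarrow> real"
  assumes "\<And>n. 0 \<le> a n" "\<And>e. e > 0 \<Longrightarrow> \<forall>\<^sub>F n in sequentially. a n < e"
  shows "a \<longlonglongrightarrow> 0"
  using assms by (auto intro!: order_tendstoI intro: always_eventually less_le_trans)

lemma (in prob_space) prob_subset_Un_le:
  assumes "A \<subseteq> B \<union> C" "B \<in> events" "C \<in> events"
  shows "prob A \<le> prob B + prob C"
proof -
  have "prob A \<le> prob (B \<union> C)" using assms by (intro finite_measure_mono) auto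
  also have "\<dots> \<le> prob B + prob C" using assms by (intro measure_Un_le)
  finally show ?thesis .
qed

lemma tendsto_if_between_inverse:
  fixes t :: real
  assumes "\<And>k. t \<le> s k" "\<And>k. s k \<le> t + 1 / real (Suc k)"
  shows "s \<longlonglongrightarrow> t"
proof -
  have "(\<lambda>k. t + 1 / real (Suc k)) \<longlonglongrightarrow> t + 0"
    by (intro tendsto_intros LIMSEQ_Suc[OF lim_1_over_n])
  then have lim: "(\<lambda>k. t + 1 / real (Suc k)) \<longlonglongrightarrow> t" by simp
  show ?thesis
    by (rule tendsto_sandwich[OF always_eventually always_eventually tendsto_const lim]) (use assms in blast)+
qed

lemma cadlag_on_tendsto_right:
  assumes f: "cadlag_on T f" and t: "t \<in> {0..T}" and s: "s \<longlonglongrightarrow> t" "\<And>n. s n \<in> {t..T}"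
  shows "(\<lambda>n. f (s n)) \<longlonglongrightarrow> f t"
proof (rule tendstoI)
  fix e :: real assume "e > 0"
  from cadlag_on_oscillation[OF f t this] obtain d where d: "d > 0"
    "\<And>s u. s \<in> {t..<t+d} \<Longrightarrow> u \<in> {t..<t+d} \<Longrightarrow> s \<le> T \<Longrightarrow> u \<le> T \<Longrightarrow> \<bar>f s - f u\<bar> < e"
    by metis
  have "\<forall>\<^sub>F n in sequentially. s n < t + d"
    using s(1) d by (intro order_tendstoD(2)) auto
  then show "\<forall>\<^sub>F n in sequentially. dist (f (s n)) (f t) < e"
    by eventually_elim (use s(2) t d in \<open>auto simp: dist_real_def intro!: d(2)\<close>)
qed

text \<open>A random time is the limit from the right of random times with countably many values.\<close>

lemma cadlag_process_at_random_time_measurable: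
  assumes Y: "cadlag_process M T Y" and \<tau>: "\<tau> \<in> borel_measurable M" "\<And>w. w \<in> space M \<Longrightarrow> \<tau> w \<in> {0..T}"
  shows "(\<lambda>w. Y (\<tau> w) w) \<in> borel_measurable M"
proof (cases "0 \<le> T")
  case T: True
  define r where "r N k = max 0 (min T ((of_int k + 1) / real (Suc N)))" for N and k :: int
  have meas: "(\<lambda>w. Y (r N \<lfloor>\<tau> w * real (Suc N)\<rfloor>) w) \<in> borel_measurable M" for N
  proof (rule measurable_compose_countable)
    show "Y (r N k) \<in> borel_measurable M" for k
      using Y T by (auto simp: cadlag_process_def r_def)
    show "(\<lambda>w. \<lfloor>\<tau> w * real (Suc N)\<rfloor>) \<in> measurable M (count_space UNIV)"
      using \<tau>(1) by measurable
  qed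
  show ?thesis
  proof (rule borel_measurable_LIMSEQ_real[OF _ meas])
    fix w assume w: "w \<in> space M"
    let ?s = "\<lambda>N. r N \<lfloor>\<tau> w * real (Suc N)\<rfloor>"
    have t: "\<tau> w \<in> {0..T}" using \<tau>(2) w by simp
    have s: "\<tau> w \<le> ?s N \<and> ?s N \<le> T \<and> ?s N \<le> \<tau> w + 1 / real (Suc N)" for N
    proof -
      define k where "k = \<lfloor>\<tau> w * real (Suc N)\<rfloor>"
      have k: "\<tau> w * real (Suc N) < of_int k + 1" "of_int k \<le> \<tau> w * real (Suc N)"
        unfolding k_def by linarith+
      have "\<tau> w \<le> (of_int k + 1) / real (Suc N)"
        using k(1) by (simp add: le_divide_eq)
      moreover have "(of_int k + 1) / real (Suc N) \<le> \<tau> w + 1 / real (Suc N)"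
        using k(2) by (simp add: divide_le_eq distrib_right)
      ultimately have "\<tau> w \<le> r N k \<and> r N k \<le> T \<and> r N k \<le> \<tau> w + 1 / real (Suc N)"
        using t by (auto simp: r_def)
      then show ?thesis by (simp only: k_def)
    qed
    have "?s \<longlonglongrightarrow> \<tau> w" using s by (intro tendsto_if_between_inverse) blast+
    then show "(\<lambda>N. Y (?s N) w) \<longlonglongrightarrow> Y (\<tau> w) w"
      using s t Y w by (intro cadlag_on_tendsto_right[of T "\<lambda>t. Y t w"]) (auto simp: cadlag_process_def)
  qed
next
  case False
  then have "space M = {}" using \<tau>(2) by force
  then show ?thesis by (simp add: measurable_def)
qed

lemma (in prob_space) cadlag_process_bounded_in_prob:
  assumes T: "0 \<le> T" and Y: "cadlag_process M T Y" and e: "e > 0"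
  obtains B and R :: real where "B \<in> events" "prob B < e"
    "\<And>w t. w \<in> space M - B \<Longrightarrow> t \<in> {0..T} \<Longrightarrow> \<bar>Y t w\<bar> \<le> R"
proof -
  have Ym [measurable]: "Y q \<in> borel_measurable M" if "q \<in> dense_times T" for q
    using Y that dense_times_subset[OF T] by (auto simp: cadlag_process_def)
  define B where "B n = {w\<in>space M. \<exists>q\<in>dense_times T. \<bar>Y q w\<bar> > real n}" for n
  have lev: "{w \<in> space M. real n < \<bar>Y q w\<bar>} \<in> events" if "q \<in> dense_times T" for q n
    using Ym[OF that] by measurable
  have B: "B n \<in> events" for n
    unfolding B_def by (rule sets.sets_Collect_countable_Ex'[OF lev countable_dense_times])
  have "(\<lambda>n. prob (B n)) \<longlonglongrightarrow> prob (\<Inter>n. B n)"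
    using B by (intro finite_Lim_measure_decseq) (force simp: B_def decseq_def)+
  moreover have "(\<Inter>n. B n) = {}"
  proof (rule ccontr)
    assume "(\<Inter>n. B n) \<noteq> {}"
    then obtain w where w: "w \<in> space M" "\<And>n. \<exists>q\<in>dense_times T. \<bar>Y q w\<bar> > real n"
      by (auto simp: B_def)
    obtain K where "\<And>t. t \<in> {0..T} \<Longrightarrow> \<bar>Y t w\<bar> \<le> K"
      using cadlag_on_bounded[of T "\<lambda>t. Y t w"] Y w by (auto simp: cadlag_process_def)
    moreover obtain n where "K < real n" using reals_Archimedean2 by blast
    ultimately show False using w(2)[of n] dense_times_subset[OF T] by fastforce
  qed
  ultimately have "(\<lambda>n. prob (B n)) \<longlonglongrightarrow> 0" by simp
  then have "\<forall>\<^sub>F n in sequentially. prob (B n) < e"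
    using e by (rule order_tendstoD(2))
  then obtain n where n: "prob (B n) < e" by (auto dest: eventually_happens)
  show ?thesis
  proof (rule that[OF B n])
    fix w t assume w: "w \<in> space M - B n" and t: "t \<in> {0..T}"
    show "\<bar>Y t w\<bar> \<le> real n + 1"
    proof -
      have "cadlag_on T (\<lambda>t. Y t w)" using Y w by (auto simp: cadlag_process_def)
      from cadlag_on_dense_times[OF this t zero_less_one]
      obtain q where "q \<in> dense_times T" "\<bar>Y q w - Y t w\<bar> < 1" by blast
      moreover from this have "\<bar>Y q w\<bar> \<le> real n" using w by (force simp: B_def)
      ultimately show ?thesis by linarith
    qed
  qed
qed

text \<open>Only countably many times near \<open>t\<close> are inspected, which makes this an event; by right-continuity
  they stand for all times near \<open>t\<close>.\<close>

definition moves_near :: "'a measure \<Rightarrow> real \<Rightarrow> (real \<Rightarrow> 'a \<Rightarrow> real) \<Rightarrow> real \<Rightarrow> real \<Rightarrow> real \<Rightarrow> 'a set" where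
  "moves_near M T Y t d c = {w\<in>space M. \<exists>q\<in>dense_times T. \<bar>q - t\<bar> < d \<and> \<bar>Y q w - Y t w\<bar> > c}"

text \<open>The times at which the path jumps with positive probability. As \<open>m\<close> grows, the events below
  decrease to an event that contains the jumps larger than \<open>c\<close> and consists of jumps of size at least
  \<open>c\<close>. One constant serves as a bound for size and probability.\<close>

definition fixed_discontinuities :: "'a measure \<Rightarrow> real \<Rightarrow> (real \<Rightarrow> 'a \<Rightarrow> real) \<Rightarrow> real set" where
  "fixed_discontinuities M T Y =
     {t\<in>{0..T}. \<exists>c>0. \<forall>m. c \<le> measure M (moves_near M T Y t (1 / Suc m) c)}"

lemma moves_near_sets:
  assumes T: "0 \<le> T" and Y: "cadlag_process M T Y" and t: "t \<in> {0..T}"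
  shows "moves_near M T Y t d c \<in> sets M"
proof -
  have lev: "{w \<in> space M. \<bar>q - t\<bar> < d \<and> c < \<bar>Y q w - Y t w\<bar>} \<in> sets M" if "q \<in> dense_times T" for q
  proof -
    have "Y q \<in> borel_measurable M" "Y t \<in> borel_measurable M"
      using Y t that dense_times_subset[OF T] by (auto simp: cadlag_process_def)
    then show ?thesis by measurable
  qed
  show ?thesis
    unfolding moves_near_def by (rule sets.sets_Collect_countable_Ex'[OF lev countable_dense_times])
qed

lemma moves_near_mono: "d \<le> d' \<Longrightarrow> c' \<le> c \<Longrightarrow> moves_near M T Y t d c \<subseteq> moves_near M T Y t d' c'"
  unfolding moves_near_def by force

text \<open>If the jumps at infinitely many times were larger than a fixed size with a probability bounded
  below, these times would accumulate from one side, and with positive probability the path would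
  have no limit from that side.\<close>

lemma (in prob_space) countable_fixed_discontinuities:
  assumes T: "0 \<le> T" and Y: "cadlag_process M T Y"
  shows "countable (fixed_discontinuities M T Y)"
proof -
  note sets = moves_near_sets[OF T Y]
  define Bad where "Bad j = {t\<in>{0..T}. \<forall>m. 1 / Suc j \<le> prob (moves_near M T Y t (1 / Suc m) (1 / Suc j))}" for j
  have "finite (Bad j)" for j
  proof (rule ccontr)
    assume inf: "infinite (Bad j)"
    have "Bad j \<subseteq> {0..T}" by (auto simp: Bad_def)
    then obtain x where x: "x \<in> {0..T}" "x islimpt (Bad j)"
      using inf compact_Icc[of 0 T] unfolding compact_eq_Bolzano_Weierstrass by blast
    have "Bad j \<subseteq> insert x ((Bad j \<inter> {..<x}) \<union> (Bad j \<inter> {x<..}))" by auto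
    then have "x islimpt insert x ((Bad j \<inter> {..<x}) \<union> (Bad j \<inter> {x<..}))"
      using x(2) islimpt_subset by blast
    then consider "x islimpt (Bad j \<inter> {..<x})" | "x islimpt (Bad j \<inter> {x<..})"
      unfolding islimpt_insert islimpt_Un by blast
    \<comment> \<open>All \<open>t i\<close> lie on one side of \<open>x\<close>, where the path has a limit.\<close>
    then obtain t where t: "\<And>i. t i \<in> Bad j" "t \<longlonglongrightarrow> x" "(\<forall>i. t i < x) \<or> (\<forall>i. x < t i)"
    proof cases
      case 1 then show ?thesis unfolding islimpt_sequential by (auto intro: that)
    next
      case 2 then show ?thesis unfolding islimpt_sequential by (auto intro: that)
    qed
    have "\<exists>m. 1 / real (Suc m) < \<bar>t i - x\<bar>" for i
    proof -
      have "\<bar>t i - x\<bar> > 0" using t(3) by (auto simp: less_imp_neq dest: spec[of _ i])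
      then show ?thesis using nat_approx_posE by blast
    qed
    \<comment> \<open>Windows so small that they stay on the same side of \<open>x\<close>.\<close>
    then obtain m where m: "\<And>i. 1 / real (Suc (m i)) < \<bar>t i - x\<bar>" by metis
    define J where "J i = moves_near M T Y (t i) (1 / Suc (m i)) (1 / Suc j)" for i
    have J: "J i \<in> events" "1 / Suc j \<le> prob (J i)" for i
      using t(1)[of i] sets by (auto simp: J_def Bad_def)
    have "(\<lambda>i. indicator (J i) w :: real) \<longlonglongrightarrow> 0" if w: "w \<in> space M" for w
    proof -
      have "cadlag_on T (\<lambda>t. Y t w)" using Y w by (auto simp: cadlag_process_def)
      from cadlag_on_oscillation[OF this x(1), of "1 / Suc j"]
      obtain d where d: "d > 0"
        "\<And>s u. s \<in> {x..<x+d} \<Longrightarrow> u \<in> {x..<x+d} \<Longrightarrow> s \<le> T \<Longrightarrow> u \<le> T \<Longrightarrow> \<bar>Y s w - Y u w\<bar> < 1 / Suc j"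
        "\<And>s u. s \<in> {x-d<..<x} \<Longrightarrow> u \<in> {x-d<..<x} \<Longrightarrow> 0 \<le> s \<Longrightarrow> 0 \<le> u \<Longrightarrow> \<bar>Y s w - Y u w\<bar> < 1 / Suc j"
        by auto
      have "\<forall>\<^sub>F i in sequentially. dist (t i) x < d / 2"
        using t(2) d(1) by (intro tendstoD) auto
      then have "\<forall>\<^sub>F i in sequentially. indicator (J i) w = (0 :: real)"
      proof eventually_elim
        case (elim i)
        have "w \<notin> J i"
        proof
          assume "w \<in> J i"
          then obtain q where q: "q \<in> {0..T}" "\<bar>q - t i\<bar> < \<bar>t i - x\<bar>" "\<bar>Y q w - Y (t i) w\<bar> > 1 / Suc j"
            using m[of i] dense_times_subset[OF T] by (force simp: J_def moves_near_def)
          have ti: "t i \<in> {0..T}" using t(1)[of i] by (auto simp: Bad_def)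
          have dd: "\<bar>t i - x\<bar> * 2 < d" using elim by (simp add: dist_real_def)
          from t(3) show False
          proof
            assume "\<forall>i. t i < x"
            then have "t i < x" by simp
            then have "q \<in> {x-d<..<x}" "t i \<in> {x-d<..<x}" using q(2) dd by auto
            then show False using d(3)[of q "t i"] q ti by auto
          next
            assume "\<forall>i. x < t i"
            then have "x < t i" by simp
            then have "q \<in> {x..<x+d}" "t i \<in> {x..<x+d}" using q(2) dd by auto
            then show False using d(2)[of q "t i"] q ti by auto
          qed
        qed
        then show ?case by simp
      qed
      then show ?thesis by (rule tendsto_eventually)
    qed
    then have "(\<lambda>i. \<integral>w. indicator (J i) w \<partial>M) \<longlonglongrightarrow> (\<integral>w. (0::real) \<partial>M)"
      using J(1) by (intro integral_dominated_convergence[where w = "\<lambda>_. 1"]) (auto simp: indicator_def)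
    then have "(\<lambda>i. prob (J i)) \<longlonglongrightarrow> 0"
      using J(1) sets.sets_into_space by (simp add: Int_absorb1 measure_def)
    then have "1 / real (Suc j) \<le> 0"
      using J(2) by (intro LIMSEQ_le_const) auto
    then show False by simp
  qed
  then have "countable (\<Union>j. Bad j)" by (intro countable_UN) (auto intro: countable_finite)
  moreover have "fixed_discontinuities M T Y \<subseteq> (\<Union>j. Bad j)"
  proof
    fix t assume "t \<in> fixed_discontinuities M T Y"
    then obtain c where t: "t \<in> {0..T}" "c > 0" "\<And>m. c \<le> prob (moves_near M T Y t (1 / Suc m) c)"
      by (auto simp: fixed_discontinuities_def)
    obtain j where j: "1 / real (Suc j) < c" using nat_approx_posE[OF t(2)] .
    have "1 / real (Suc j) \<le> prob (moves_near M T Y t (1 / Suc m) (1 / Suc j))" for m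
    proof -
      have "prob (moves_near M T Y t (1 / Suc m) c) \<le> prob (moves_near M T Y t (1 / Suc m) (1 / Suc j))"
        using j by (intro finite_measure_mono moves_near_mono sets t) auto
      then show ?thesis using t(3)[of m] j by linarith
    qed
    then show "t \<in> (\<Union>j. Bad j)" using t by (auto simp: Bad_def)
  qed
  ultimately show ?thesis using countable_subset by blast
qed

definition (in prob_space) tendsto_in_prob :: "(nat \<Rightarrow> 'a \<Rightarrow> real) \<Rightarrow> ('a \<Rightarrow> real) \<Rightarrow> bool" where
  "tendsto_in_prob Zn Z \<longleftrightarrow> (\<forall>c>0. (\<lambda>n. prob {w\<in>space M. \<bar>Zn n w - Z w\<bar> \<ge> c}) \<longlonglongrightarrow> 0)"

text \<open>At \<open>t\<close>, the value of the approximating path is close to the value of the limit path at a time near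
  \<open>t\<close>, hence close to its value at \<open>t\<close> unless the limit path moves there. For \<open>t = T\<close> that nearby time is
  \<open>T\<close> itself.\<close>

lemma (in prob_space) tendsto_in_prob_at_time:
  assumes T: "T > 0" and Yn: "\<And>n. cadlag_process M T (Yn n)" and Y: "cadlag_process M T Y"
    and conv: "skorokhod_tendsto_in_prob M T Yn Y"
    and t: "t \<in> insert T ({0..T} - fixed_discontinuities M T Y)"
  shows "tendsto_in_prob (\<lambda>n. Yn n t) (Y t)"
  unfolding tendsto_in_prob_def
proof (intro allI impI)
  fix c :: real assume c: "c > 0"
  have tT: "t \<in> {0..T}" using t T by auto
  have "\<exists>J d. J \<in> events \<and> prob J < e \<and> d > 0 \<and>
     (\<forall>w\<in>space M - J. \<forall>l\<in>time_changes T. \<bar>l t - t\<bar> < d \<longrightarrow> \<bar>Y (l t) w - Y t w\<bar> < 2 * c / 3)"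
    if e: "e > 0" for e
  proof (cases "t = T")
    case True
    have "\<bar>Y (l t) w - Y t w\<bar> < 2 * c / 3" if "l \<in> time_changes T" for l w
      using time_changes_endpoint[OF _ that] T True c by simp
    then show ?thesis
      using e by (intro exI[of _ "{}"] exI[of _ 1]) simp
  next
    case False
    have "min e (c / 3) > 0" using e c by simp
    then obtain m where "prob (moves_near M T Y t (1 / Suc m) (min e (c / 3))) < min e (c / 3)"
      using False t unfolding fixed_discontinuities_def not_le[symmetric] by blast
    moreover have "prob (moves_near M T Y t (1 / Suc m) (c / 3)) \<le> prob (moves_near M T Y t (1 / Suc m) (min e (c / 3)))"
      using T by (intro finite_measure_mono moves_near_mono moves_near_sets Y tT) auto
    ultimately have m: "prob (moves_near M T Y t (1 / Suc m) (c / 3)) < e" by linarith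
    show ?thesis
    proof (intro exI[of _ "moves_near M T Y t (1 / Suc m) (c / 3)"] exI[of _ "1 / real (Suc m)"] conjI ballI impI m)
      show "moves_near M T Y t (1 / Suc m) (c / 3) \<in> events"
        using T by (intro moves_near_sets Y tT) simp
      fix w l assume w: "w \<in> space M - moves_near M T Y t (1 / Suc m) (c / 3)"
        and l: "l \<in> time_changes T" "\<bar>l t - t\<bar> < 1 / real (Suc m)"
      have f: "cadlag_on T (\<lambda>t. Y t w)" using Y w by (auto simp: cadlag_process_def)
      define a b where "a = c / 3" and "b = 1 / real (Suc m)"
      have "min a (b - \<bar>l t - t\<bar>) > 0" using c l by (simp add: a_def b_def)
      from cadlag_on_dense_times[OF f time_changes_mem[OF l(1) tT] this]
      obtain q where q: "q \<in> dense_times T" "l t \<le> q" "q < l t + min a (b - \<bar>l t - t\<bar>)"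
        "\<bar>Y q w - Y (l t) w\<bar> < min a (b - \<bar>l t - t\<bar>)"
        by blast
      have "\<bar>q - t\<bar> < b" "\<bar>Y q w - Y (l t) w\<bar> < a" using q(2-4) by linarith+
      then have "\<bar>q - t\<bar> < 1 / real (Suc m)" "\<bar>Y q w - Y (l t) w\<bar> < c / 3"
        by (simp_all only: a_def b_def)
      note q = q(1) this
      then have "\<not> \<bar>Y q w - Y t w\<bar> > c / 3" using w q(1,2) unfolding moves_near_def by blast
      then show "\<bar>Y (l t) w - Y t w\<bar> < 2 * c / 3" using q(3) by (simp add: abs_if split: if_splits)
    qed simp
  qed
  note J_ex = this
  show "(\<lambda>n. prob {w\<in>space M. \<bar>Yn n t w - Y t w\<bar> \<ge> c}) \<longlonglongrightarrow> 0"
  proof (rule tendsto_zero_if_eventually_small)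
    fix e :: real assume e: "e > 0"
    from J_ex[of "e / 2"] e obtain J d where J: "J \<in> events" "prob J < e / 2" "d > 0"
       and Jd: "\<And>w l. w\<in>space M - J \<Longrightarrow> l\<in>time_changes T \<Longrightarrow> \<bar>l t - t\<bar> < d \<Longrightarrow> \<bar>Y (l t) w - Y t w\<bar> < 2 * c / 3"
      by auto
    have "min d (c / 3) > 0" using J c by simp
    from skorokhod_tendsto_in_prob_close[OF prob_space_axioms T Yn Y conv this]
    obtain D where D: "\<And>n. D n \<in> events" "(\<lambda>n. prob (D n)) \<longlonglongrightarrow> 0"
      "\<And>n w. w \<in> space M - D n \<Longrightarrow>
       \<exists>l\<in>time_changes T. \<forall>t\<in>{0..T}. \<bar>l t - t\<bar> < min d (c / 3) \<and> \<bar>Yn n t w - Y (l t) w\<bar> < min d (c / 3)"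
      by auto
    have "e / 2 > 0" using e by simp
    from order_tendstoD(2)[OF D(2) this]
    show "\<forall>\<^sub>F n in sequentially. prob {w\<in>space M. \<bar>Yn n t w - Y t w\<bar> \<ge> c} < e"
    proof eventually_elim
      case (elim n)
      have "{w\<in>space M. \<bar>Yn n t w - Y t w\<bar> \<ge> c} \<subseteq> D n \<union> J"
      proof (rule ccontr)
        assume "\<not> ?thesis"
        then obtain w where w: "w \<in> space M - D n" "w \<in> space M - J" "\<bar>Yn n t w - Y t w\<bar> \<ge> c" by auto
        from D(3)[OF w(1)] tT obtain l where l: "l \<in> time_changes T" "\<bar>l t - t\<bar> < d"
          "\<bar>Yn n t w - Y (l t) w\<bar> < c / 3" by auto
        from Jd[OF w(2) l(1,2)] l(3) w(3) show False by (simp add: abs_if split: if_splits)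
      qed
      from prob_subset_Un_le[OF this D(1) J(1)] show ?case using elim J(2) by simp
    qed
  qed simp
qed

section \<open>Comparison of expected rewards\<close>

abbreviation L1_dist :: "'a measure \<Rightarrow> ('a \<Rightarrow> real) \<Rightarrow> ('a \<Rightarrow> real) \<Rightarrow> real" where
  "L1_dist M f g \<equiv> \<integral>w. \<bar>f w - g w\<bar> \<partial>M"

lemma (in prob_space) abs_expectation_diff_le:
  assumes f: "f \<in> borel_measurable M" and g: "g \<in> borel_measurable M" and B: "B \<in> events"
    and K: "AE w in M. \<bar>f w - g w\<bar> \<le> K" and e: "e \<ge> 0" "K \<ge> 0"
    and diff: "\<And>w. w \<in> space M - B \<Longrightarrow> \<bar>f w - g w\<bar> \<le> e"
  shows "L1_dist M f g \<le> e + K * prob B"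
proof -
  have "L1_dist M f g \<le> (\<integral>w. e + K * indicator B w \<partial>M)"
  proof (rule integral_mono_AE)
    show "integrable M (\<lambda>w. \<bar>f w - g w\<bar>)"
      using K f g by (intro integrable_const_bound[where B = K]) auto
    show "integrable M (\<lambda>w. e + K * indicator B w)"
      using B by (intro Bochner_Integration.integrable_add integrable_const integrable_mult_right integrable_real_indicator)
        (auto simp: emeasure_eq_measure)
    show "AE w in M. \<bar>f w - g w\<bar> \<le> e + K * indicator B w"
      using K AE_space
    proof eventually_elim
      case (elim w)
      then show ?case using e diff[of w] by (cases "w \<in> B") auto
    qed
  qed
  also have "\<dots> = e + K * prob B"
    using B by (subst Bochner_Integration.integral_add)
      (auto simp: prob_space emeasure_eq_measure sets.sets_into_space Int_absorb2)
  finally show ?thesis .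
qed

lemma (in prob_space) expectation_diff_le:
  assumes "integrable M f" "integrable M g" "B \<in> events" "\<And>w. w \<in> space M \<Longrightarrow> \<bar>f w - g w\<bar> \<le> K" "e \<ge> 0" "K \<ge> 0"
    and "\<And>w. w \<in> space M - B \<Longrightarrow> \<bar>f w - g w\<bar> \<le> e"
  shows "(\<integral>w. f w \<partial>M) \<le> (\<integral>w. g w \<partial>M) + e + K * prob B"
proof -
  have "(\<integral>w. f w \<partial>M) \<le> (\<integral>w. g w + \<bar>f w - g w\<bar> \<partial>M)"
    using assms(1,2) by (intro integral_mono) auto
  also have "\<dots> = (\<integral>w. g w \<partial>M) + L1_dist M f g"
    using assms(1,2) by (intro Bochner_Integration.integral_add) auto
  also have "L1_dist M f g \<le> e + K * prob B"
    using assms by (intro abs_expectation_diff_le) auto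
  finally show ?thesis by simp
qed

lemma (in prob_space) tendsto_in_prob_imp_L1:
  assumes conv: "tendsto_in_prob Zn Z" and Zn: "\<And>n. Zn n \<in> borel_measurable M" and Z: "Z \<in> borel_measurable M"
    and K: "\<And>n. AE w in M. \<bar>Zn n w - Z w\<bar> \<le> K" "K \<ge> 0"
  shows "(\<lambda>n. \<integral>w. \<bar>Zn n w - Z w\<bar> \<partial>M) \<longlonglongrightarrow> 0"
proof (rule tendsto_zero_if_eventually_small)
  fix e :: real assume e: "e > 0"
  define B where "B n = {w\<in>space M. \<bar>Zn n w - Z w\<bar> \<ge> e / 2}" for n
  have B: "B n \<in> events" for n
    unfolding B_def using Zn[of n] Z by measurable
  have "(\<lambda>n. prob (B n)) \<longlonglongrightarrow> 0"
    using conv e half_gt_zero[OF e] unfolding tendsto_in_prob_def B_def by blast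
  then have "(\<lambda>n. K * prob (B n)) \<longlonglongrightarrow> K * 0" by (intro tendsto_intros)
  then have "\<forall>\<^sub>F n in sequentially. K * prob (B n) < e / 2"
    using e by (intro order_tendstoD(2)) auto
  then show "\<forall>\<^sub>F n in sequentially. (\<integral>w. \<bar>Zn n w - Z w\<bar> \<partial>M) < e"
  proof eventually_elim
    case (elim n)
    have "(\<integral>w. \<bar>Zn n w - Z w\<bar> \<partial>M) \<le> e / 2 + K * prob (B n)"
      using K e by (intro abs_expectation_diff_le Zn Z B) (auto simp: B_def)
    then show ?case using elim by simp
  qed
qed simp

lemma reward_measurable:
  fixes \<gamma> :: "real \<times> real \<Rightarrow> real"
  assumes \<gamma>: "continuous_on ({0..T} \<times> UNIV) \<gamma>" and \<tau>: "\<tau> \<in> borel_measurable N" "\<And>w. w \<in> space N \<Longrightarrow> \<tau> w \<in> {0..T}"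
    and Z: "Z \<in> borel_measurable N"
  shows "(\<lambda>w. \<gamma> (\<tau> w, Z w)) \<in> borel_measurable N"
proof (cases "0 \<le> T")
  case True
  have "(\<lambda>w. \<gamma> (max 0 (min T (\<tau> w)), Z w)) \<in> borel_measurable N"
    using True
    by (intro borel_measurable_continuous_Pair[where H = "\<lambda>t x. \<gamma> (max 0 (min T t), x)", OF \<tau>(1) Z]
        continuous_on_compose2[OF \<gamma>] continuous_intros) auto
  moreover have "\<gamma> (max 0 (min T (\<tau> w)), Z w) = \<gamma> (\<tau> w, Z w)" if "w \<in> space N" for w
    using \<tau>(2)[OF that] by simp
  ultimately show ?thesis by (simp cong: measurable_cong)
next
  case False
  then have "space N = {}" using \<tau>(2) by force
  then show ?thesis by (simp add: measurable_def)
qed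

section \<open>Convergence of conditional expectations\<close>

lemma (in prob_space) sigma_finite_subalgebraI:
  assumes "subalgebra M G" shows "sigma_finite_subalgebra M G"
proof -
  interpret finite_measure_subalgebra M G by unfold_locales fact
  show ?thesis by (rule sigma_finite_subalgebra_axioms)
qed

lemma (in prob_space) cond_exp_L1_contraction:
  assumes "subalgebra M G" "integrable M U" "integrable M V"
  shows "L1_dist M (real_cond_exp M G U) (real_cond_exp M G V) \<le> L1_dist M U V"
proof -
  interpret sigma_finite_subalgebra M G by (rule sigma_finite_subalgebraI) fact
  note int = real_cond_exp_int(1)
  have d: "integrable M (\<lambda>w. U w - V w)" using assms by simp
  have "L1_dist M (real_cond_exp M G U) (real_cond_exp M G V)
      \<le> (\<integral>w. real_cond_exp M G (\<lambda>w. \<bar>U w - V w\<bar>) w \<partial>M)"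
  proof (rule integral_mono_AE)
    have "AE w in M. real_cond_exp M G (\<lambda>w. U w - V w) w \<le> real_cond_exp M G (\<lambda>w. \<bar>U w - V w\<bar>) w"
      "AE w in M. real_cond_exp M G (\<lambda>w. - \<bar>U w - V w\<bar>) w \<le> real_cond_exp M G (\<lambda>w. U w - V w) w"
      using d by (intro real_cond_exp_mono AE_I2; simp)+
    then show "AE w in M. \<bar>real_cond_exp M G U w - real_cond_exp M G V w\<bar>
        \<le> real_cond_exp M G (\<lambda>w. \<bar>U w - V w\<bar>) w"
      using real_cond_exp_diff[OF assms(2,3)] real_cond_exp_cmult[OF integrable_abs[OF d], of "-1"]
      by eventually_elim simp
  qed (use assms int d in auto)
  also have "\<dots> = L1_dist M U V"
    using d by (intro real_cond_exp_int(2)) auto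
  finally show ?thesis .
qed

lemma (in prob_space) abs_integral_triangle:
  assumes "integrable M f" "integrable M g" "integrable M h"
  shows "L1_dist M f h \<le> L1_dist M f g + L1_dist M g h"
proof -
  have "L1_dist M f h \<le> (\<integral>w. \<bar>f w - g w\<bar> + \<bar>g w - h w\<bar> \<partial>M)"
    using assms by (intro integral_mono) auto
  also have "\<dots> = L1_dist M f g + L1_dist M g h"
    using assms by (intro Bochner_Integration.integral_add) auto
  finally show ?thesis .
qed

lemma integrable_indicator_times:
  fixes f :: "'a \<Rightarrow> real"
  assumes "A \<in> sets M" "integrable M f"
  shows "integrable M (\<lambda>w. indicator A w * f w)"
  using integrable_real_mult_indicator[OF assms] by (simp add: mult.commute)

definition (in prob_space) cond_exp_conv :: "(nat \<Rightarrow> 'a measure) \<Rightarrow> 'a measure \<Rightarrow> ('a \<Rightarrow> real) \<Rightarrow> bool" where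
  "cond_exp_conv Gn G U \<longleftrightarrow>
     (\<lambda>n. L1_dist M (real_cond_exp M (Gn n) U) (real_cond_exp M G U)) \<longlonglongrightarrow> 0"

context prob_space
begin

lemma prob_finite_unions:
  fixes A :: "nat \<Rightarrow> 'a set"
  assumes "\<And>i. A i \<in> events"
  shows "(\<lambda>k. prob (\<Union>i. A i) - prob (\<Union>i<k. A i)) \<longlonglongrightarrow> 0"
proof -
  have "(\<lambda>k. prob (\<Union>i<k. A i)) \<longlonglongrightarrow> prob (\<Union>k. \<Union>i<k. A i)"
    using assms by (intro finite_Lim_measure_incseq) (force simp: incseq_def)+
  moreover have "(\<Union>k. \<Union>i<k. A i) = (\<Union>i. A i)" by (auto intro: lessI)
  ultimately have "(\<lambda>k. prob (\<Union>i. A i) - prob (\<Union>i<k. A i)) \<longlonglongrightarrow> prob (\<Union>i. A i) - prob (\<Union>i. A i)"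
    by (intro tendsto_intros) simp
  then show ?thesis by simp
qed

context
  fixes Gn :: "nat \<Rightarrow> 'a measure" and G :: "'a measure"
  assumes Gn: "\<And>n. subalgebra M (Gn n)" and G: "subalgebra M G"
begin

lemma cond_exp_conv_const: "cond_exp_conv Gn G (\<lambda>_. c)"
proof -
  have "L1_dist M (real_cond_exp M (Gn n) (\<lambda>_. c)) (real_cond_exp M G (\<lambda>_. c)) = 0" for n
  proof -
    interpret n: sigma_finite_subalgebra M "Gn n" by (rule sigma_finite_subalgebraI[OF Gn])
    interpret sigma_finite_subalgebra M G by (rule sigma_finite_subalgebraI[OF G])
    have "AE w in M. \<bar>real_cond_exp M (Gn n) (\<lambda>_. c) w - real_cond_exp M G (\<lambda>_. c) w\<bar> = 0"
      using n.real_cond_exp_F_meas[of "\<lambda>_. c", OF integrable_const borel_measurable_const]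
        real_cond_exp_F_meas[of "\<lambda>_. c", OF integrable_const borel_measurable_const]
      by eventually_elim simp
    then have "L1_dist M (real_cond_exp M (Gn n) (\<lambda>_. c)) (real_cond_exp M G (\<lambda>_. c)) = (\<integral>w. 0 \<partial>M)"
      by (intro integral_cong_AE) auto
    then show ?thesis by simp
  qed
  then show ?thesis by (simp add: cond_exp_conv_def)
qed

lemma cond_exp_conv_add_scaled:
  assumes "cond_exp_conv Gn G U" "cond_exp_conv Gn G V" and U: "integrable M U" and V: "integrable M V"
  shows "cond_exp_conv Gn G (\<lambda>w. U w + c * V w)"
proof -
  define a where "a W n = L1_dist M (real_cond_exp M (Gn n) W) (real_cond_exp M G W)" for W n
  have "a (\<lambda>w. U w + c * V w) n \<le> a U n + \<bar>c\<bar> * a V n" for n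
  proof -
    interpret n: sigma_finite_subalgebra M "Gn n" by (rule sigma_finite_subalgebraI[OF Gn])
    interpret sigma_finite_subalgebra M G by (rule sigma_finite_subalgebraI[OF G])
    have cV: "integrable M (\<lambda>w. c * V w)" using V by simp
    have "a (\<lambda>w. U w + c * V w) n \<le> (\<integral>w. \<bar>real_cond_exp M (Gn n) U w - real_cond_exp M G U w\<bar>
        + \<bar>c\<bar> * \<bar>real_cond_exp M (Gn n) V w - real_cond_exp M G V w\<bar> \<partial>M)"
      unfolding a_def
    proof (rule integral_mono_AE)
      show "AE w in M. \<bar>real_cond_exp M (Gn n) (\<lambda>w. U w + c * V w) w - real_cond_exp M G (\<lambda>w. U w + c * V w) w\<bar>
        \<le> \<bar>real_cond_exp M (Gn n) U w - real_cond_exp M G U w\<bar>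
          + \<bar>c\<bar> * \<bar>real_cond_exp M (Gn n) V w - real_cond_exp M G V w\<bar>"
        using n.real_cond_exp_add[OF U cV] real_cond_exp_add[OF U cV]
          n.real_cond_exp_cmult[OF V, of c] real_cond_exp_cmult[OF V, of c]
      proof eventually_elim
        case (elim w)
        have "real_cond_exp M (Gn n) (\<lambda>w. U w + c * V w) w - real_cond_exp M G (\<lambda>w. U w + c * V w) w
          = (real_cond_exp M (Gn n) U w - real_cond_exp M G U w)
            + c * (real_cond_exp M (Gn n) V w - real_cond_exp M G V w)"
          using elim by (simp add: algebra_simps)
        then show ?case by (metis abs_mult abs_triangle_ineq)
      qed
    qed (use U V cV n.real_cond_exp_int(1) real_cond_exp_int(1) in auto)
    also have "\<dots> = a U n + \<bar>c\<bar> * a V n"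
      unfolding a_def using U V n.real_cond_exp_int(1) real_cond_exp_int(1)
      by (subst Bochner_Integration.integral_add) auto
    finally show ?thesis .
  qed
  moreover have "(\<lambda>n. a U n + \<bar>c\<bar> * a V n) \<longlonglongrightarrow> 0 + \<bar>c\<bar> * 0"
    using assms(1,2) unfolding cond_exp_conv_def a_def by (intro tendsto_intros)
  moreover have "norm (a W n) = a W n" for W n by (simp add: a_def)
  ultimately have "(\<lambda>n. a (\<lambda>w. U w + c * V w) n) \<longlonglongrightarrow> 0"
    by - (rule Lim_null_comparison[OF always_eventually], simp_all)
  then show ?thesis by (simp add: cond_exp_conv_def a_def)
qed

lemma cond_exp_conv_sum:
  assumes "finite I" "\<And>i. i \<in> I \<Longrightarrow> cond_exp_conv Gn G (V i)" "\<And>i. i \<in> I \<Longrightarrow> integrable M (V i)"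
  shows "cond_exp_conv Gn G (\<lambda>w. \<Sum>i\<in>I. c i * V i w)"
  using assms
proof (induction I rule: finite_induct)
  case empty
  then show ?case using cond_exp_conv_const[of 0] by simp
next
  case (insert i I)
  then have "cond_exp_conv Gn G (\<lambda>w. (\<Sum>i\<in>I. c i * V i w) + c i * V i w)"
    by (intro cond_exp_conv_add_scaled) auto
  then show ?case using insert by (simp add: add.commute)
qed

text \<open>Conditional expectations are contractions of \<open>L\<^sup>1\<close>, so the class of random variables for which
  they converge is closed.\<close>

lemma cond_exp_conv_closed:
  assumes U: "integrable M U" and V: "\<And>i. integrable M (V i)" "\<And>i. cond_exp_conv Gn G (V i)"
    and lim: "(\<lambda>i. L1_dist M U (V i)) \<longlonglongrightarrow> 0"
  shows "cond_exp_conv Gn G U"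
  unfolding cond_exp_conv_def
proof (rule tendsto_zero_if_eventually_small)
  fix e :: real assume e: "e > 0"
  define a where "a W n = L1_dist M (real_cond_exp M (Gn n) W) (real_cond_exp M G W)" for W n
  have "e / 3 > 0" using e by simp
  from order_tendstoD(2)[OF lim this] obtain i where i: "L1_dist M U (V i) < e / 3"
    by (auto dest: eventually_happens)
  have "a U n \<le> L1_dist M U (V i) + (a (V i) n + L1_dist M U (V i))" for n
  proof -
    interpret n: sigma_finite_subalgebra M "Gn n" by (rule sigma_finite_subalgebraI[OF Gn])
    interpret sigma_finite_subalgebra M G by (rule sigma_finite_subalgebraI[OF G])
    note int = n.real_cond_exp_int(1)[OF U] n.real_cond_exp_int(1)[OF V(1)[of i]]
       real_cond_exp_int(1)[OF U] real_cond_exp_int(1)[OF V(1)[of i]]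
    show ?thesis
      using abs_integral_triangle[OF int(1,2,3)] abs_integral_triangle[OF int(2,4,3)]
        cond_exp_L1_contraction[OF Gn U V(1)[of i], of n] cond_exp_L1_contraction[OF G U V(1)[of i]]
      unfolding a_def by (simp add: abs_minus_commute)
  qed
  moreover have "\<forall>\<^sub>F n in sequentially. a (V i) n < e / 3"
    using V(2)[of i] \<open>e / 3 > 0\<close> unfolding cond_exp_conv_def a_def by (intro order_tendstoD(2))
  ultimately show "\<forall>\<^sub>F n in sequentially. L1_dist M (real_cond_exp M (Gn n) U) (real_cond_exp M G U) < e"
    unfolding a_def[symmetric] using i by (auto elim!: eventually_mono) (smt (verit) field_sum_of_halves)
qed simp

lemma cond_exp_conv_cong:
  assumes "cond_exp_conv Gn G U" "\<And>w. w \<in> space M \<Longrightarrow> U w = V w" "integrable M U" "integrable M V"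
  shows "cond_exp_conv Gn G V"
proof (rule cond_exp_conv_closed[OF assms(4,3,1)])
  have "L1_dist M V U = L1_dist M U U"
    using assms(2) by (intro Bochner_Integration.integral_cong) auto
  then show "(\<lambda>i. L1_dist M V U) \<longlonglongrightarrow> 0" by simp
qed

text \<open>Linearity and closedness turn the events for which convergence holds into a Dynkin system.\<close>

lemma cond_exp_conv_sigma_sets:
  assumes P: "Int_stable P" "P \<subseteq> events" and conv: "\<And>A. A \<in> P \<Longrightarrow> cond_exp_conv Gn G (indicator A)"
    and A: "A \<in> sigma_sets (space M) P"
  shows "cond_exp_conv Gn G (indicator A)"
proof -
  have sub: "sigma_sets (space M) P \<subseteq> events" using P(2) by (rule sets.sigma_sets_subset)
  have ind: "integrable M (indicator A :: 'a \<Rightarrow> real)" if "A \<in> events" for A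
    using that by (simp add: emeasure_eq_measure)
  have "P \<subseteq> Pow (space M)" using P(2) sets.space_closed by blast
  from P(1) this A show ?thesis
  proof (induction rule: sigma_sets_induct_disjoint)
    case (basic A)
    then show ?case by (rule conv)
  next
    case empty
    then show ?case using cond_exp_conv_const[of 0] by (simp add: indicator_def)
  next
    case (compl A)
    then have A: "A \<in> events" using sub by auto
    have "cond_exp_conv Gn G (\<lambda>w. 1 + (- 1) * indicator A w)"
      using compl A by (intro cond_exp_conv_add_scaled cond_exp_conv_const ind) auto
    then show ?case
    proof (rule cond_exp_conv_cong)
      show "1 + - 1 * indicator A w = (indicator (space M - A) w :: real)" if "w \<in> space M" for w
        using that by (simp add: indicator_def)
    qed (use A ind in auto)
  next
    case (union A)
    then have A: "A i \<in> events" for i using sub by auto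
    show ?case
    proof (rule cond_exp_conv_closed)
      show "cond_exp_conv Gn G (indicator (\<Union>i<k. A i))" for k
      proof -
        have "cond_exp_conv Gn G (\<lambda>w. \<Sum>i<k. 1 * indicator (A i) w)"
          using union A by (intro cond_exp_conv_sum ind) auto
        then show ?thesis
        proof (rule cond_exp_conv_cong)
          show "(\<Sum>i<k. 1 * indicator (A i) w) = (indicator (\<Union>i<k. A i) w :: real)" for w
            using union(1) by (subst indicator_UN_disjoint) (auto simp: disjoint_family_on_def)
        qed (use A ind in auto)
      qed
      have "L1_dist M (indicator (\<Union>i. A i)) (indicator (\<Union>i<k. A i))
          = prob (\<Union>i. A i) - prob (\<Union>i<k. A i)" for k
      proof -
        have "L1_dist M (indicator (\<Union>i. A i)) (indicator (\<Union>i<k. A i))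
          = (\<integral>w. indicator (\<Union>i. A i) w - indicator (\<Union>i<k. A i) w \<partial>M)"
          by (intro Bochner_Integration.integral_cong) (auto simp: indicator_def)
        also have "\<dots> = (\<integral>w. indicator (\<Union>i. A i) w \<partial>M) - (\<integral>w. indicator (\<Union>i<k. A i) w \<partial>M)"
          using A by (intro Bochner_Integration.integral_diff ind) auto
        also have "\<dots> = prob (\<Union>i. A i) - prob (\<Union>i<k. A i)"
          using A sets.sets_into_space by (simp add: Int_absorb2 sets.countable_UN)
        finally show ?thesis .
      qed
      then show "(\<lambda>k. L1_dist M (indicator (\<Union>i. A i)) (indicator (\<Union>i<k. A i))) \<longlonglongrightarrow> 0"
        using prob_finite_unions[OF A] by simp
    qed (use A ind in auto)
  qed
qed

lemma cond_exp_conv_integrable: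
  assumes H: "subalgebra M H" and conv: "\<And>A. A \<in> sets H \<Longrightarrow> cond_exp_conv Gn G (indicator A)"
    and U: "integrable M U" "U \<in> borel_measurable H"
  shows "cond_exp_conv Gn G U"
proof -
  have sp: "space H = space M" and HM: "sets H \<subseteq> events" using H by (auto simp: subalgebra_def)
  obtain V where V: "\<And>i. simple_function H (V i)" "\<And>w. w \<in> space H \<Longrightarrow> (\<lambda>i. V i w) \<longlonglongrightarrow> U w"
    "\<And>i w. w \<in> space H \<Longrightarrow> dist (V i w) 0 \<le> 2 * dist (U w) 0"
    using borel_measurable_implies_sequence_metric[OF U(2), of 0] by blast
  have Vm: "V i \<in> borel_measurable M" for i
    using measurable_from_subalg[OF H borel_measurable_simple_function[OF V(1)]] .
  have Um: "U \<in> borel_measurable M" using U by auto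
  have ind: "integrable M (indicator A :: 'a \<Rightarrow> real)" if "A \<in> sets H" for A
    using that HM by (auto simp: emeasure_eq_measure)
  have Vi: "integrable M (V i)" for i
  proof (rule Bochner_Integration.integrable_bound)
    show "integrable M (\<lambda>w. 2 * U w)" using U by simp
    show "AE w in M. norm (V i w) \<le> norm (2 * U w)"
      using V(3)[of _ i] sp by (intro AE_I2) (simp add: dist_real_def abs_mult)
  qed (rule Vm)
  show ?thesis
  proof (rule cond_exp_conv_closed[OF U(1) Vi])
    fix i
    let ?A = "\<lambda>y. V i -` {y} \<inter> space H"
    have A: "?A y \<in> sets H" for y using simple_functionD(2)[OF V(1)[of i], of "{y}"] .
    have fin: "finite (V i ` space H)" using V(1)[of i] by (simp add: simple_function_def)
    have "cond_exp_conv Gn G (\<lambda>w. \<Sum>y\<in>V i ` space H. y * indicator (?A y) w)"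
      by (intro cond_exp_conv_sum conv ind fin A)
    then show "cond_exp_conv Gn G (V i)"
    proof (rule cond_exp_conv_cong)
      fix w assume w: "w \<in> space M"
      have "(\<Sum>y\<in>V i ` space H. y * indicator (?A y) w) = (\<Sum>y\<in>V i ` space H. if y = V i w then y else 0)"
        using w sp by (intro sum.cong) (auto simp: indicator_def)
      also have "\<dots> = V i w" using fin w sp by simp
      finally show "(\<Sum>y\<in>V i ` space H. y * indicator (?A y) w) = V i w" .
    qed (use Vi ind A in auto)
  next
    have "(\<lambda>i. L1_dist M U (V i)) \<longlonglongrightarrow> (\<integral>w. 0 \<partial>M)"
    proof (rule integral_dominated_convergence[where w = "\<lambda>w. 3 * \<bar>U w\<bar>"])
      show "AE w in M. (\<lambda>i. \<bar>U w - V i w\<bar>) \<longlonglongrightarrow> 0"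
      proof (rule AE_I2)
        fix w assume "w \<in> space M"
        then have "(\<lambda>i. \<bar>U w - V i w\<bar>) \<longlonglongrightarrow> \<bar>U w - U w\<bar>"
          using V(2) sp by (intro tendsto_intros) auto
        then show "(\<lambda>i. \<bar>U w - V i w\<bar>) \<longlonglongrightarrow> 0" by simp
      qed
      show "AE w in M. norm \<bar>U w - V i w\<bar> \<le> 3 * \<bar>U w\<bar>" for i
        using V(3)[of _ i] sp by (intro AE_I2) (force simp: dist_real_def)
    qed (use U Um Vm in auto)
    then show "(\<lambda>i. L1_dist M U (V i)) \<longlonglongrightarrow> 0" by simp
  qed
qed

end

end

section \<open>Optimal stopping on a finite set of times\<close>

text \<open>The value at the head of the list of the Snell envelope along the list. Times are not numbered, so
  that all inductions are inductions on lists.\<close>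

fun snell :: "'a measure \<Rightarrow> (real \<Rightarrow> 'a measure) \<Rightarrow> (real \<Rightarrow> 'a \<Rightarrow> real) \<Rightarrow> real list \<Rightarrow> 'a \<Rightarrow> real" where
  "snell M G Z [] = (\<lambda>_. 0)"
| "snell M G Z [t] = Z t"
| "snell M G Z (t # s # ts) = (\<lambda>w. max (Z t w) (real_cond_exp M (G t) (snell M G Z (s # ts)) w))"

abbreviation E_on :: "'a measure \<Rightarrow> 'a set \<Rightarrow> ('a \<Rightarrow> real) \<Rightarrow> real" where
  "E_on M B f \<equiv> \<integral>w. indicator B w * f w \<partial>M"

context prob_space
begin

lemma integrable_snell:
  assumes G: "\<And>t. t \<in> set L \<Longrightarrow> subalgebra M (G t)" and Z: "\<And>t. t \<in> set L \<Longrightarrow> integrable M (Z t)"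
  shows "integrable M (snell M G Z L)"
  using assms
proof (induction L rule: induct_list012)
  case (3 t s ts)
  interpret sigma_finite_subalgebra M "G t" using 3 by (intro sigma_finite_subalgebraI) auto
  have "integrable M (real_cond_exp M (G t) (snell M G Z (s # ts)))"
    using 3 by (intro real_cond_exp_int(1)) auto
  then show ?case using 3 by (auto intro!: Bochner_Integration.integrable_max)
qed auto

lemma snell_measurable:
  assumes G: "\<And>t. t \<in> set L \<Longrightarrow> subalgebra M (G t)" "\<And>t. t \<in> set L \<Longrightarrow> subalgebra H (G t)"
    and Z: "\<And>t. t \<in> set L \<Longrightarrow> Z t \<in> borel_measurable H"
  shows "snell M G Z L \<in> borel_measurable H"
  using assms
proof (induction L rule: induct_list012)
  case (3 t s ts)
  have "real_cond_exp M (G t) (snell M G Z (s # ts)) \<in> borel_measurable H"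
    using 3 by (intro measurable_from_subalg[of H "G t"]) auto
  then show ?case using 3 by auto
qed auto

text \<open>A stopping rule is represented by the disjoint events \<open>A s\<close> of stopping at \<open>s\<close>; their union is an
  arbitrary event of the first \<open>\<sigma>\<close>-algebra, because the induction restricts the rule to the event that it
  has not stopped yet. This event belongs to the \<open>\<sigma>\<close>-algebra at the current time \<open>t\<close>, so on it the next value
  of the envelope may be replaced by its conditional expectation, which the envelope at \<open>t\<close> dominates.\<close>

lemma snell_upper_bound:
  assumes L: "L \<noteq> []" "sorted_wrt (<) L"
    and G: "\<And>t. t \<in> set L \<Longrightarrow> subalgebra M (G t)"
      "\<And>s t. s \<in> set L \<Longrightarrow> t \<in> set L \<Longrightarrow> s \<le> t \<Longrightarrow> sets (G s) \<subseteq> sets (G t)"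
    and Z: "\<And>t. t \<in> set L \<Longrightarrow> integrable M (Z t)"
    and A: "\<And>t. t \<in> set L \<Longrightarrow> A t \<in> sets (G t)" "disjoint_family_on A (set L)"
    and B: "(\<Union>t\<in>set L. A t) \<in> sets (G (hd L))"
  shows "(\<Sum>t\<in>set L. E_on M (A t) (Z t)) \<le> E_on M (\<Union>t\<in>set L. A t) (snell M G Z L)"
  using assms
proof (induction L rule: induct_list012)
  case (3 t s ts)
  let ?L = "s # ts"
  interpret sigma_finite_subalgebra M "G t" by (rule sigma_finite_subalgebraI, rule 3) simp
  have GM: "sets (G r) \<subseteq> events" if "r \<in> set (t # ?L)" for r using 3(5)[OF that] by (simp add: subalgebra_def)
  have ts: "t \<notin> set ?L" "t < s" using 3(4) by auto
  define B where "B = (\<Union>r\<in>set ?L. A r)"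
  have disj: "A t \<inter> B = {}" "(\<Union>r\<in>set (t # ?L). A r) = A t \<union> B"
    using 3(9) ts by (auto simp: B_def disjoint_family_on_def)
  then have "B = (\<Union>r\<in>set (t # ?L). A r) - A t" by auto
  then have Bt: "B \<in> sets (G t)"
    using 3(8)[of t] 3(10) by auto
  have ev: "A t \<in> events" "B \<in> events" using Bt 3(8)[of t] GM[of t] by auto
  let ?U = "snell M G Z ?L" and ?C = "real_cond_exp M (G t) (snell M G Z ?L)"
  have U: "integrable M ?U" by (intro integrable_snell 3) auto
  have C: "integrable M ?C" using U by (rule real_cond_exp_int(1))
  have W: "integrable M (snell M G Z (t # ?L))" by (intro integrable_snell 3) auto
  have IH: "(\<Sum>r\<in>set ?L. E_on M (A r) (Z r)) \<le> E_on M B ?U"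
    unfolding B_def
  proof (rule 3(2))
    show "(\<Union>t\<in>set ?L. A t) \<in> sets (G (hd ?L))"
      using Bt 3(6)[of t s] ts unfolding B_def by auto
  qed (use 3(3-9) in \<open>auto simp: disjoint_family_on_def\<close>)
  also have "E_on M B ?U = E_on M B ?C"
    using Bt U ev by (intro real_cond_exp_intg(2)[symmetric] integrable_indicator_times) auto
  also have "\<dots> \<le> E_on M B (snell M G Z (t # ?L))"
    using ev C W by (intro integral_mono integrable_indicator_times) (auto simp: indicator_def)
  finally have "(\<Sum>r\<in>set ?L. E_on M (A r) (Z r)) \<le> E_on M B (snell M G Z (t # ?L))" .
  moreover have "E_on M (A t) (Z t) \<le> E_on M (A t) (snell M G Z (t # ?L))"
    using ev 3(7)[of t] W by (intro integral_mono integrable_indicator_times) (auto simp: indicator_def)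
  ultimately have "(\<Sum>r\<in>set (t # ?L). E_on M (A r) (Z r)) \<le> E_on M (A t) (snell M G Z (t # ?L)) + E_on M B (snell M G Z (t # ?L))"
    using ts(1) by simp
  also have "\<dots> = (\<integral>w. indicator (A t) w * snell M G Z (t # ?L) w + indicator B w * snell M G Z (t # ?L) w \<partial>M)"
    using ev W by (intro Bochner_Integration.integral_add[symmetric] integrable_indicator_times)
  also have "\<dots> = E_on M (\<Union>r\<in>set (t # ?L). A r) (snell M G Z (t # ?L))"
    unfolding disj(2) using disj(1) by (intro Bochner_Integration.integral_cong) (auto simp: indicator_def)
  finally show ?case .
qed auto

text \<open>Both inequalities used for the upper bound become equalities if one stops as soon as the reward
  is at least the conditional expectation of the next value.\<close>

lemma snell_attained:
  assumes L: "L \<noteq> []" "sorted_wrt (<) L"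
    and G: "\<And>t. t \<in> set L \<Longrightarrow> subalgebra M (G t)"
      "\<And>s t. s \<in> set L \<Longrightarrow> t \<in> set L \<Longrightarrow> s \<le> t \<Longrightarrow> sets (G s) \<subseteq> sets (G t)"
    and Z: "\<And>t. t \<in> set L \<Longrightarrow> integrable M (Z t)" "\<And>t. t \<in> set L \<Longrightarrow> Z t \<in> borel_measurable (G t)"
    and B: "B \<in> sets (G (hd L))"
  shows "\<exists>A. (\<forall>t\<in>set L. A t \<in> sets (G t)) \<and> disjoint_family_on A (set L) \<and> (\<Union>t\<in>set L. A t) = B \<and>
    (\<Sum>t\<in>set L. E_on M (A t) (Z t)) = E_on M B (snell M G Z L)"
  using assms
proof (induction L arbitrary: B rule: induct_list012)
  case (2 t)
  then show ?case by (intro exI[of _ "\<lambda>_. B"]) (auto simp: disjoint_family_on_def)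
next
  case (3 t s ts)
  let ?L = "s # ts"
  interpret sigma_finite_subalgebra M "G t" by (rule sigma_finite_subalgebraI, rule 3) simp
  have sub: "subalgebra M (G t)" using 3(5) by simp
  have ts: "t \<notin> set ?L" "t < s" using 3(4) by auto
  let ?U = "snell M G Z ?L" and ?C = "real_cond_exp M (G t) (snell M G Z ?L)"
  have U: "integrable M ?U" by (intro integrable_snell 3) auto
  have C: "integrable M ?C" using U by (rule real_cond_exp_int(1))
  have W: "integrable M (snell M G Z (t # ?L))" by (intro integrable_snell 3) auto
  define B1 where "B1 = B \<inter> {w\<in>space (G t). ?C w \<le> Z t w}"
  have Zt: "Z t \<in> borel_measurable (G t)" and Bt: "B \<in> sets (G t)" using 3(8,9) by auto
  have B1: "B1 \<in> sets (G t)"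
    unfolding B1_def by (intro sets.Int Bt borel_measurable_le borel_measurable_cond_exp Zt)
  have B2: "B - B1 \<in> sets (G t)" using B1 Bt by auto
  have ev: "B1 \<in> events" "B - B1 \<in> events" using B1 B2 sub by (auto simp: subalgebra_def)
  have "B - B1 \<in> sets (G (hd ?L))" using B2 3(6)[of t s] ts by auto
  from 3(2)[OF _ _ _ _ _ _ this] 3(4-8) obtain A where
    A: "\<forall>t\<in>set ?L. A t \<in> sets (G t)" "disjoint_family_on A (set ?L)" "(\<Union>t\<in>set ?L. A t) = B - B1"
      "(\<Sum>t\<in>set ?L. E_on M (A t) (Z t)) = E_on M (B - B1) ?U"
    by auto
  let ?A = "A(t := B1)"
  have B1B: "B1 \<subseteq> B" by (auto simp: B1_def)
  have spB: "B \<subseteq> space (G t)" using Bt sets.sets_into_space by blast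
  have "(\<Sum>r\<in>set (t # ?L). E_on M (?A r) (Z r)) = E_on M B1 (Z t) + (\<Sum>r\<in>set ?L. E_on M (?A r) (Z r))"
    using ts(1) by simp
  also have "(\<Sum>r\<in>set ?L. E_on M (?A r) (Z r)) = (\<Sum>r\<in>set ?L. E_on M (A r) (Z r))"
    using ts(1) by (intro sum.cong) auto
  also have "\<dots> = E_on M (B - B1) ?C"
    unfolding A(4)
    using B2 U ev by (intro real_cond_exp_intg(2)[symmetric] integrable_indicator_times) auto
  also have "E_on M B1 (Z t) + E_on M (B - B1) ?C
     = (\<integral>w. indicator B1 w * Z t w + indicator (B - B1) w * ?C w \<partial>M)"
    using ev 3(7)[of t] C by (intro Bochner_Integration.integral_add[symmetric] integrable_indicator_times) auto
  also have "\<dots> = E_on M B (snell M G Z (t # ?L))"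
    using B1B spB by (intro Bochner_Integration.integral_cong) (auto simp: indicator_def B1_def)
  finally have eq: "(\<Sum>r\<in>set (t # ?L). E_on M (?A r) (Z r)) = E_on M B (snell M G Z (t # ?L))" .
  have "(\<Union>r\<in>set (t # ?L). ?A r) = B1 \<union> (\<Union>r\<in>set ?L. A r)" using ts(1) by auto
  then have un: "(\<Union>r\<in>set (t # ?L). ?A r) = B" using A(3) B1B by auto
  have "B1 \<inter> A r = {}" if "r \<in> set ?L" for r using A(3) that by auto
  then have disj: "disjoint_family_on ?A (set (t # ?L))"
    using A(2) ts(1) unfolding disjoint_family_on_def by (auto simp: Int_commute)
  have meas: "\<forall>r\<in>set (t # ?L). ?A r \<in> sets (G r)" using A(1) B1 by auto
  show ?case by (intro exI[of _ ?A] conjI meas disj un eq)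
qed auto

text \<open>In each step of the backward induction the maximum and the conditional expectation are contractions
  of \<open>L\<^sup>1\<close>; what remains is the convergence of the conditional expectations of one fixed random variable,
  the limit envelope at the next time.\<close>

lemma snell_convergence:
  assumes L: "sorted_wrt (<) L"
    and Gn: "\<And>n t. t \<in> set L \<Longrightarrow> subalgebra M (Gn n t)" and G: "\<And>t. t \<in> set L \<Longrightarrow> subalgebra M (G t)"
    and H: "\<And>t. t \<in> set L \<Longrightarrow> subalgebra H (G t)"
    and Z: "\<And>t. t \<in> set L \<Longrightarrow> integrable M (Z t)" "\<And>t. t \<in> set L \<Longrightarrow> Z t \<in> borel_measurable H"
    and conv: "\<And>t U. t \<in> set L \<Longrightarrow> integrable M U \<Longrightarrow> U \<in> borel_measurable H \<Longrightarrow>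
       cond_exp_conv (\<lambda>n. Gn n t) (G t) U"
  shows "(\<lambda>n. L1_dist M (snell M (Gn n) Z L) (snell M G Z L)) \<longlonglongrightarrow> 0"
  using assms
proof (induction L rule: induct_list012)
  case (3 t s ts)
  let ?L = "s # ts"
  let ?Un = "\<lambda>n. snell M (Gn n) Z ?L" and ?U = "snell M G Z ?L"
  interpret sigma_finite_subalgebra M "G t" by (rule sigma_finite_subalgebraI, rule 3) simp
  have U: "integrable M ?U" "?U \<in> borel_measurable H" by (intro integrable_snell snell_measurable 3; simp)+
  have W: "integrable M (snell M G Z (t # ?L))" by (intro integrable_snell 3) auto
  have IH: "(\<lambda>n. L1_dist M (?Un n) ?U) \<longlonglongrightarrow> 0"
    by (rule 3(2)) (use 3(3-) in auto)
  define a where "a n = L1_dist M (real_cond_exp M (Gn n t) ?U) (real_cond_exp M (G t) ?U)" for n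
  have "a \<longlonglongrightarrow> 0" using 3(9)[OF _ U] unfolding cond_exp_conv_def a_def by auto
  then have lim: "(\<lambda>n. L1_dist M (?Un n) ?U + a n) \<longlonglongrightarrow> 0"
    using tendsto_add[OF IH] by fastforce
  show ?case
  proof (rule Lim_null_comparison[OF _ lim], intro always_eventually allI)
    fix n
    interpret n: sigma_finite_subalgebra M "Gn n t" by (rule sigma_finite_subalgebraI, rule 3) simp
    have Un: "integrable M (?Un n)" by (intro integrable_snell 3) auto
    have Wn: "integrable M (snell M (Gn n) Z (t # ?L))" by (intro integrable_snell 3) auto
    note int = n.real_cond_exp_int(1)[OF Un] n.real_cond_exp_int(1)[OF U(1)] real_cond_exp_int(1)[OF U(1)]
    have "L1_dist M (snell M (Gn n) Z (t # ?L)) (snell M G Z (t # ?L))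
      \<le> L1_dist M (real_cond_exp M (Gn n t) (?Un n)) (real_cond_exp M (G t) ?U)"
    proof (rule integral_mono)
      show "integrable M (\<lambda>w. \<bar>snell M (Gn n) Z (t # ?L) w - snell M G Z (t # ?L) w\<bar>)"
        using Wn W by (intro integrable_abs Bochner_Integration.integrable_diff)
    qed (use int in auto)
    also have "\<dots> \<le> L1_dist M (real_cond_exp M (Gn n t) (?Un n)) (real_cond_exp M (Gn n t) ?U) + a n"
      unfolding a_def by (rule abs_integral_triangle[OF int])
    also have "\<dots> \<le> L1_dist M (?Un n) ?U + a n"
      using cond_exp_L1_contraction[OF _ Un U(1), of "Gn n t"] 3(4) by simp
    finally show "norm (L1_dist M (snell M (Gn n) Z (t # ?L)) (snell M G Z (t # ?L)))
      \<le> L1_dist M (?Un n) ?U + a n" by simp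
  qed
qed auto

end

section \<open>Filtrations generated by cadlag processes\<close>

lemma natural_filtration_measurable:
  assumes "s \<in> {0..t}"
  shows "Y s \<in> borel_measurable (natural_filtration M Y t)"
proof (rule measurableI)
  fix B :: "real set" assume "B \<in> sets borel"
  then have "Y s -` B \<inter> space M \<in> {Y s -` B \<inter> space M |s B. s \<in> {0..t} \<and> B \<in> sets borel}"
    using assms by blast
  then show "Y s -` B \<inter> space (natural_filtration M Y t) \<in> sets (natural_filtration M Y t)"
    unfolding sets_natural_filtration by auto
qed simp

text \<open>By right-continuity of the paths, the values at times in \<open>D\<close> determine all others up to \<open>t\<close>.\<close>

lemma natural_filtration_subset_dense:
  assumes X: "cadlag_process M T X" and t: "t \<in> {0..T}" and H: "space H = space M"
    and D: "D \<subseteq> {0..t}" "\<And>q. q \<in> D \<Longrightarrow> X q \<in> borel_measurable H"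
      "\<And>s u. s \<in> {0..t} \<Longrightarrow> s < u \<Longrightarrow> \<exists>q\<in>D. s \<le> q \<and> q < u"
  shows "sets (natural_filtration M X t) \<subseteq> sets H"
proof -
  have Xs: "X s \<in> borel_measurable H" if s: "s \<in> {0..t}" for s
  proof -
    have "\<exists>q\<in>D. s \<le> q \<and> q < s + 1 / real (Suc k)" for k
      using D(3)[OF s, of "s + 1 / real (Suc k)"] by simp
    then obtain q where q: "\<And>k. q k \<in> D" "\<And>k. s \<le> q k" "\<And>k. q k < s + 1 / real (Suc k)" by metis
    have "q \<longlonglongrightarrow> s" using q(2) less_imp_le[OF q(3)] by (rule tendsto_if_between_inverse)
    moreover have "q k \<in> {s..T}" for k using q(1,2)[of k] D(1) t by force
    ultimately have "(\<lambda>k. X (q k) w) \<longlonglongrightarrow> X s w" if "w \<in> space H" for w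
      using X that H s t by (intro cadlag_on_tendsto_right[of T "\<lambda>t. X t w"]) (auto simp: cadlag_process_def)
    then show ?thesis
      using D(2)[OF q(1)] by (rule borel_measurable_LIMSEQ_real)
  qed
  have "X s -` B \<inter> space M \<in> sets H" if "s \<in> {0..t}" "B \<in> sets borel" for s B
    using measurable_sets[OF Xs[OF that(1)] that(2)] H by simp
  then show ?thesis
    unfolding sets_natural_filtration unfolding H[symmetric]
    by (intro sets.sigma_sets_subset) (auto simp: H)
qed

lemma space_right_continuous_filtration [simp]:
  "space (right_continuous_filtration T (natural_filtration M X) t) = space M"
  by (simp add: right_continuous_filtration_def space_measure_of_conv)

lemma right_continuous_filtration_mono:
  assumes "s \<le> t"
  shows "sets (right_continuous_filtration T (natural_filtration M X) s)
    \<subseteq> sets (right_continuous_filtration T (natural_filtration M X) t)"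
proof (cases "t < T")
  case True
  then show ?thesis
    using assms by (subst (1 2) sets_right_continuous_filtration[where \<Omega> = "space M"]) auto
next
  case False
  then show ?thesis
  proof (cases "s < T")
    case True
    then show ?thesis
      using False by (subst sets_right_continuous_filtration[where \<Omega> = "space M"])
        (auto simp: right_continuous_filtration_def)
  qed (simp add: right_continuous_filtration_def)
qed

lemma natural_filtration_subset_right_continuous:
  assumes "t \<le> T"
  shows "sets (natural_filtration M X t) \<subseteq> sets (right_continuous_filtration T (natural_filtration M X) t)"
proof (cases "t < T")
  case True
  then show ?thesis
    by (subst sets_right_continuous_filtration[where \<Omega> = "space M"])
      (auto dest: subsetD[OF sets_natural_filtration_mono[OF less_imp_le]])
next
  case False
  then show ?thesis
    using assms by (simp add: right_continuous_filtration_def)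
qed

section \<open>Weak convergence of filtrations at a fixed time\<close>

text \<open>Conditional probabilities are bounded, so convergence in probability at a time is convergence in
  \<open>L\<^sup>1\<close>.\<close>

lemma (in prob_space) cond_exp_conv_indicator:
  assumes T: "T > 0" and t: "t \<in> insert T ({0..T} - fixed_discontinuities M T N)" and A: "A \<in> events"
    and Gn: "\<And>n. subalgebra M (Gn n t)" and G: "subalgebra M (G t)"
    and Nn: "\<And>n. cadlag_cond_prob M T (Gn n) A (Nn n)" and N: "cadlag_cond_prob M T G A N"
    and conv: "skorokhod_tendsto_in_prob M T Nn N"
  shows "cond_exp_conv (\<lambda>n. Gn n t) (G t) (indicator A)"
proof -
  have tT: "t \<in> {0..T}" using t T by auto
  have Nn': "cadlag_process M T (Nn n)" "Nn n t \<in> borel_measurable M"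
     "AE w in M. Nn n t w = real_cond_exp M (Gn n t) (indicator A) w" for n
    using Nn[of n] tT by (auto simp: cadlag_cond_prob_def cadlag_process_def)
  have N': "cadlag_process M T N" "N t \<in> borel_measurable M"
     "AE w in M. N t w = real_cond_exp M (G t) (indicator A) w"
    using N tT by (auto simp: cadlag_cond_prob_def cadlag_process_def)
  have range: "AE w in M. real_cond_exp M H (indicator A) w \<in> {0..1}" if "subalgebra M H" for H
  proof -
    interpret sigma_finite_subalgebra M H by (rule sigma_finite_subalgebraI) fact
    have int: "integrable M (indicator A :: 'a \<Rightarrow> real)" using A by (simp add: emeasure_eq_measure)
    have "AE w in M. real_cond_exp M H (indicator A) w \<ge> 0"
      by (rule real_cond_exp_ge_c[OF int]) simp
    moreover have "AE w in M. real_cond_exp M H (indicator A) w \<le> 1"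
      by (rule real_cond_exp_le_c[OF int]) (simp add: indicator_def)
    ultimately show ?thesis by eventually_elim simp
  qed
  have "AE w in M. \<bar>Nn n t w - N t w\<bar> \<le> 1" for n
    using range[OF Gn[of n]] range[OF G] Nn'(3)[of n] N'(3) by eventually_elim auto
  then have "(\<lambda>n. \<integral>w. \<bar>Nn n t w - N t w\<bar> \<partial>M) \<longlonglongrightarrow> 0"
    by (intro tendsto_in_prob_imp_L1[where K = 1] tendsto_in_prob_at_time[OF T Nn'(1) N'(1) conv t] Nn'(2) N'(2)) auto
  also have "(\<lambda>n. \<integral>w. \<bar>Nn n t w - N t w\<bar> \<partial>M)
     = (\<lambda>n. \<integral>w. \<bar>real_cond_exp M (Gn n t) (indicator A) w - real_cond_exp M (G t) (indicator A) w\<bar> \<partial>M)"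
  proof (intro ext integral_cong_AE)
    show "AE w in M. \<bar>Nn n t w - N t w\<bar>
       = \<bar>real_cond_exp M (Gn n t) (indicator A) w - real_cond_exp M (G t) (indicator A) w\<bar>" for n
      using Nn'(3)[of n] N'(3) by eventually_elim simp
  qed (use Nn'(2) N'(2) in auto)
  finally show ?thesis unfolding cond_exp_conv_def .
qed

text \<open>Each event has its own exceptional times; countably many events suffice because the filtration
  is generated by a cadlag process.\<close>

lemma (in prob_space) weak_conv_filtrations_cond_exp:
  assumes T: "T > 0" and X: "cadlag_process M T X"
    and Gn: "\<And>n t. t \<in> {0..T} \<Longrightarrow> subalgebra M (Gn n t)" and G: "\<And>t. t \<in> {0..T} \<Longrightarrow> subalgebra M (G t)"
    and GT: "sets (G T) = sets (natural_filtration M X T)" and conv: "weak_conv_filtrations M T Gn G"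
  obtains C where "countable C"
    "\<And>t U. t \<in> insert T ({0..T} - C) \<Longrightarrow> integrable M U \<Longrightarrow> U \<in> borel_measurable (G T) \<Longrightarrow>
       cond_exp_conv (\<lambda>n. Gn n t) (G t) U"
proof -
  \<comment> \<open>\<open>P\<close> is a countable \<open>\<pi>\<close>-system that generates the \<open>\<sigma>\<close>-algebra at time \<open>T\<close>.\<close>
  define P0 where "P0 = (\<lambda>(q, r). {w\<in>space M. X q w < r}) ` (dense_times T \<times> \<rat>)"
  define P where "P = (\<lambda>J. space M \<inter> \<Inter>J) ` {J. finite J \<and> J \<subseteq> P0}"
  have "countable P0"
    unfolding P0_def using countable_dense_times countable_rat by (intro countable_image countable_SIGMA)
  then have cP: "countable P"
    unfolding P_def by (intro countable_image countable_Collect_finite_subset)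
  have TT: "T \<in> {0..T}" using T by simp
  have GTM: "sets (G T) \<subseteq> events" using G[OF TT] by (auto simp: subalgebra_def)
  have spT: "space (G T) = space M" using G[OF TT] by (auto simp: subalgebra_def)
  have P0G: "P0 \<subseteq> sets (G T)"
  proof
    fix A assume "A \<in> P0"
    then obtain q r where q: "q \<in> dense_times T" and A: "A = {w\<in>space M. X q w < r}" by (auto simp: P0_def)
    have "X q \<in> borel_measurable (natural_filtration M X T)"
      using q dense_times_subset[of T] T by (intro natural_filtration_measurable) auto
    then have "{w\<in>space (natural_filtration M X T). X q w < r} \<in> sets (natural_filtration M X T)"
      by measurable
    then show "A \<in> sets (G T)" using GT A by simp
  qed
  have PG: "P \<subseteq> sets (G T)"
  proof
    fix A assume "A \<in> P"
    then obtain J where J: "finite J" "J \<subseteq> P0" "A = space (G T) \<inter> \<Inter>J" by (auto simp: P_def spT)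
    from J(1,2) have "space (G T) \<inter> \<Inter>J \<in> sets (G T)"
    proof (induction J rule: finite_induct)
      case (insert B J)
      have "space (G T) \<inter> \<Inter>(insert B J) = B \<inter> (space (G T) \<inter> \<Inter>J)" by auto
      then show ?case using insert P0G by auto
    qed simp
    then show "A \<in> sets (G T)" using J by simp
  qed
  have stable: "Int_stable P"
  proof (rule Int_stableI)
    fix A B assume "A \<in> P" "B \<in> P"
    then obtain I J where "finite I" "I \<subseteq> P0" "A = space M \<inter> \<Inter>I" "finite J" "J \<subseteq> P0" "B = space M \<inter> \<Inter>J"
      by (auto simp: P_def)
    then show "A \<inter> B \<in> P"
      unfolding P_def by (intro image_eqI[of _ _ "I \<union> J"]) auto
  qed
  have gen: "sets (G T) \<subseteq> sigma_sets (space M) P"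
  proof -
    define H where "H = sigma (space M) P"
    have PPow: "P \<subseteq> Pow (space M)" using PG GTM sets.space_closed by blast
    have H: "space H = space M" "sets H = sigma_sets (space M) P"
      using PPow by (auto simp: H_def)
    have "sets (natural_filtration M X T) \<subseteq> sets H"
    proof (rule natural_filtration_subset_dense[OF X TT H(1)])
      show "dense_times T \<subseteq> {0..T}" using dense_times_subset T by simp
      show "\<exists>q\<in>dense_times T. s \<le> q \<and> q < u" if s: "s \<in> {0..T}" "s < u" for s u
      proof (cases "s = T")
        case True
        then show ?thesis using that by (auto simp: dense_times_def)
      next
        case False
        then obtain q where "q \<in> \<rat>" "s < q" "q < min T u"
          using Rats_dense_in_real[of s "min T u"] s by auto
        then show ?thesis using s by (auto simp: dense_times_def intro!: bexI[of _ q])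
      qed
      show "X q \<in> borel_measurable H" if q: "q \<in> dense_times T" for q
      proof (rule borel_measurableI_less)
        fix a
        have "{w\<in>space M. X q w < r} \<in> P" if "r \<in> \<rat>" for r
          unfolding P_def using q that
          by (intro image_eqI[of _ _ "{{w\<in>space M. X q w < r}}"]) (auto simp: P0_def)
        then have "(\<Union>r\<in>\<rat> \<inter> {..<a}. {w\<in>space M. X q w < r}) \<in> sets H"
          unfolding H(2) by (intro sigma_sets_UNION countable_image) (auto intro: countable_subset[OF _ countable_rat])
        also have "(\<Union>r\<in>\<rat> \<inter> {..<a}. {w\<in>space M. X q w < r}) = {w\<in>space H. X q w < a}"
        proof (intro equalityI subsetI)
          fix w assume "w \<in> {w\<in>space H. X q w < a}"
          then show "w \<in> (\<Union>r\<in>\<rat> \<inter> {..<a}. {w\<in>space M. X q w < r})"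
            using Rats_dense_in_real[of "X q w" a] H(1) by auto
        qed (auto simp: H(1))
        finally show "{w\<in>space H. X q w < a} \<in> sets H" .
      qed
    qed
    then show ?thesis using GT H by simp
  qed
  have "\<exists>Nn N. (\<forall>n. cadlag_cond_prob M T (Gn n) A (Nn n)) \<and> cadlag_cond_prob M T G A N \<and>
      skorokhod_tendsto_in_prob M T Nn N" if "A \<in> P" for A
    using conv PG that unfolding weak_conv_filtrations_def by blast
  then obtain Nn N where N: "\<And>A n. A \<in> P \<Longrightarrow> cadlag_cond_prob M T (Gn n) A (Nn A n)"
    "\<And>A. A \<in> P \<Longrightarrow> cadlag_cond_prob M T G A (N A)" "\<And>A. A \<in> P \<Longrightarrow> skorokhod_tendsto_in_prob M T (Nn A) (N A)"
    by metis
  define C where "C = (\<Union>A\<in>P. fixed_discontinuities M T (N A))"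
  show ?thesis
  proof (rule that[of C])
    show "countable C"
      unfolding C_def using T N(2) by (intro countable_UN[OF cP] countable_fixed_discontinuities)
        (auto simp: cadlag_cond_prob_def)
    fix t and U :: "'a \<Rightarrow> real" assume t: "t \<in> insert T ({0..T} - C)" and U: "integrable M U" "U \<in> borel_measurable (G T)"
    have tT: "t \<in> {0..T}" using t TT by auto
    note sub = Gn[OF tT] G[OF tT]
    have P: "cond_exp_conv (\<lambda>n. Gn n t) (G t) (indicator A)" if "A \<in> P" for A
    proof (rule cond_exp_conv_indicator[OF T _ _ sub N(1)[OF that] N(2)[OF that] N(3)[OF that]])
      show "t \<in> insert T ({0..T} - fixed_discontinuities M T (N A))"
        using t that by (auto simp: C_def)
      show "A \<in> events" using that PG GTM by auto
    qed
    have "cond_exp_conv (\<lambda>n. Gn n t) (G t) (indicator A)" if "A \<in> sets (G T)" for A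
      by (rule cond_exp_conv_sigma_sets[OF sub stable subset_trans[OF PG GTM] P]) (use that gen in auto)
    then show "cond_exp_conv (\<lambda>n. Gn n t) (G t) U"
      by (rule cond_exp_conv_integrable[OF sub G[OF TT] _ U])
  qed
qed

section \<open>Stopping times on a finite grid\<close>

lemma fine_grid_avoiding_countable:
  fixes d :: real
  assumes T: "T > 0" and d: "d > 0" and C: "countable C"
  obtains S where "finite S" "S \<subseteq> {0..<T} - C"
    "\<And>t. t \<in> {0..<T} \<Longrightarrow> \<exists>s\<in>insert T S. t < s \<and> s \<le> t + d"
proof -
  have "\<exists>s. s \<in> {real j * d / 2<..<real (Suc j) * d / 2} - C" for j
  proof -
    have "uncountable ({real j * d / 2<..<real (Suc j) * d / 2})"
      using d by (simp add: uncountable_open_interval divide_strict_right_mono)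
    then have "uncountable ({real j * d / 2<..<real (Suc j) * d / 2} - C)"
      using C by (rule uncountable_minus_countable)
    then show ?thesis by (metis countable_empty ex_in_conv)
  qed
  then obtain g where g: "\<And>j. g j \<in> {real j * d / 2<..<real (Suc j) * d / 2} - C" by metis
  obtain m where m: "2 * T / d < real m" using reals_Archimedean2 by blast
  define S where "S = g ` {..m} \<inter> {0..<T}"
  show ?thesis
  proof (rule that[of S])
    show "finite S" "S \<subseteq> {0..<T} - C" using g by (auto simp: S_def)
    fix t assume t: "t \<in> {0..<T}"
    define j where "j = Suc (nat \<lfloor>2 * t / d\<rfloor>)"
    have t0: "0 \<le> 2 * t / d" using t d by simp
    then have j: "2 * t / d < real j" "real j \<le> 2 * t / d + 1"
      unfolding j_def by linarith+
    have tj: "t < real j * d / 2" using j(1) d by (simp add: field_simps)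
    have "real (Suc j) * d \<le> (2 * t / d + 2) * d"
      using j(2) d by (intro mult_right_mono) auto
    moreover have "(2 * t / d + 2) * d = 2 * t + 2 * d" using d by (simp add: distrib_right)
    ultimately have "real (Suc j) * d / 2 \<le> t + d" by simp
    with tj have "t < real j * d / 2" "real (Suc j) * d / 2 \<le> t + d" by auto
    moreover have "real j * d / 2 < g j" "g j < real (Suc j) * d / 2" using g[of j] by auto
    ultimately have gj: "t < g j" "g j \<le> t + d" by linarith+
    have "2 * t / d < 2 * T / d" using t d by (simp add: divide_strict_right_mono)
    then have "\<lfloor>2 * t / d\<rfloor> < int m" using m by (simp add: floor_less_iff)
    then have "j \<le> m" using t0 by (simp add: j_def nat_less_iff Suc_le_eq)
    show "\<exists>s\<in>insert T S. t < s \<and> s \<le> t + d"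
    proof (cases "g j < T")
      case True
      then show ?thesis using gj t \<open>j \<le> m\<close> by (intro bexI[of _ "g j"]) (auto simp: S_def)
    next
      case False
      then show ?thesis using gj t by (intro bexI[of _ T]) auto
    qed
  qed
qed

lemma stopping_times_iff:
  assumes "\<And>t. space (G t) = space M"
  shows "\<tau> \<in> stopping_times M T G \<longleftrightarrow>
    (\<forall>t. {w\<in>space M. \<tau> w \<le> t} \<in> sets (G t)) \<and> (\<forall>w\<in>space M. \<tau> w \<in> {0..T})"
  using assms by (simp add: stopping_times_def stopping_time_def pred_def)

lemma stopping_times_measurable:
  assumes G: "\<And>t. space (G t) = space M" "\<And>t. t \<le> T \<Longrightarrow> subalgebra M (G t)"
    and \<tau>: "\<tau> \<in> stopping_times M T G"
  shows "\<tau> \<in> borel_measurable M"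
proof (rule borel_measurableI_le)
  fix a
  have *: "{w\<in>space M. \<tau> w \<le> t} \<in> sets (G t)" "\<forall>w\<in>space M. \<tau> w \<in> {0..T}" for t
    using \<tau> unfolding stopping_times_iff[where G = G, OF G(1)] by auto
  show "{w\<in>space M. \<tau> w \<le> a} \<in> sets M"
  proof (cases "a \<le> T")
    case True
    then show ?thesis using *(1)[of a] G(2) by (auto simp: subalgebra_def)
  next
    case False
    then have "{w\<in>space M. \<tau> w \<le> a} = space M" using *(2) by force
    then show ?thesis by simp
  qed
qed

lemma stopping_times_finite_range:
  assumes G: "\<And>t. space (G t) = space M" "\<And>s t. s \<le> t \<Longrightarrow> sets (G s) \<subseteq> sets (G t)"
    and S: "finite S" "S \<subseteq> {0..T}" and \<tau>: "\<And>w. w \<in> space M \<Longrightarrow> \<tau> w \<in> S"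
  shows "\<tau> \<in> stopping_times M T G \<longleftrightarrow> (\<forall>s\<in>S. {w\<in>space M. \<tau> w = s} \<in> sets (G s))"
proof
  assume "\<tau> \<in> stopping_times M T G"
  then have le: "{w\<in>space M. \<tau> w \<le> t} \<in> sets (G t)" for t
    unfolding stopping_times_iff[where G = G, OF G(1)] by auto
  show "\<forall>s\<in>S. {w\<in>space M. \<tau> w = s} \<in> sets (G s)"
  proof
    fix s assume "s \<in> S"
    have "{w\<in>space M. \<tau> w \<le> r} \<in> sets (G s)" if "r \<le> s" for r
      using le[of r] G(2)[OF that] by blast
    then have "{w\<in>space M. \<tau> w \<le> s} - (\<Union>r\<in>S \<inter> {..<s}. {w\<in>space M. \<tau> w \<le> r}) \<in> sets (G s)"
      using S by (intro sets.Diff sets.finite_UN) auto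
    also have "{w\<in>space M. \<tau> w \<le> s} - (\<Union>r\<in>S \<inter> {..<s}. {w\<in>space M. \<tau> w \<le> r}) = {w\<in>space M. \<tau> w = s}"
      using \<tau> by force
    finally show "{w\<in>space M. \<tau> w = s} \<in> sets (G s)" .
  qed
next
  assume eq: "\<forall>s\<in>S. {w\<in>space M. \<tau> w = s} \<in> sets (G s)"
  have "{w\<in>space M. \<tau> w \<le> t} \<in> sets (G t)" for t
  proof -
    have "{w\<in>space M. \<tau> w = s} \<in> sets (G t)" if "s \<in> S \<inter> {..t}" for s
      using that eq G(2)[of s t] by blast
    then have "(\<Union>s\<in>S \<inter> {..t}. {w\<in>space M. \<tau> w = s}) \<in> sets (G t)"
      using S by (intro sets.finite_UN) auto
    also have "(\<Union>s\<in>S \<inter> {..t}. {w\<in>space M. \<tau> w = s}) = {w\<in>space M. \<tau> w \<le> t}"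
      using \<tau> by auto
    finally show ?thesis .
  qed
  then show "\<tau> \<in> stopping_times M T G"
    unfolding stopping_times_iff[where G = G, OF G(1)] using \<tau> S by blast
qed

text \<open>A rule that has not stopped at any time in \<open>S\<close> stops at \<open>T\<close>.\<close>

definition first_true :: "real \<Rightarrow> real set \<Rightarrow> (real \<Rightarrow> bool) \<Rightarrow> real" where
  "first_true T S P = Min (insert T {s\<in>S. P s})"

lemma first_true:
  assumes "finite S" "S \<subseteq> {0..<T}" "0 \<le> T"
  shows "first_true T S P \<in> insert T S" "first_true T S P \<in> {0..T}"
    "t < T \<Longrightarrow> first_true T S P \<le> t \<longleftrightarrow> (\<exists>s\<in>S \<inter> {..t}. P s)"
proof -
  have fin: "finite (insert T {s\<in>S. P s})" "insert T {s\<in>S. P s} \<noteq> {}" using assms by auto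
  show "first_true T S P \<in> insert T S" using Min_in[OF fin] by (auto simp: first_true_def)
  then show "first_true T S P \<in> {0..T}" using assms by auto
  show "first_true T S P \<le> t \<longleftrightarrow> (\<exists>s\<in>S \<inter> {..t}. P s)" if "t < T"
    unfolding first_true_def using fin that by (auto simp: Min_le_iff)
qed

text \<open>Rounding up to the first grid point, whether strictly or not, moves a time by at most the mesh.\<close>

lemma first_true_near:
  assumes S: "finite S" "S \<subseteq> {0..<T}" and mesh: "t \<in> {0..<T} \<Longrightarrow> \<exists>s\<in>insert T S. t < s \<and> s \<le> t + d"
    and t: "t \<in> {0..T}" and d: "d > 0" and P: "\<And>s. P s \<Longrightarrow> t \<le> s" "\<And>s. t < s \<Longrightarrow> P s"
  shows "t \<le> first_true T S P" "first_true T S P \<le> t + d"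
proof -
  have fin: "finite (insert T {s\<in>S. P s})" using S(1) by auto
  show "t \<le> first_true T S P"
    unfolding first_true_def using fin t P(1) by (auto simp: Min_ge_iff)
  show "first_true T S P \<le> t + d"
  proof (cases "t = T")
    case True
    have "first_true T S P \<le> T" unfolding first_true_def using fin by (intro Min_le) auto
    then show ?thesis using True d by linarith
  next
    case False
    with t have "t \<in> {0..<T}" by auto
    from mesh[OF this] obtain s where s: "s \<in> insert T S" "t < s" "s \<le> t + d" by blast
    have "first_true T S P \<le> s" unfolding first_true_def using s P(2) fin by (intro Min_le) auto
    then show ?thesis using s(3) by (rule order_trans)
  qed
qed

lemma first_true_stopping_times:
  assumes G: "\<And>t. space (G t) = space M" "\<And>s t. s \<le> t \<Longrightarrow> sets (G s) \<subseteq> sets (G t)"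
    and S: "finite S" "S \<subseteq> {0..<T}" "0 \<le> T" and P: "\<And>s. s \<in> S \<Longrightarrow> {w\<in>space M. P s w} \<in> sets (G s)"
  shows "(\<lambda>w. first_true T S (\<lambda>s. P s w)) \<in> stopping_times M T G"
proof -
  note ft = first_true[OF S]
  have "{w\<in>space M. first_true T S (\<lambda>s. P s w) \<le> t} \<in> sets (G t)" for t
  proof (cases "t < T")
    case True
    have "{w\<in>space M. P s w} \<in> sets (G t)" if "s \<in> S \<inter> {..t}" for s
      using that P[of s] G(2)[of s t] by blast
    then have "(\<Union>s\<in>S \<inter> {..t}. {w\<in>space M. P s w}) \<in> sets (G t)"
      using S(1) by (intro sets.finite_UN) auto
    also have "(\<Union>s\<in>S \<inter> {..t}. {w\<in>space M. P s w}) = {w\<in>space M. first_true T S (\<lambda>s. P s w) \<le> t}"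
      unfolding ft(3)[OF True] by auto
    finally show ?thesis .
  next
    case False
    have "first_true T S (\<lambda>s. P s w) \<le> t" for w using ft(2)[of "\<lambda>s. P s w"] False by simp
    then show ?thesis using sets.top[of "G t"] G(1) by simp
  qed
  then show ?thesis
    unfolding stopping_times_iff[where G = G, OF G(1)] using ft(2) by blast
qed

lemma (in prob_space) expectation_at_finite_time:
  fixes Z :: "real \<Rightarrow> 'a \<Rightarrow> real"
  assumes S: "finite S" "\<And>w. w \<in> space M \<Longrightarrow> \<tau> w \<in> S"
    and \<tau>: "\<And>s. s \<in> S \<Longrightarrow> {w\<in>space M. \<tau> w = s} \<in> events"
    and Z: "\<And>s. s \<in> S \<Longrightarrow> integrable M (Z s)"
  shows "(\<integral>w. Z (\<tau> w) w \<partial>M) = (\<Sum>s\<in>S. E_on M {w\<in>space M. \<tau> w = s} (Z s))"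
proof -
  have "(\<integral>w. Z (\<tau> w) w \<partial>M) = (\<integral>w. (\<Sum>s\<in>S. indicator {w\<in>space M. \<tau> w = s} w * Z s w) \<partial>M)"
  proof (intro Bochner_Integration.integral_cong refl)
    fix w assume w: "w \<in> space M"
    have "(\<Sum>s\<in>S. indicator {w\<in>space M. \<tau> w = s} w * Z s w) = (\<Sum>s\<in>S. if s = \<tau> w then Z s w else 0)"
      using w by (intro sum.cong) (auto simp: indicator_def)
    then show "Z (\<tau> w) w = (\<Sum>s\<in>S. indicator {w\<in>space M. \<tau> w = s} w * Z s w)"
      using S w by simp
  qed
  also have "\<dots> = (\<Sum>s\<in>S. E_on M {w\<in>space M. \<tau> w = s} (Z s))"
    using \<tau> Z by (intro Bochner_Integration.integral_sum integrable_indicator_times)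
  finally show ?thesis .
qed

section \<open>Approximation of events\<close>

context prob_space
begin

abbreviation eventually_near :: "(nat \<Rightarrow> 'a measure) \<Rightarrow> 'a set \<Rightarrow> real \<Rightarrow> bool" where
  "eventually_near Gn A e \<equiv> \<forall>\<^sub>F n in sequentially. \<exists>B\<in>sets (Gn n). prob (sym_diff A B) < e"

text \<open>The events that can be decided, up to small probability, from the information \<open>Gn n\<close> for large
  \<open>n\<close>.\<close>

definition approximable :: "(nat \<Rightarrow> 'a measure) \<Rightarrow> 'a set \<Rightarrow> bool" where
  "approximable Gn A \<longleftrightarrow> A \<in> events \<and>
     (\<forall>e>0. eventually_near Gn A e)"

context
  fixes Gn :: "nat \<Rightarrow> 'a measure"
  assumes Gn: "\<And>n. subalgebra M (Gn n)"
begin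

lemma Gn_events: "B \<in> sets (Gn n) \<Longrightarrow> B \<in> events"
  using Gn[of n] by (auto simp: subalgebra_def)

lemma approximable_closed:
  assumes A: "A \<in> events" and close: "\<And>e. e > 0 \<Longrightarrow> \<exists>A'. approximable Gn A' \<and> prob (sym_diff A A') < e"
  shows "approximable Gn A"
  unfolding approximable_def
proof (intro conjI A allI impI)
  fix e :: real assume e: "e > 0"
  from close[OF half_gt_zero[OF e]] obtain A' where A': "approximable Gn A'" "prob (sym_diff A A') < e / 2"
    by blast
  have ev: "A' \<in> events" using A' by (simp add: approximable_def)
  have "eventually_near Gn A' (e / 2)"
    using A'(1) half_gt_zero[OF e] unfolding approximable_def by blast
  then show "eventually_near Gn A e"
  proof eventually_elim
    case (elim n)
    then obtain B where B: "B \<in> sets (Gn n)" "prob (sym_diff A' B) < e / 2" by blast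
    note BM = Gn_events[OF B(1)]
    have "prob (sym_diff A B) \<le> prob (sym_diff A A') + prob (sym_diff A' B)"
      using A ev BM by (intro prob_subset_Un_le) auto
    then show ?case using A'(2) B by (intro bexI[of _ B]) auto
  qed
qed

lemma approximable_Un:
  assumes A: "approximable Gn A" "approximable Gn A'"
  shows "approximable Gn (A \<union> A')"
  unfolding approximable_def
proof (intro conjI allI impI)
  have ev: "A \<in> events" "A' \<in> events" using A by (simp_all add: approximable_def)
  then show "A \<union> A' \<in> events" by simp
  fix e :: real assume e: "e > 0"
  have "eventually_near Gn A (e / 2)"
    "eventually_near Gn A' (e / 2)"
    using A half_gt_zero[OF e] unfolding approximable_def by blast+
  then show "eventually_near Gn (A \<union> A') e"
  proof eventually_elim
    case (elim n)
    then obtain B B' where B: "B \<in> sets (Gn n)" "prob (sym_diff A B) < e / 2"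
      "B' \<in> sets (Gn n)" "prob (sym_diff A' B') < e / 2" by blast
    note BM = Gn_events[OF B(1)] Gn_events[OF B(3)]
    have "prob (sym_diff (A \<union> A') (B \<union> B')) \<le> prob (sym_diff A B) + prob (sym_diff A' B')"
      using ev BM by (intro prob_subset_Un_le) auto
    then show ?case using B by (intro bexI[of _ "B \<union> B'"]) auto
  qed
qed

lemma sigma_algebra_approximable: "sigma_algebra (space M) {A. approximable Gn A}"
  unfolding sigma_algebra_iff2
proof (intro conjI ballI allI impI)
  show "{A. approximable Gn A} \<subseteq> Pow (space M)"
    using sets.sets_into_space by (auto simp: approximable_def)
  have empty: "approximable Gn {}"
    unfolding approximable_def
  proof (intro conjI allI impI always_eventually)
    show "\<exists>B\<in>sets (Gn n). prob (({} - B) \<union> (B - {})) < e" if "e > 0" for n e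
      using that by (intro bexI[of _ "{}"]) auto
  qed simp
  then show "{} \<in> {A. approximable Gn A}" by simp
  show "space M - A \<in> {A. approximable Gn A}" if "A \<in> {A. approximable Gn A}" for A
  proof -
    have A: "A \<in> events" "\<And>e. e > 0 \<Longrightarrow> eventually_near Gn A e"
      using that by (auto simp: approximable_def)
    have "eventually_near Gn (space M - A) e" if "e > 0" for e
      using A(2)[OF that]
    proof eventually_elim
      case (elim n)
      then obtain B where B: "B \<in> sets (Gn n)" "prob (sym_diff A B) < e" by blast
      have sp: "space (Gn n) = space M" using Gn[of n] by (simp add: subalgebra_def)
      have "space M - B \<in> sets (Gn n)" using sets.compl_sets[OF B(1)] sp by simp
      moreover have "sym_diff (space M - A) (space M - B) = sym_diff A B"
        using sets.sets_into_space[OF A(1)] sets.sets_into_space[OF B(1)] sp by auto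
      ultimately show ?case using B(2) by (intro bexI[of _ "space M - B"]) simp_all
    qed
    then show ?thesis using A(1) by (auto simp: approximable_def)
  qed
  show "(\<Union>i. A i) \<in> {A. approximable Gn A}" if "range A \<subseteq> {A. approximable Gn A}" for A :: "nat \<Rightarrow> _"
  proof -
    have A: "approximable Gn (A i)" "A i \<in> events" for i
      using that by (auto simp: approximable_def)
    have fin: "approximable Gn (\<Union>i<k. A i)" for k
      by (induction k) (auto simp: empty lessThan_Suc A intro: approximable_Un)
    have U: "(\<Union>i. A i) \<in> events" using A by auto
    have "approximable Gn (\<Union>i. A i)"
    proof (rule approximable_closed[OF U])
      fix e :: real assume "e > 0"
      from order_tendstoD(2)[OF prob_finite_unions[of A, OF A(2)] this] obtain k where k: "prob (\<Union>i. A i) - prob (\<Union>i<k. A i) < e"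
        by (auto dest: eventually_happens)
      have "((\<Union>i. A i) - (\<Union>i<k. A i)) \<union> ((\<Union>i<k. A i) - (\<Union>i. A i)) = (\<Union>i. A i) - (\<Union>i<k. A i)" by auto
      moreover have "prob ((\<Union>i. A i) - (\<Union>i<k. A i)) = prob (\<Union>i. A i) - prob (\<Union>i<k. A i)"
        using U fin[of k] by (intro finite_measure_Diff) (auto simp: approximable_def)
      ultimately show "\<exists>A'. approximable Gn A' \<and> prob ((\<Union>i. A i) - A' \<union> (A' - (\<Union>i. A i))) < e"
        using k fin by (intro exI[of _ "\<Union>i<k. A i"]) simp
    qed
    then show ?thesis by simp
  qed
qed

text \<open>The approximating event is that \<open>Zn n\<close> exceeds a level slightly above \<open>a\<close>. The two events differ only
  if \<open>Z\<close> lies in a short interval to the right of \<open>a\<close>, or \<open>Zn n\<close> deviates from \<open>Z\<close> by half its length.\<close>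

lemma approximable_level_set:
  assumes conv: "tendsto_in_prob Zn Z" and Zn: "\<And>n. Zn n \<in> borel_measurable (Gn n)" and Z: "Z \<in> borel_measurable M"
  shows "approximable Gn {w\<in>space M. Z w > a}"
  unfolding approximable_def
proof (intro conjI allI impI)
  show "{w\<in>space M. Z w > a} \<in> events" using Z by measurable
  fix e :: real assume e: "e > 0"
  define I where "I i = {w\<in>space M. a < Z w \<and> Z w \<le> a + 1 / real (Suc i)}" for i
  have I: "I i \<in> events" for i unfolding I_def using Z by measurable
  have "(\<lambda>i. prob (I i)) \<longlonglongrightarrow> prob (\<Inter>i. I i)"
  proof (intro finite_Lim_measure_decseq)
    show "decseq I"
    proof (rule decseq_SucI, rule subsetI)
      fix i w assume "w \<in> I (Suc i)"
      moreover have "1 / real (Suc (Suc i)) \<le> 1 / real (Suc i)" by (intro frac_le) auto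
      ultimately show "w \<in> I i" by (simp add: I_def)
    qed
  qed (use I in auto)
  also have "(\<Inter>i. I i) = {}"
  proof (rule ccontr)
    assume "(\<Inter>i. I i) \<noteq> {}"
    then obtain w where "\<And>i. w \<in> I i" by blast
    then have w: "a < Z w" "\<And>i. Z w \<le> a + 1 / real (Suc i)" by (auto simp: I_def)
    then obtain i where "1 / real (Suc i) < Z w - a" using nat_approx_posE[of "Z w - a"] by auto
    then show False using w(2)[of i] by simp
  qed
  finally have "(\<lambda>i. prob (I i)) \<longlonglongrightarrow> 0" by simp
  from order_tendstoD(2)[OF this half_gt_zero[OF e]] obtain i where i: "prob (I i) < e / 2"
    by (auto dest: eventually_happens)
  define h where "h = 1 / real (Suc i)"
  define c where "c = h / 2"
  have "h > 0" by (simp add: h_def)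
  then have c: "c > 0" "2 * c = h" by (simp_all add: c_def)
  have ci: "w \<in> I i" if "w \<in> space M" "a < Z w" "Z w \<le> a + 2 * c" for w
    using that unfolding I_def c(2) h_def by blast
  define D where "D n = {w\<in>space M. \<bar>Zn n w - Z w\<bar> \<ge> c}" for n
  have sub: "Zn n \<in> borel_measurable M" for n by (rule measurable_from_subalg[OF Gn Zn])
  have D: "D n \<in> events" for n unfolding D_def using sub[of n] Z by measurable
  have "(\<lambda>n. prob (D n)) \<longlonglongrightarrow> 0" using conv c(1) by (simp add: tendsto_in_prob_def D_def)
  from order_tendstoD(2)[OF this half_gt_zero[OF e]]
  show "eventually_near Gn {w\<in>space M. Z w > a} e"
  proof eventually_elim
    case (elim n)
    define B where "B = {w\<in>space M. Zn n w > a + c}"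
    have "{w\<in>space (Gn n). Zn n w > a + c} \<in> sets (Gn n)" using Zn[of n] by measurable
    then have B: "B \<in> sets (Gn n)" using Gn[of n] by (simp add: B_def subalgebra_def)
    have "sym_diff {w\<in>space M. Z w > a} B \<subseteq> I i \<union> D n"
    proof
      fix w assume w: "w \<in> sym_diff {w\<in>space M. Z w > a} B"
      then have sp: "w \<in> space M" by (auto simp: B_def)
      consider "a < Z w" "Z w \<le> a + 2 * c" | "\<bar>Zn n w - Z w\<bar> \<ge> c"
        using w by (auto simp: B_def) linarith+
      then show "w \<in> I i \<union> D n" using ci[OF sp] sp by cases (auto simp: D_def)
    qed
    from prob_subset_Un_le[OF this I D] show ?case using i elim B by (intro bexI[of _ B]) auto
  qed
qed

end

text \<open>Approximable events form a \<open>\<sigma>\<close>-algebra that contains the level sets of \<open>X\<close> at all times up to \<open>t\<close>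
  that are no fixed discontinuities. These times are dense from the right in \<open>[0,t]\<close>, where \<open>t\<close> itself
  has to be one of them.\<close>

lemma approximable_natural_filtration:
  assumes T: "T > 0" and Xn: "\<And>n. cadlag_process M T (Xn n)" and X: "cadlag_process M T X"
    and conv: "skorokhod_tendsto_in_prob M T Xn X"
    and t: "t \<in> {0..T} - fixed_discontinuities M T X" and A: "A \<in> sets (natural_filtration M X t)"
  shows "approximable (\<lambda>n. natural_filtration M (Xn n) t) A"
proof -
  let ?G = "\<lambda>n. natural_filtration M (Xn n) t" and ?C = "fixed_discontinuities M T X"
  have tT: "t \<in> {0..T}" using t by simp
  have G: "subalgebra M (?G n)" for n using tT by (intro subalgebra_natural_filtration[OF Xn]) simp
  interpret H: sigma_algebra "space M" "{A. approximable ?G A}" by (rule sigma_algebra_approximable[OF G])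
  define H where "H = sigma (space M) {A. approximable ?G A}"
  have H: "space H = space M" "sets H = {A. approximable ?G A}"
    using H.space_closed by (auto simp: H_def H.sets_measure_of_eq space_measure_of_conv)
  have "sets (natural_filtration M X t) \<subseteq> sets H"
  proof (rule natural_filtration_subset_dense[OF X tT H(1), of "{0..t} - ?C"])
    show "X q \<in> borel_measurable H" if q: "q \<in> {0..t} - ?C" for q
    proof (rule borel_measurableI_greater)
      fix a
      have "approximable ?G {w\<in>space M. X q w > a}"
      proof (rule approximable_level_set[OF G])
        show "tendsto_in_prob (\<lambda>n. Xn n q) (X q)"
          using q tT by (intro tendsto_in_prob_at_time[OF T Xn X conv]) auto
        show "Xn n q \<in> borel_measurable (?G n)" for n
          using q by (intro natural_filtration_measurable) auto
        show "X q \<in> borel_measurable M" using X q tT by (auto simp: cadlag_process_def)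
      qed
      then show "{w\<in>space H. a < X q w} \<in> sets H" by (simp add: H)
    qed
    show "\<exists>q\<in>{0..t} - ?C. s \<le> q \<and> q < u" if s: "s \<in> {0..t}" "s < u" for s u
    proof (cases "s = t")
      case True
      then show ?thesis using t s by (intro bexI[of _ t]) auto
    next
      case False
      then have "uncountable {s<..<min t u}" using s by (simp add: uncountable_open_interval)
      then have "uncountable ({s<..<min t u} - ?C)"
        using T by (intro uncountable_minus_countable countable_fixed_discontinuities[OF _ X]) auto
      then obtain q where "q \<in> {s<..<min t u} - ?C" by (metis countable_empty ex_in_conv)
      then show ?thesis using s by (intro bexI[of _ q]) auto
    qed
  qed auto
  then show ?thesis using A H by auto
qed

end

section \<open>Bounds for the optimal values\<close>

abbreviation E_reward ::
  "'a measure \<Rightarrow> (real \<times> real \<Rightarrow> real) \<Rightarrow> (real \<Rightarrow> 'a \<Rightarrow> real) \<Rightarrow> ('a \<Rightarrow> real) \<Rightarrow> real" where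
  "E_reward M \<gamma> Y \<tau> \<equiv> \<integral>w. \<gamma> (\<tau> w, Y (\<tau> w) w) \<partial>M"

context prob_space
begin

context
  fixes T K :: real and \<gamma> :: "real \<times> real \<Rightarrow> real"
  assumes T: "T > 0" and \<gamma>: "continuous_on ({0..T} \<times> UNIV) \<gamma>"
    and K: "K > 0" "\<And>t x. t \<in> {0..T} \<Longrightarrow> \<bar>\<gamma> (t, x)\<bar> \<le> K"
begin

lemma reward_diff_bound:
  assumes "s \<in> {0..T}" "t \<in> {0..T}"
  shows "\<bar>\<gamma> (s, x) - \<gamma> (t, y)\<bar> \<le> 2 * K"
  using K(2)[OF assms(1), of x] K(2)[OF assms(2), of y] by linarith

lemma integrable_reward:
  assumes "\<tau> \<in> borel_measurable M" "\<And>w. w \<in> space M \<Longrightarrow> \<tau> w \<in> {0..T}" "Z \<in> borel_measurable M"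
  shows "integrable M (\<lambda>w. \<gamma> (\<tau> w, Z w))"
  using assms K(2) by (intro integrable_const_bound[where B = K] reward_measurable[OF \<gamma>]) auto

lemma reward_modulus:
  assumes X: "cadlag_process M T X" and p: "p > 0" and e: "e > 0"
  obtains B h where "B \<in> events" "prob B < p" "h > 0"
    "\<And>w s t u v x y. w \<in> space M - B \<Longrightarrow> s \<in> {0..T} \<Longrightarrow> t \<in> {0..T} \<Longrightarrow> u \<in> {0..T} \<Longrightarrow> v \<in> {0..T} \<Longrightarrow>
       \<bar>x - X u w\<bar> < 1 \<Longrightarrow> \<bar>y - X v w\<bar> < 1 \<Longrightarrow> \<bar>s - t\<bar> < h \<Longrightarrow> \<bar>x - y\<bar> < h \<Longrightarrow> \<bar>\<gamma> (s, x) - \<gamma> (t, y)\<bar> \<le> e"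
proof -
  from cadlag_process_bounded_in_prob[OF less_imp_le[OF T] X p]
  obtain B R where B: "B \<in> events" "prob B < p"
    "\<And>w t. w \<in> space M - B \<Longrightarrow> t \<in> {0..T} \<Longrightarrow> \<bar>X t w\<bar> \<le> R" by blast
  have "uniformly_continuous_on ({0..T} \<times> {-R-1..R+1}) \<gamma>"
    using \<gamma> by (intro compact_uniformly_continuous compact_Times) (auto elim: continuous_on_subset)
  then obtain d where d: "d > 0" "\<And>p q. p \<in> {0..T} \<times> {-R-1..R+1} \<Longrightarrow> q \<in> {0..T} \<times> {-R-1..R+1} \<Longrightarrow>
      dist q p < d \<Longrightarrow> dist (\<gamma> q) (\<gamma> p) < e"
    using e unfolding uniformly_continuous_on_def by metis
  show ?thesis
  proof (rule that[OF B(1,2), of "d / 2"])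
    fix w s t u v x y
    assume a: "w \<in> space M - B" "s \<in> {0..T}" "t \<in> {0..T}" "u \<in> {0..T}" "v \<in> {0..T}"
      "\<bar>x - X u w\<bar> < 1" "\<bar>y - X v w\<bar> < 1" "\<bar>s - t\<bar> < d / 2" "\<bar>x - y\<bar> < d / 2"
    have "dist (s, x) (t, y) \<le> \<bar>s - t\<bar> + \<bar>x - y\<bar>"
      by (simp add: dist_Pair_Pair dist_real_def sqrt_sum_squares_le_sum_abs)
    then have "dist (s, x) (t, y) < d" using a(8,9) by simp
    moreover have "x \<in> {-R-1..R+1}" "y \<in> {-R-1..R+1}"
      using B(3)[OF a(1,4)] B(3)[OF a(1,5)] a(6,7) by auto
    ultimately have "dist (\<gamma> (s, x)) (\<gamma> (t, y)) < e" using a(2,3) by (intro d(2)) auto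
    then show "\<bar>\<gamma> (s, x) - \<gamma> (t, y)\<bar> \<le> e" by (simp add: dist_real_def)
  qed (use d(1) in simp)
qed

lemma integrable_reward_at:
  assumes "s \<in> {0..T}" "cadlag_process M T Y"
  shows "integrable M (\<lambda>w. \<gamma> (s, Y s w))"
  using assms by (intro integrable_reward) (auto simp: cadlag_process_def)

lemma expected_reward_le:
  assumes "\<And>w. w \<in> space M \<Longrightarrow> \<tau> w \<in> {0..T}"
  shows "(\<integral>w. \<gamma> (\<tau> w, Z w) \<partial>M) \<le> K"
proof (cases "integrable M (\<lambda>w. \<gamma> (\<tau> w, Z w))")
  case True
  then have "(\<integral>w. \<gamma> (\<tau> w, Z w) \<partial>M) \<le> (\<integral>w. K \<partial>M)"
    using assms K(2) by (intro integral_mono) (auto simp: abs_le_iff)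
  then show ?thesis by (simp add: prob_space)
next
  case False
  then show ?thesis using K(1) by (simp add: not_integrable_integral_eq)
qed

lemma expected_reward_le_optimal_value:
  assumes "\<tau> \<in> stopping_times M T G"
  shows "E_reward M \<gamma> Y \<tau> \<le> optimal_value M T G \<gamma> Y"
  unfolding optimal_value_def
proof (rule cSUP_upper[OF assms])
  show "bdd_above ((\<lambda>\<tau>. \<integral>w. \<gamma> (\<tau> w, Y (\<tau> w) w) \<partial>M) ` stopping_times M T G)"
    using expected_reward_le by (intro bdd_aboveI2[where M = K]) (auto simp: stopping_times_def)
qed

lemma optimal_value_le:
  assumes "\<And>t. space (G t) = space M"
    and "\<And>\<tau>. \<tau> \<in> stopping_times M T G \<Longrightarrow> E_reward M \<gamma> Y \<tau> \<le> c"
  shows "optimal_value M T G \<gamma> Y \<le> c"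
  unfolding optimal_value_def
proof (rule cSUP_least)
  have "{w\<in>space M. T \<le> t} \<in> sets (G t)" for t
    using sets.top[of "G t"] by (cases "T \<le> t") (simp_all add: assms(1))
  moreover have "T \<in> {0..T}" using T by simp
  ultimately have "(\<lambda>_. T) \<in> stopping_times M T G"
    unfolding stopping_times_iff[where G = G, OF assms(1)] by blast
  then show "stopping_times M T G \<noteq> {}" by blast
qed (rule assms(2))

text \<open>The difference of the rewards at a random time in \<open>S\<close> is at most the sum over \<open>S\<close> of the differences
  at the fixed times. This sum does not involve the random time, which gives the uniformity.\<close>

lemma expected_reward_exchange:
  assumes Xn: "\<And>n. cadlag_process M T (Xn n)" and X: "cadlag_process M T X"
    and S: "finite S" "S \<subseteq> {0..T}" and conv: "\<And>s. s \<in> S \<Longrightarrow> tendsto_in_prob (\<lambda>n. Xn n s) (X s)"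
    and e: "e > 0"
  shows "\<forall>\<^sub>F n in sequentially. \<forall>\<tau>. \<tau> \<in> borel_measurable M \<longrightarrow> (\<forall>w\<in>space M. \<tau> w \<in> S) \<longrightarrow>
    \<bar>E_reward M \<gamma> (Xn n) \<tau> - E_reward M \<gamma> X \<tau>\<bar> < e"
proof -
  define a where "a n s = (\<integral>w. \<bar>\<gamma> (s, Xn n s w) - \<gamma> (s, X s w)\<bar> \<partial>M)" for n s
  have int: "integrable M (\<lambda>w. \<gamma> (s, Xn n s w))" "integrable M (\<lambda>w. \<gamma> (s, X s w))" if "s \<in> S" for s n
    using that S(2) Xn X by (auto intro!: integrable_reward_at)
  have "(\<lambda>n. a n s) \<longlonglongrightarrow> 0" if s: "s \<in> S" for s
  proof (rule tendsto_zero_if_eventually_small)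
    have sT: "s \<in> {0..T}" using s S by auto
    have meas: "Xn n s \<in> borel_measurable M" "X s \<in> borel_measurable M" for n
      using Xn X sT by (auto simp: cadlag_process_def)
    fix r :: real assume r: "r > 0"
    \<comment> \<open>Two exceptional events of probability \<open>p\<close> cost \<open>r / 2\<close>.\<close>
    define p where "p = r / (8 * K)"
    have p: "p > 0" using r K by (simp add: p_def)
    obtain B h where B: "B \<in> events" "prob B < p" and h: "h > 0"
      "\<And>w x. w \<in> space M - B \<Longrightarrow> \<bar>x - X s w\<bar> < min h 1 \<Longrightarrow> \<bar>\<gamma> (s, x) - \<gamma> (s, X s w)\<bar> \<le> r / 2"
      by (rule reward_modulus[OF X p half_gt_zero[OF r]]) (use sT in force)
    define D where "D n = {w\<in>space M. \<bar>Xn n s w - X s w\<bar> \<ge> min h 1}" for n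
    have D: "D n \<in> events" for n unfolding D_def using meas(1)[of n] meas(2) by measurable
    have "(\<lambda>n. prob (D n)) \<longlonglongrightarrow> 0"
      using conv[OF s] h(1) by (auto simp: tendsto_in_prob_def D_def)
    from order_tendstoD(2)[OF this p] show "\<forall>\<^sub>F n in sequentially. a n s < r"
    proof eventually_elim
      case (elim n)
      have "a n s \<le> r / 2 + 2 * K * prob (B \<union> D n)"
        unfolding a_def
      proof (rule abs_expectation_diff_le)
        show "\<bar>\<gamma> (s, Xn n s w) - \<gamma> (s, X s w)\<bar> \<le> r / 2" if "w \<in> space M - (B \<union> D n)" for w
          using that by (intro h(2)) (auto simp: D_def)
      qed (use int[OF s] reward_diff_bound[OF sT sT] B(1) D K r in \<open>auto intro!: AE_I2\<close>)
      moreover have "prob (B \<union> D n) \<le> prob B + prob (D n)" using B(1) D by (intro measure_Un_le)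
      then have "2 * K * prob (B \<union> D n) < 2 * K * (2 * p)" using K elim B(2) by simp
      moreover have "2 * K * (2 * p) = r / 2" using K by (simp add: p_def)
      ultimately show ?case by simp
    qed
  qed (simp add: a_def)
  then have "(\<lambda>n. \<Sum>s\<in>S. a n s) \<longlonglongrightarrow> (\<Sum>s\<in>S. 0)" by (intro tendsto_sum)
  then have "\<forall>\<^sub>F n in sequentially. (\<Sum>s\<in>S. a n s) < e"
    using e by (intro order_tendstoD(2)) auto
  then show ?thesis
  proof eventually_elim
    case (elim n)
    show ?case
    proof (intro allI impI)
      fix \<tau> assume \<tau>: "\<tau> \<in> borel_measurable M" "\<forall>w\<in>space M. \<tau> w \<in> S"
      have \<tau>T: "\<And>w. w \<in> space M \<Longrightarrow> \<tau> w \<in> {0..T}" using \<tau>(2) S(2) by blast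
      note i = integrable_reward[OF \<tau>(1) \<tau>T cadlag_process_at_random_time_measurable[OF Xn[of n] \<tau>(1) \<tau>T]]
        integrable_reward[OF \<tau>(1) \<tau>T cadlag_process_at_random_time_measurable[OF X \<tau>(1) \<tau>T]]
      have "\<bar>E_reward M \<gamma> (Xn n) \<tau> - E_reward M \<gamma> X \<tau>\<bar>
         = \<bar>\<integral>w. \<gamma> (\<tau> w, Xn n (\<tau> w) w) - \<gamma> (\<tau> w, X (\<tau> w) w) \<partial>M\<bar>"
        using i by (subst Bochner_Integration.integral_diff) auto
      also have "\<dots> \<le> (\<integral>w. \<bar>\<gamma> (\<tau> w, Xn n (\<tau> w) w) - \<gamma> (\<tau> w, X (\<tau> w) w)\<bar> \<partial>M)"
        by (rule integral_abs_bound)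
      also have "\<dots> \<le> (\<integral>w. (\<Sum>s\<in>S. \<bar>\<gamma> (s, Xn n s w) - \<gamma> (s, X s w)\<bar>) \<partial>M)"
      proof (rule integral_mono)
        fix w assume w: "w \<in> space M"
        then show "\<bar>\<gamma> (\<tau> w, Xn n (\<tau> w) w) - \<gamma> (\<tau> w, X (\<tau> w) w)\<bar> \<le> (\<Sum>s\<in>S. \<bar>\<gamma> (s, Xn n s w) - \<gamma> (s, X s w)\<bar>)"
          using \<tau>(2) S(1) by (intro member_le_sum[where f = "\<lambda>s. \<bar>\<gamma> (s, Xn n s w) - \<gamma> (s, X s w)\<bar>"]) auto
      qed (use i int in auto)
      also have "\<dots> = (\<Sum>s\<in>S. a n s)"
        unfolding a_def using int by (intro Bochner_Integration.integral_sum) auto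
      finally show "\<bar>E_reward M \<gamma> (Xn n) \<tau> - E_reward M \<gamma> X \<tau>\<bar> < e"
        using elim by simp
    qed
  qed
qed

text \<open>A stopping time and its rounding to the next grid point are two ordered stopping times at distance at
  most the mesh, so Aldous' criterion bounds the increment of \<open>X\<^sup>n\<close> between them. The paths stay in a
  fixed compact set up to a small probability, and there \<open>\<gamma>\<close> is uniformly continuous.\<close>

lemma expected_reward_rounding:
  assumes Xn: "\<And>n. cadlag_process M T (Xn n)" and X: "cadlag_process M T X"
    and conv: "skorokhod_tendsto_in_prob M T Xn X" and aldous: "aldous_criterion M T Gn Xn"
    and Gn: "\<And>n t. space (Gn n t) = space M" "\<And>n s t. s \<le> t \<Longrightarrow> sets (Gn n s) \<subseteq> sets (Gn n t)"
      "\<And>n t. t \<le> T \<Longrightarrow> subalgebra M (Gn n t)"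
    and C: "countable C" and e: "e > 0"
  obtains S where "finite S" "S \<subseteq> {0..<T} - C"
    "\<forall>\<^sub>F n in sequentially. \<forall>\<tau>\<in>stopping_times M T (Gn n). \<exists>\<nu>\<in>stopping_times M T (Gn n).
       (\<forall>w\<in>space M. \<nu> w \<in> insert T S) \<and> E_reward M \<gamma> (Xn n) \<tau> \<le> E_reward M \<gamma> (Xn n) \<nu> + e"
proof -
  \<comment> \<open>Three exceptional events of probability \<open>p\<close>, on which rewards differ by at most \<open>2 K\<close>, cost \<open>e / 2\<close>.\<close>
  define p where "p = e / (12 * K)"
  have p: "p > 0" using e K by (simp add: p_def)
  from skorokhod_tendsto_in_prob_close[OF prob_space_axioms T Xn X conv zero_less_one]
  obtain D where D: "\<And>n. D n \<in> events" "(\<lambda>n. prob (D n)) \<longlonglongrightarrow> 0"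
    "\<And>n w. w \<in> space M - D n \<Longrightarrow>
       \<exists>l\<in>time_changes T. \<forall>t\<in>{0..T}. \<bar>l t - t\<bar> < 1 \<and> \<bar>Xn n t w - X (l t) w\<bar> < 1" by blast
  obtain B h where B: "B \<in> events" "prob B < p" and h: "h > 0"
    "\<And>w s t u v x y. w \<in> space M - B \<Longrightarrow> s \<in> {0..T} \<Longrightarrow> t \<in> {0..T} \<Longrightarrow> u \<in> {0..T} \<Longrightarrow> v \<in> {0..T} \<Longrightarrow>
       \<bar>x - X u w\<bar> < 1 \<Longrightarrow> \<bar>y - X v w\<bar> < 1 \<Longrightarrow> \<bar>s - t\<bar> < h \<Longrightarrow> \<bar>x - y\<bar> < h \<Longrightarrow> \<bar>\<gamma> (s, x) - \<gamma> (t, y)\<bar> \<le> e / 2"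
    using reward_modulus[OF X p half_gt_zero[OF e]] by metis
  define P where "P \<delta> n = {(\<sigma>, \<nu>). \<sigma> \<in> stopping_times M T (Gn n) \<and> \<nu> \<in> stopping_times M T (Gn n) \<and>
                                (\<forall>w\<in>space M. \<sigma> w \<le> \<nu> w \<and> \<nu> w \<le> \<sigma> w + \<delta>)}" for \<delta> :: real and n
  define Q where "Q n = (\<lambda>(\<sigma>, \<nu>). emeasure M {w\<in>space M. \<bar>Xn n (\<sigma> w) w - Xn n (\<nu> w) w\<bar> \<ge> h})" for n
  have "((\<lambda>\<delta>. limsup (\<lambda>n. SUP \<sigma>\<nu>\<in>P \<delta> n. Q n \<sigma>\<nu>)) \<longlongrightarrow> 0) (at_right 0)"
    using aldous h(1) unfolding aldous_criterion_def P_def Q_def by blast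
  moreover have "(0 :: ennreal) < ennreal p" using p by simp
  ultimately have "\<forall>\<^sub>F \<delta> in at_right 0. limsup (\<lambda>n. SUP \<sigma>\<nu>\<in>P \<delta> n. Q n \<sigma>\<nu>) < ennreal p"
    by (rule order_tendstoD(2))
  moreover have "\<forall>\<^sub>F \<delta> in at_right 0. \<delta> \<in> {0<..<h}"
    using h(1) by (rule eventually_at_right_real)
  ultimately have "\<forall>\<^sub>F \<delta> in at_right 0. limsup (\<lambda>n. SUP \<sigma>\<nu>\<in>P \<delta> n. Q n \<sigma>\<nu>) < ennreal p \<and> \<delta> \<in> {0<..<h}"
    by (rule eventually_conj)
  then obtain d where d: "limsup (\<lambda>n. SUP \<sigma>\<nu>\<in>P d n. Q n \<sigma>\<nu>) < ennreal p" "0 < d" "d < h"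
    by (auto dest!: eventually_happens simp: trivial_limit_at_right_real)
  obtain S where SC: "finite S" "S \<subseteq> {0..<T} - C"
    and mesh: "\<And>t. t \<in> {0..<T} \<Longrightarrow> \<exists>s\<in>insert T S. t < s \<and> s \<le> t + d"
    using fine_grid_avoiding_countable[OF T d(2) C] by metis
  have S: "finite S" "S \<subseteq> {0..<T}" using SC by auto
  show ?thesis
  proof (rule that[OF SC])
    have "\<forall>\<^sub>F n in sequentially. (SUP \<sigma>\<nu>\<in>P d n. Q n \<sigma>\<nu>) < ennreal p"
      using d(1) by (rule Limsup_lessD)
    moreover have "\<forall>\<^sub>F n in sequentially. prob (D n) < p" using D(2) p by (rule order_tendstoD(2))
    ultimately show "\<forall>\<^sub>F n in sequentially. \<forall>\<tau>\<in>stopping_times M T (Gn n). \<exists>\<nu>\<in>stopping_times M T (Gn n).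
         (\<forall>w\<in>space M. \<nu> w \<in> insert T S) \<and> E_reward M \<gamma> (Xn n) \<tau> \<le> E_reward M \<gamma> (Xn n) \<nu> + e"
    proof eventually_elim
      case (elim n)
      show ?case
      proof
        fix \<tau> assume \<tau>: "\<tau> \<in> stopping_times M T (Gn n)"
        define \<nu> where "\<nu> w = first_true T S (\<lambda>s. \<tau> w \<le> s)" for w
        have \<nu>: "\<nu> \<in> stopping_times M T (Gn n)"
          unfolding \<nu>_def using \<tau> T Gn(1)
          by (intro first_true_stopping_times Gn S) (auto simp: stopping_times_iff)
        note meas = stopping_times_measurable[OF Gn(1,3) \<tau>] stopping_times_measurable[OF Gn(1,3) \<nu>]
        have rg: "\<tau> w \<in> {0..T}" "\<nu> w \<in> {0..T}" if "w \<in> space M" for w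
          using \<tau> \<nu> that by (auto simp: stopping_times_def)
        note Xm = cadlag_process_at_random_time_measurable[OF Xn[of n] meas(1) rg(1)]
          cadlag_process_at_random_time_measurable[OF Xn[of n] meas(2) rg(2)]
        note int = integrable_reward[OF meas(1) rg(1) Xm(1)] integrable_reward[OF meas(2) rg(2) Xm(2)]
        define J where "J = {w\<in>space M. \<bar>Xn n (\<tau> w) w - Xn n (\<nu> w) w\<bar> \<ge> h}"
        have J: "J \<in> events" unfolding J_def using Xm by measurable
        have near: "\<tau> w \<le> \<nu> w" "\<nu> w \<le> \<tau> w + d" if "w \<in> space M" for w
          unfolding \<nu>_def using first_true_near[OF S mesh rg(1)[OF that] d(2)] by auto
        then have "(\<tau>, \<nu>) \<in> P d n" using \<tau> \<nu> by (auto simp: P_def)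
        then have "Q n (\<tau>, \<nu>) \<le> (SUP \<sigma>\<nu>\<in>P d n. Q n \<sigma>\<nu>)" by (rule SUP_upper)
        then have "Q n (\<tau>, \<nu>) < ennreal p" using elim(1) by (rule le_less_trans)
        then have pJ: "prob J < p" by (simp add: Q_def J_def emeasure_eq_measure ennreal_less_iff)
        define E where "E = B \<union> D n \<union> J"
        have E: "E \<in> events" using B(1) D(1) J by (auto simp: E_def)
        have "prob E \<le> prob (B \<union> D n) + prob J" unfolding E_def using B(1) D(1) J by (intro measure_Un_le) auto
        also have "prob (B \<union> D n) \<le> prob B + prob (D n)" using B(1) D(1) by (intro measure_Un_le)
        finally have pE: "prob E \<le> 3 * p" using pJ B(2) elim(2) by simp
        have "E_reward M \<gamma> (Xn n) \<tau>
          \<le> E_reward M \<gamma> (Xn n) \<nu> + e / 2 + 2 * K * prob E"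
        proof (rule expectation_diff_le[OF int E])
          show "\<bar>\<gamma> (\<tau> w, Xn n (\<tau> w) w) - \<gamma> (\<nu> w, Xn n (\<nu> w) w)\<bar> \<le> 2 * K" if "w \<in> space M" for w
            by (rule reward_diff_bound[OF rg[OF that]])
          fix w assume w: "w \<in> space M - E"
          then obtain l where l: "l \<in> time_changes T" "\<forall>t\<in>{0..T}. \<bar>Xn n t w - X (l t) w\<bar> < 1"
            using D(3)[of w n] by (auto simp: E_def)
          have w': "w \<in> space M" using w by simp
          have "\<bar>Xn n (\<tau> w) w - Xn n (\<nu> w) w\<bar> < h" using w by (auto simp: E_def J_def)
          moreover have "\<bar>\<tau> w - \<nu> w\<bar> < h" using near[OF w'] d(3) by linarith
          ultimately show "\<bar>\<gamma> (\<tau> w, Xn n (\<tau> w) w) - \<gamma> (\<nu> w, Xn n (\<nu> w) w)\<bar> \<le> e / 2"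
            using l(2) rg[OF w'] w time_changes_mem[OF l(1)]
            by (intro h(2)[of w _ _ "l (\<tau> w)" "l (\<nu> w)"]) (auto simp: E_def)
        qed (use e K in auto)
        moreover have "2 * K * prob E \<le> 2 * K * (3 * p)" using pE K by (intro mult_left_mono) auto
        moreover have "2 * K * (3 * p) = e / 2" using K by (simp add: p_def)
        ultimately have "E_reward M \<gamma> (Xn n) \<tau> \<le> E_reward M \<gamma> (Xn n) \<nu> + e" by simp
        moreover have "\<nu> w \<in> insert T S" for w
          unfolding \<nu>_def using first_true(1)[OF S less_imp_le[OF T]] .
        ultimately show "\<exists>\<nu>\<in>stopping_times M T (Gn n). (\<forall>w\<in>space M. \<nu> w \<in> insert T S) \<and>
            E_reward M \<gamma> (Xn n) \<tau> \<le> E_reward M \<gamma> (Xn n) \<nu> + e"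
          using \<nu> by blast
      qed
    qed
  qed
qed

text \<open>The Snell envelope for \<open>Gn n\<close> bounds the rewards of the stopping times of \<open>Gn n\<close>, it converges to the
  Snell envelope for \<open>G\<close>, and the latter is attained by a stopping time of \<open>G\<close>.\<close>

lemma expected_reward_finite_weak_conv:
  assumes X: "cadlag_process M T X" and S: "finite S" "S \<subseteq> {0..T}" "S \<noteq> {}"
    and Gn: "\<And>n t. space (Gn n t) = space M" "\<And>n s t. s \<le> t \<Longrightarrow> sets (Gn n s) \<subseteq> sets (Gn n t)"
      "\<And>n t. t \<le> T \<Longrightarrow> subalgebra M (Gn n t)"
    and G: "\<And>t. space (G t) = space M" "\<And>s t. s \<le> t \<Longrightarrow> sets (G s) \<subseteq> sets (G t)"
      "\<And>t. t \<le> T \<Longrightarrow> subalgebra M (G t)" "\<And>t. t \<in> {0..T} \<Longrightarrow> X t \<in> borel_measurable (G t)"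
    and conv: "\<And>t U. t \<in> S \<Longrightarrow> integrable M U \<Longrightarrow> U \<in> borel_measurable (G T) \<Longrightarrow>
       cond_exp_conv (\<lambda>n. Gn n t) (G t) U"
    and e: "e > 0"
  shows "\<forall>\<^sub>F n in sequentially. \<forall>\<tau>\<in>stopping_times M T (Gn n). (\<forall>w\<in>space M. \<tau> w \<in> S) \<longrightarrow>
    E_reward M \<gamma> X \<tau> \<le> optimal_value M T G \<gamma> X + e"
proof -
  define L where "L = sorted_list_of_set S"
  define Z where "Z t w = \<gamma> (t, X t w)" for t w
  have L: "set L = S" "sorted_wrt (<) L" "L \<noteq> []"
    using S by (auto simp: L_def)
  have ST: "t \<le> T" if "t \<in> S" for t using that S by auto
  have Zint: "integrable M (Z t)" if "t \<in> S" for t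
    unfolding Z_def using that S X by (intro integrable_reward_at) auto
  have subT: "subalgebra (G T) (G t)" if "t \<in> S" for t
    using G(1) G(2)[OF ST[OF that]] by (simp add: subalgebra_def)
  have Zmeas: "Z t \<in> borel_measurable (G t)" if "t \<in> S" for t
    unfolding Z_def using that S by (intro reward_measurable[OF \<gamma>] G(4)) auto
  have ZT: "Z t \<in> borel_measurable (G T)" if "t \<in> S" for t
    by (rule measurable_from_subalg[OF subT Zmeas]) fact+
  have evG: "A \<in> events" if "A \<in> sets (G t)" "t \<in> S" for A t
    using G(3)[OF ST[OF that(2)]] that(1) by (auto simp: subalgebra_def)
  have evGn: "A \<in> events" if "A \<in> sets (Gn n t)" "t \<in> S" for A n t
    using Gn(3)[OF ST[OF that(2)]] that(1) by (auto simp: subalgebra_def)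
  have snG: "integrable M (snell M G Z L)"
    using L(1) by (intro integrable_snell) (auto intro: G(3) ST Zint)
  have "\<exists>A. (\<forall>t\<in>set L. A t \<in> sets (G t)) \<and> disjoint_family_on A (set L) \<and> (\<Union>t\<in>set L. A t) = space M \<and>
    (\<Sum>t\<in>set L. E_on M (A t) (Z t)) = E_on M (space M) (snell M G Z L)"
  proof (rule snell_attained[OF L(3,2)])
    show "space M \<in> sets (G (hd L))" using sets.top[of "G (hd L)"] by (simp add: G(1))
  qed (auto simp: L(1) intro: G(3) ST Zint Zmeas dest: subsetD[OF G(2)])
  then obtain A where A: "\<And>t. t \<in> S \<Longrightarrow> A t \<in> sets (G t)" "disjoint_family_on A S" "(\<Union>t\<in>S. A t) = space M"
     "(\<Sum>t\<in>S. E_on M (A t) (Z t)) = E_on M (space M) (snell M G Z L)"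
    unfolding L(1) by blast
  have "\<exists>\<sigma>. \<forall>w\<in>space M. \<sigma> w \<in> S \<and> w \<in> A (\<sigma> w)"
    using A(3) by (intro bchoice) blast
  then obtain \<sigma> where \<sigma>: "\<And>w. w \<in> space M \<Longrightarrow> \<sigma> w \<in> S" "\<And>w. w \<in> space M \<Longrightarrow> w \<in> A (\<sigma> w)" by blast
  have \<sigma>A: "{w\<in>space M. \<sigma> w = t} = A t" if "t \<in> S" for t
    using \<sigma> A(2,3) that unfolding disjoint_family_on_def by blast
  have \<sigma>st: "\<sigma> \<in> stopping_times M T G"
    using stopping_times_finite_range[OF G(1,2) S(1,2) \<sigma>(1)] \<sigma>A A(1) by simp
  have "{w\<in>space M. \<sigma> w = t} \<in> events" if "t \<in> S" for t
    unfolding \<sigma>A[OF that] by (rule evG[OF A(1)[OF that] that])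
  from expectation_at_finite_time[OF S(1) \<sigma>(1) this Zint]
  have "(\<integral>w. Z (\<sigma> w) w \<partial>M) = (\<Sum>t\<in>S. E_on M {w\<in>space M. \<sigma> w = t} (Z t))" .
  also have "\<dots> = (\<Sum>t\<in>S. E_on M (A t) (Z t))"
    by (intro sum.cong refl) (simp only: \<sigma>A)
  also have "\<dots> = (\<integral>w. snell M G Z L w \<partial>M)"
    unfolding A(4) by (intro Bochner_Integration.integral_cong) auto
  finally have value_ge: "(\<integral>w. snell M G Z L w \<partial>M) \<le> optimal_value M T G \<gamma> X"
    using expected_reward_le_optimal_value[OF \<sigma>st, of X] by (simp add: Z_def)
  have "(\<lambda>n. L1_dist M (snell M (Gn n) Z L) (snell M G Z L)) \<longlonglongrightarrow> 0"
    by (rule snell_convergence[OF L(2), where H = "G T"]) 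
      (auto simp: L(1) intro: G(3) Gn(3) ST Zint ZT subT conv)
  from order_tendstoD(2)[OF this e] show ?thesis
  proof eventually_elim
    case (elim n)
    show ?case
    proof (intro ballI impI)
      fix \<tau> assume \<tau>: "\<tau> \<in> stopping_times M T (Gn n)" "\<forall>w\<in>space M. \<tau> w \<in> S"
      define B where "B t = {w\<in>space M. \<tau> w = t}" for t
      have B: "B t \<in> sets (Gn n t)" if "t \<in> S" for t
        using stopping_times_finite_range[of "Gn n" M S T \<tau>, OF Gn(1,2) S(1,2)] \<tau> that
        by (simp add: B_def)
      have un: "(\<Union>t\<in>set L. B t) = space M" using \<tau>(2) by (auto simp: B_def L(1))
      have snn: "integrable M (snell M (Gn n) Z L)"
        using L(1) by (intro integrable_snell) (auto intro: Gn(3) ST Zint)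
      have "(\<integral>w. Z (\<tau> w) w \<partial>M) = (\<Sum>t\<in>S. E_on M (B t) (Z t))"
        unfolding B_def
      proof (rule expectation_at_finite_time[OF S(1) _ _ Zint])
        show "{w\<in>space M. \<tau> w = t} \<in> events" if "t \<in> S" for t
          using evGn[OF B[OF that] that] by (simp only: B_def)
      qed (use \<tau>(2) in blast)
      also have "\<dots> \<le> E_on M (\<Union>t\<in>set L. B t) (snell M (Gn n) Z L)"
        unfolding L(1)[symmetric]
      proof (rule snell_upper_bound[OF L(3,2)])
        show "disjoint_family_on B (set L)" by (auto simp: disjoint_family_on_def B_def)
        show "(\<Union>t\<in>set L. B t) \<in> sets (Gn n (hd L))"
          unfolding un using sets.top[of "Gn n (hd L)"] by (simp add: Gn(1))
      qed (auto simp: L(1) intro: Gn(3) ST Zint B dest: subsetD[OF Gn(2)])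
      also have "\<dots> = (\<integral>w. snell M (Gn n) Z L w \<partial>M)"
        unfolding un by (intro Bochner_Integration.integral_cong) auto
      also have "\<dots> \<le> (\<integral>w. snell M G Z L w + \<bar>snell M (Gn n) Z L w - snell M G Z L w\<bar> \<partial>M)"
        using snn snG by (intro integral_mono) auto
      also have "\<dots> = (\<integral>w. snell M G Z L w \<partial>M) + L1_dist M (snell M (Gn n) Z L) (snell M G Z L)"
        using snn snG by (intro Bochner_Integration.integral_add) auto
      finally show "E_reward M \<gamma> X \<tau> \<le> optimal_value M T G \<gamma> X + e"
        using elim value_ge by (simp add: Z_def)
    qed
  qed
qed

text \<open>The stopping time \<open>\<tau>\<close> is rounded up to the first grid point strictly after it. The strict
  inequality makes the result a stopping time of the natural filtration, although \<open>\<tau>\<close> is one of the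
  right-continuous filtration only.\<close>

lemma expected_reward_liminf:
  assumes Xn: "\<And>n. cadlag_process M T (Xn n)" and X: "cadlag_process M T X"
    and conv: "skorokhod_tendsto_in_prob M T Xn X"
    and \<tau>: "\<tau> \<in> stopping_times M T (right_continuous_filtration T (natural_filtration M X))"
    and e: "e > 0"
  shows "\<forall>\<^sub>F n in sequentially. E_reward M \<gamma> X \<tau> - e
    \<le> optimal_value M T (natural_filtration M (Xn n)) \<gamma> (Xn n)"
proof -
  let ?F = "right_continuous_filtration T (natural_filtration M X)"
  let ?C = "fixed_discontinuities M T X"
  have e3: "e / 3 > 0" using e by simp
  have \<tau>m: "\<tau> \<in> borel_measurable M"
    by (rule stopping_times_measurable[OF _ _ \<tau>]) (auto intro: subalgebra_right_continuous_filtration[OF X])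
  have \<tau>T: "\<tau> w \<in> {0..T}" if "w \<in> space M" for w using \<tau> that by (auto simp: stopping_times_def)
  have cC: "countable ?C" using T by (intro countable_fixed_discontinuities X) simp
  have "\<exists>S. finite S \<and> S \<subseteq> {0..<T} - ?C \<and> (\<forall>t\<in>{0..<T}. \<exists>s\<in>insert T S. t < s \<and> s \<le> t + 1 / real (Suc k))" for k
  proof -
    have "0 < 1 / real (Suc k)" by simp
    from fine_grid_avoiding_countable[OF T this cC] show ?thesis by metis
  qed
  then obtain S where S: "\<And>k. finite (S k)" "\<And>k. S k \<subseteq> {0..<T} - ?C"
    "\<And>k t. t \<in> {0..<T} \<Longrightarrow> \<exists>s\<in>insert T (S k). t < s \<and> s \<le> t + 1 / real (Suc k)" by metis
  have S0: "S k \<subseteq> {0..<T}" for k using S(2) by blast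
  define \<rho> where "\<rho> k w = first_true T (S k) (\<lambda>s. \<tau> w < s)" for k w
  note ft = first_true[OF S(1) S0 less_imp_le[OF T]]
  have \<rho>T: "\<rho> k w \<in> {0..T}" "\<rho> k w \<in> insert T (S k)" for k w
    using ft(1,2) unfolding \<rho>_def by auto
  have lt: "{w\<in>space M. \<tau> w < s} \<in> sets (natural_filtration M X s)" if s: "s < T" for s
  proof -
    have shift: "s - 1 / real (Suc i) < s" for i
    proof -
      have "0 < 1 / real (Suc i)" by simp
      then show ?thesis by (simp only: diff_less_eq less_add_same_cancel1)
    qed
    have "{w\<in>space M. \<tau> w \<le> s - 1 / real (Suc i)} \<in> sets (natural_filtration M X s)" for i
    proof -
      have "{w\<in>space M. \<tau> w \<le> s - 1 / real (Suc i)} \<in> sets (?F (s - 1 / real (Suc i)))"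
        using \<tau> by (subst (asm) stopping_times_iff) auto
      also have "sets (?F (s - 1 / real (Suc i))) \<subseteq> sets (natural_filtration M X s)"
      proof -
        have "s - 1 / real (Suc i) < T" using shift s by (rule less_trans)
        then show ?thesis
          using s shift[of i] by (subst sets_right_continuous_filtration[where \<Omega> = "space M"]) auto
      qed
      finally show ?thesis .
    qed
    then have "(\<Union>i. {w\<in>space M. \<tau> w \<le> s - 1 / real (Suc i)}) \<in> sets (natural_filtration M X s)" by blast
    also have "(\<Union>i. {w\<in>space M. \<tau> w \<le> s - 1 / real (Suc i)}) = {w\<in>space M. \<tau> w < s}"
    proof (intro equalityI subsetI)
      fix w assume "w \<in> (\<Union>i. {w\<in>space M. \<tau> w \<le> s - 1 / real (Suc i)})"
      then obtain i where "w \<in> space M" "\<tau> w \<le> s - 1 / real (Suc i)" by blast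
      then show "w \<in> {w\<in>space M. \<tau> w < s}" using le_less_trans[OF _ shift] by blast
    next
      fix w assume w: "w \<in> {w\<in>space M. \<tau> w < s}"
      then obtain i where "1 / real (Suc i) < s - \<tau> w" using nat_approx_posE[of "s - \<tau> w"] by auto
      then have "\<tau> w \<le> s - 1 / real (Suc i)" by simp
      then show "w \<in> (\<Union>i. {w\<in>space M. \<tau> w \<le> s - 1 / real (Suc i)})" using w by blast
    qed
    finally show ?thesis .
  qed
  have ltM: "{w\<in>space M. \<tau> w < s} \<in> events" for s using \<tau>m by measurable
  have "\<rho> k \<in> stopping_times M T (natural_filtration M X)" for k
    unfolding \<rho>_def using S0[of k] T
    by (intro first_true_stopping_times S(1) lt sets_natural_filtration_mono) auto
  then have \<rho>m: "\<rho> k \<in> borel_measurable M" for k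
    by (rule stopping_times_measurable[rotated 2]) (simp_all add: subalgebra_natural_filtration[OF X])
  have \<rho>_near: "\<tau> w \<le> \<rho> k w" "\<rho> k w \<le> \<tau> w + 1 / real (Suc k)" if w: "w \<in> space M" for k w
    unfolding \<rho>_def using first_true_near[OF S(1) S0 S(3) \<tau>T[OF w], where P = "\<lambda>s. \<tau> w < s"] by auto
  have lim: "(\<lambda>k. E_reward M \<gamma> X (\<rho> k)) \<longlonglongrightarrow> E_reward M \<gamma> X \<tau>"
  proof (rule integral_dominated_convergence[where w = "\<lambda>_. K"])
    show "AE w in M. (\<lambda>k. \<gamma> (\<rho> k w, X (\<rho> k w) w)) \<longlonglongrightarrow> \<gamma> (\<tau> w, X (\<tau> w) w)"
    proof (rule AE_I2)
      fix w assume w: "w \<in> space M"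
      have \<rho>: "(\<lambda>k. \<rho> k w) \<longlonglongrightarrow> \<tau> w" using \<rho>_near[OF w] by (rule tendsto_if_between_inverse)
      have "(\<lambda>k. X (\<rho> k w) w) \<longlonglongrightarrow> X (\<tau> w) w"
        using X w \<rho>_near(1)[OF w] \<rho>T(1)
        by (intro cadlag_on_tendsto_right[of T "\<lambda>t. X t w", OF _ \<tau>T[OF w] \<rho>]) (auto simp: cadlag_process_def)
      with \<rho> have "(\<lambda>k. (\<rho> k w, X (\<rho> k w) w)) \<longlonglongrightarrow> (\<tau> w, X (\<tau> w) w)" by (rule tendsto_Pair)
      then show "(\<lambda>k. \<gamma> (\<rho> k w, X (\<rho> k w) w)) \<longlonglongrightarrow> \<gamma> (\<tau> w, X (\<tau> w) w)"
        using \<rho>T(1) \<tau>T[OF w] by (intro continuous_on_tendsto_compose[OF \<gamma>]) auto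
    qed
    show "AE w in M. norm (\<gamma> (\<rho> k w, X (\<rho> k w) w)) \<le> K" for k
      using K(2)[OF \<rho>T(1)] by auto
    show "(\<lambda>w. \<gamma> (\<tau> w, X (\<tau> w) w)) \<in> borel_measurable M"
      by (intro reward_measurable[OF \<gamma> \<tau>m \<tau>T] cadlag_process_at_random_time_measurable[OF X \<tau>m \<tau>T])
    show "(\<lambda>w. \<gamma> (\<rho> k w, X (\<rho> k w) w)) \<in> borel_measurable M" for k
      by (intro reward_measurable[OF \<gamma> \<rho>m \<rho>T(1)] cadlag_process_at_random_time_measurable[OF X \<rho>m \<rho>T(1)])
  qed simp
  have "E_reward M \<gamma> X \<tau> - e / 3 < E_reward M \<gamma> X \<tau>" using e by simp
  from order_tendstoD(1)[OF lim this] obtain k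
    where k: "E_reward M \<gamma> X \<tau> - e / 3 < E_reward M \<gamma> X (\<rho> k)"
    by (auto dest: eventually_happens)
  \<comment> \<open>One more than the number of grid points, because the grid may be empty.\<close>
  define p where "p = e / (6 * K * real (Suc (card (S k))))"
  have p: "p > 0" using e K(1) by (simp add: p_def)
  define A where "A s = {w\<in>space M. \<tau> w < s}" for s
  have "\<forall>\<^sub>F n in sequentially. \<exists>B\<in>sets (natural_filtration M (Xn n) s). prob (sym_diff (A s) B) < p"
    if s: "s \<in> S k" for s
  proof -
    have "s \<in> {0..T} - ?C" "s < T" using S(2)[of k] s by auto
    then have "approximable (\<lambda>n. natural_filtration M (Xn n) s) (A s)"
      unfolding A_def by (intro approximable_natural_filtration[OF T Xn X conv] lt)
    then show ?thesis using p unfolding approximable_def by blast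
  qed
  then have ev1: "\<forall>\<^sub>F n in sequentially. \<forall>s\<in>S k. \<exists>B\<in>sets (natural_filtration M (Xn n) s). prob (sym_diff (A s) B) < p"
    using S(1) by (simp add: eventually_ball_finite)
  have "tendsto_in_prob (\<lambda>n. Xn n s) (X s)" if "s \<in> insert T (S k)" for s
    using that S(2)[of k] by (intro tendsto_in_prob_at_time[OF T Xn X conv]) auto
  then have ev2: "\<forall>\<^sub>F n in sequentially. \<forall>\<tau>. \<tau> \<in> borel_measurable M \<longrightarrow> (\<forall>w\<in>space M. \<tau> w \<in> insert T (S k)) \<longrightarrow>
    \<bar>E_reward M \<gamma> (Xn n) \<tau> - E_reward M \<gamma> X \<tau>\<bar> < e / 3"
    using S(1)[of k] S0[of k] T by (intro expected_reward_exchange[OF Xn X _ _ _ e3]) auto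
  from ev1 ev2 show ?thesis
  proof eventually_elim
    case (elim n)
    let ?G = "natural_filtration M (Xn n)"
    \<comment> \<open>Replacing the events \<open>{\<tau> < s}\<close> by their approximations gives a stopping time of the natural
      filtration of \<open>Xn n\<close>; it differs from \<open>\<rho> k\<close> only if one of the approximations fails.\<close>
    from elim(1) obtain B where B: "\<And>s. s \<in> S k \<Longrightarrow> B s \<in> sets (?G s)"
      "\<And>s. s \<in> S k \<Longrightarrow> prob (sym_diff (A s) (B s)) < p" by metis
    define \<sigma> where "\<sigma> w = first_true T (S k) (\<lambda>s. w \<in> B s)" for w
    have \<sigma>T: "\<sigma> w \<in> {0..T}" "\<sigma> w \<in> insert T (S k)" for w
      using ft(1,2) unfolding \<sigma>_def by auto
    have subG: "subalgebra M (?G t)" if "t \<le> T" for t by (rule subalgebra_natural_filtration[OF Xn that])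
    have BM: "B s \<in> events" if "s \<in> S k" for s
    proof -
      have "s \<le> T" using S0[of k] that by auto
      then show ?thesis using B(1)[OF that] subG[of s] by (auto simp: subalgebra_def)
    qed
    have "{w\<in>space M. w \<in> B s} = B s" if "s \<in> S k" for s
      using sets.sets_into_space[OF BM[OF that]] by auto
    then have \<sigma>st: "\<sigma> \<in> stopping_times M T ?G"
      unfolding \<sigma>_def using T B(1) by (intro first_true_stopping_times S(1) S0 sets_natural_filtration_mono) auto
    have \<sigma>m: "\<sigma> \<in> borel_measurable M"
      by (rule stopping_times_measurable[OF _ subG \<sigma>st]) auto
    define E where "E = (\<Union>s\<in>S k. sym_diff (A s) (B s))"
    have AB: "sym_diff (A s) (B s) \<in> events" if "s \<in> S k" for s
      using BM[OF that] ltM by (auto simp: A_def)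
    have E: "E \<in> events" unfolding E_def using S(1) AB by (intro sets.finite_UN) auto
    have "prob E \<le> (\<Sum>s\<in>S k. prob (sym_diff (A s) (B s)))"
      unfolding E_def using S(1) AB by (intro finite_measure_subadditive_finite) auto
    also have "\<dots> \<le> (\<Sum>s\<in>S k. p)" using B(2) by (intro sum_mono less_imp_le)
    also have "\<dots> \<le> real (Suc (card (S k))) * p" using p by simp
    finally have pE: "prob E \<le> real (Suc (card (S k))) * p" .
    have int: "integrable M (\<lambda>w. \<gamma> (\<rho> k w, X (\<rho> k w) w))" "integrable M (\<lambda>w. \<gamma> (\<sigma> w, X (\<sigma> w) w))"
      subgoal by (rule integrable_reward[OF \<rho>m \<rho>T(1) cadlag_process_at_random_time_measurable[OF X \<rho>m \<rho>T(1)]])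
      subgoal by (rule integrable_reward[OF \<sigma>m \<sigma>T(1) cadlag_process_at_random_time_measurable[OF X \<sigma>m \<sigma>T(1)]])
      done
    have "E_reward M \<gamma> X (\<rho> k) \<le> E_reward M \<gamma> X \<sigma> + 0 + 2 * K * prob E"
    proof (rule expectation_diff_le[OF int E])
      show "\<bar>\<gamma> (\<rho> k w, X (\<rho> k w) w) - \<gamma> (\<sigma> w, X (\<sigma> w) w)\<bar> \<le> 2 * K" for w
        by (rule reward_diff_bound[OF \<rho>T(1) \<sigma>T(1)])
      fix w assume w: "w \<in> space M - E"
      then have "{s\<in>S k. \<tau> w < s} = {s\<in>S k. w \<in> B s}" by (auto simp: E_def A_def)
      then have "\<rho> k w = \<sigma> w" by (simp add: \<rho>_def \<sigma>_def first_true_def)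
      then show "\<bar>\<gamma> (\<rho> k w, X (\<rho> k w) w) - \<gamma> (\<sigma> w, X (\<sigma> w) w)\<bar> \<le> 0" by simp
    qed (use K in auto)
    moreover have "2 * K * prob E \<le> 2 * K * (real (Suc (card (S k))) * p)" using pE K(1) by simp
    moreover have "\<dots> = e / 3" using K(1) by (simp add: p_def del: of_nat_Suc)
    moreover have "\<bar>E_reward M \<gamma> (Xn n) \<sigma> - E_reward M \<gamma> X \<sigma>\<bar> < e / 3"
      using elim(2) \<sigma>m \<sigma>T(2) by blast
    ultimately have "E_reward M \<gamma> X \<tau> - e / 3 - e / 3 - e / 3 \<le> E_reward M \<gamma> (Xn n) \<sigma>"
      using k unfolding abs_less_iff by linarith
    also have "\<dots> \<le> optimal_value M T ?G \<gamma> (Xn n)"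
      by (rule expected_reward_le_optimal_value[OF \<sigma>st])
    finally show ?case by simp
  qed
qed

end

end

section \<open>Convergence of the optimal values\<close>

theorem theorem3:
  fixes M :: "'a measure" and T :: real
    and X :: "real \<Rightarrow> 'a \<Rightarrow> real" and Xn :: "nat \<Rightarrow> real \<Rightarrow> 'a \<Rightarrow> real"
    and F :: "real \<Rightarrow> 'a measure" and Fn :: "nat \<Rightarrow> real \<Rightarrow> 'a measure"
    and \<gamma> :: "real \<times> real \<Rightarrow> real"
  assumes "prob_space M"
    and "T > 0"
    and "cadlag_process M T X"
    and "\<And>n. cadlag_process M T (Xn n)"
    and F_def: "F = right_continuous_filtration T (natural_filtration M X)"
    and Fn_def: "\<And>n. Fn n = natural_filtration M (Xn n)"
    and "continuous_on ({0..T} \<times> UNIV) \<gamma>"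
    and "bounded (\<gamma> ` ({0..T} \<times> UNIV))"
    and "skorokhod_tendsto_in_prob M T Xn X"
    and "aldous_criterion M T Fn Xn"
    and "(\<forall>n. \<forall>t\<in>{0..T}. sets (Fn n t) \<subseteq> sets (F t)) \<or> weak_conv_filtrations M T Fn F"
  shows "(\<lambda>n. optimal_value M T (Fn n) \<gamma> (Xn n)) \<longlonglongrightarrow> optimal_value M T F \<gamma> X"
proof -
  interpret prob_space M by fact
  note T = \<open>T > 0\<close> and X = \<open>cadlag_process M T X\<close> and Xn = \<open>\<And>n. cadlag_process M T (Xn n)\<close>
    and \<gamma> = \<open>continuous_on ({0..T} \<times> UNIV) \<gamma>\<close> and conv = \<open>skorokhod_tendsto_in_prob M T Xn X\<close>
  obtain K where K: "K > 0" "\<And>p. p \<in> {0..T} \<times> UNIV \<Longrightarrow> \<bar>\<gamma> p\<bar> \<le> K"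
    using \<open>bounded (\<gamma> ` ({0..T} \<times> UNIV))\<close> unfolding bounded_pos by auto
  have K2: "\<bar>\<gamma> (t, x)\<bar> \<le> K" if "t \<in> {0..T}" for t x using K(2) that by auto
  note ctx = T \<gamma> K(1) K2
  have F: "\<And>t. space (F t) = space M" "\<And>s t. s \<le> t \<Longrightarrow> sets (F s) \<subseteq> sets (F t)"
    "\<And>t. t \<le> T \<Longrightarrow> subalgebra M (F t)"
    unfolding F_def by (simp_all add: right_continuous_filtration_mono subalgebra_right_continuous_filtration[OF X])
  have Fn: "\<And>n t. space (Fn n t) = space M" "\<And>n s t. s \<le> t \<Longrightarrow> sets (Fn n s) \<subseteq> sets (Fn n t)"
    "\<And>n t. t \<le> T \<Longrightarrow> subalgebra M (Fn n t)"
    unfolding Fn_def by (simp_all add: sets_natural_filtration_mono subalgebra_natural_filtration[OF Xn])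
  have lower: "\<forall>\<^sub>F n in sequentially. optimal_value M T F \<gamma> X - e < optimal_value M T (Fn n) \<gamma> (Xn n)"
    if e: "e > 0" for e
  proof -
    have "\<not> (\<forall>\<tau>\<in>stopping_times M T F. E_reward M \<gamma> X \<tau> \<le> optimal_value M T F \<gamma> X - e / 2)"
      using optimal_value_le[OF ctx, where G = F and Y = X and c = "optimal_value M T F \<gamma> X - e / 2"] F(1) e by auto
    then obtain \<tau> where \<tau>: "\<tau> \<in> stopping_times M T F"
      "optimal_value M T F \<gamma> X - e / 2 < E_reward M \<gamma> X \<tau>" by (auto simp: not_le)
    have "\<forall>\<^sub>F n in sequentially. E_reward M \<gamma> X \<tau> - e / 2 \<le> optimal_value M T (Fn n) \<gamma> (Xn n)"
      unfolding Fn_def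
      by (rule expected_reward_liminf[OF ctx Xn X conv \<tau>(1)[unfolded F_def] half_gt_zero[OF e]])
    then show ?thesis by eventually_elim (use \<tau>(2) in simp)
  qed
  have upper: "\<forall>\<^sub>F n in sequentially. optimal_value M T (Fn n) \<gamma> (Xn n) < optimal_value M T F \<gamma> X + e"
    if e: "e > 0" for e
  proof -
    have e4: "e / 4 > 0" using e by simp
    \<comment> \<open>The two assumptions on the filtrations enter only here, with \<open>C\<close> the times to be avoided.\<close>
    obtain C where C: "countable C" "\<And>S. finite S \<Longrightarrow> S \<noteq> {} \<Longrightarrow> S \<subseteq> insert T ({0..T} - C) \<Longrightarrow>
       \<forall>\<^sub>F n in sequentially. \<forall>\<tau>\<in>stopping_times M T (Fn n). (\<forall>w\<in>space M. \<tau> w \<in> S) \<longrightarrow>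
         E_reward M \<gamma> X \<tau> \<le> optimal_value M T F \<gamma> X + e / 4"
      using \<open>_ \<or> weak_conv_filtrations M T Fn F\<close>
    proof
      assume sub: "\<forall>n. \<forall>t\<in>{0..T}. sets (Fn n t) \<subseteq> sets (F t)"
      show thesis
      proof (rule that[of "{}"])
        fix S assume S: "finite S" "S \<subseteq> insert T ({0..T} - {})"
        have ST: "S \<subseteq> {0..T}" using S(2) T by auto
        have "E_reward M \<gamma> X \<tau> \<le> optimal_value M T F \<gamma> X + e / 4"
          if \<tau>: "\<tau> \<in> stopping_times M T (Fn n)" "\<forall>w\<in>space M. \<tau> w \<in> S" for \<tau> n
        proof -
          have "{w\<in>space M. \<tau> w = s} \<in> sets (F s)" if "s \<in> S" for s
            using stopping_times_finite_range[of "Fn n" M S T \<tau>, OF Fn(1,2) S(1) ST] \<tau> sub ST that by blast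
          then have "\<tau> \<in> stopping_times M T F"
            using stopping_times_finite_range[of F M S T \<tau>, OF F(1,2) S(1) ST] \<tau>(2) by blast
          from expected_reward_le_optimal_value[OF ctx this, where Y = X] show ?thesis using e by simp
        qed
        then show "\<forall>\<^sub>F n in sequentially. \<forall>\<tau>\<in>stopping_times M T (Fn n). (\<forall>w\<in>space M. \<tau> w \<in> S) \<longrightarrow>
          E_reward M \<gamma> X \<tau> \<le> optimal_value M T F \<gamma> X + e / 4"
          by (intro always_eventually allI) blast
      qed simp
    next
      assume weak: "weak_conv_filtrations M T Fn F"
      have FT: "sets (F T) = sets (natural_filtration M X T)"
        by (simp add: F_def right_continuous_filtration_def)
      obtain C where C: "countable C"
        "\<And>t U. t \<in> insert T ({0..T} - C) \<Longrightarrow> integrable M U \<Longrightarrow> U \<in> borel_measurable (F T) \<Longrightarrow>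
           cond_exp_conv (\<lambda>n. Fn n t) (F t) U"
        using weak_conv_filtrations_cond_exp[OF T X _ _ FT weak] Fn(3) F(3) by auto
      have Xm: "X t \<in> borel_measurable (F t)" if "t \<in> {0..T}" for t
      proof (rule measurable_from_subalg)
        show "subalgebra (F t) (natural_filtration M X t)"
          unfolding F_def using that
          by (simp add: subalgebra_def natural_filtration_subset_right_continuous)
        show "X t \<in> borel_measurable (natural_filtration M X t)"
          using that by (intro natural_filtration_measurable) simp
      qed
      show thesis
      proof (rule that[OF C(1)])
        fix S assume S: "finite S" "S \<noteq> {}" "S \<subseteq> insert T ({0..T} - C)"
        have "S \<subseteq> {0..T}" using S(3) T by auto
        then show "\<forall>\<^sub>F n in sequentially. \<forall>\<tau>\<in>stopping_times M T (Fn n). (\<forall>w\<in>space M. \<tau> w \<in> S) \<longrightarrow>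
         E_reward M \<gamma> X \<tau> \<le> optimal_value M T F \<gamma> X + e / 4"
          using expected_reward_finite_weak_conv[OF ctx X S(1) _ S(2) Fn F Xm C(2)[OF subsetD[OF S(3)]] e4] by blast
      qed
    qed
    have "countable (C \<union> fixed_discontinuities M T X)"
      using C(1) T by (intro countable_Un countable_fixed_discontinuities X) auto
    from expected_reward_rounding[OF ctx Xn X conv \<open>aldous_criterion M T Fn Xn\<close> Fn this e4]
    obtain S where S: "finite S" "S \<subseteq> {0..<T} - (C \<union> fixed_discontinuities M T X)"
      and round: "\<forall>\<^sub>F n in sequentially. \<forall>\<tau>\<in>stopping_times M T (Fn n). \<exists>\<nu>\<in>stopping_times M T (Fn n).
         (\<forall>w\<in>space M. \<nu> w \<in> insert T S) \<and> E_reward M \<gamma> (Xn n) \<tau> \<le> E_reward M \<gamma> (Xn n) \<nu> + e / 4"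
      by blast
    let ?S = "insert T S"
    have ST: "finite ?S" "?S \<subseteq> {0..T}" "?S \<noteq> {}" "?S \<subseteq> insert T ({0..T} - C)" using S T by auto
    have at: "tendsto_in_prob (\<lambda>n. Xn n s) (X s)" if "s \<in> ?S" for s
      using that S(2) by (intro tendsto_in_prob_at_time[OF T Xn X conv]) auto
    have "\<forall>\<^sub>F n in sequentially. \<forall>\<tau>. \<tau> \<in> borel_measurable M \<longrightarrow> (\<forall>w\<in>space M. \<tau> w \<in> ?S) \<longrightarrow>
      \<bar>E_reward M \<gamma> (Xn n) \<tau> - E_reward M \<gamma> X \<tau>\<bar> < e / 4"
      by (rule expected_reward_exchange[OF ctx Xn X ST(1,2) at e4])
    with round C(2)[OF ST(1,3,4)] show ?thesis
    proof eventually_elim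
      case (elim n)
      have "optimal_value M T (Fn n) \<gamma> (Xn n) \<le> optimal_value M T F \<gamma> X + e / 4 + e / 4 + e / 4"
      proof (rule optimal_value_le[OF ctx Fn(1)])
        fix \<tau> assume "\<tau> \<in> stopping_times M T (Fn n)"
        with elim(1) obtain \<nu> where \<nu>: "\<nu> \<in> stopping_times M T (Fn n)" "\<forall>w\<in>space M. \<nu> w \<in> ?S"
          "E_reward M \<gamma> (Xn n) \<tau> \<le> E_reward M \<gamma> (Xn n) \<nu> + e / 4" by blast
        have "\<nu> \<in> borel_measurable M" by (rule stopping_times_measurable[OF Fn(1,3) \<nu>(1)])
        with elim(3) \<nu>(2) have "\<bar>E_reward M \<gamma> (Xn n) \<nu> - E_reward M \<gamma> X \<nu>\<bar> < e / 4" by blast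
        moreover have "E_reward M \<gamma> X \<nu> \<le> optimal_value M T F \<gamma> X + e / 4"
          using elim(2) \<nu>(1,2) by blast
        ultimately show "E_reward M \<gamma> (Xn n) \<tau> \<le> optimal_value M T F \<gamma> X + e / 4 + e / 4 + e / 4"
          using \<nu>(3) unfolding abs_less_iff by linarith
      qed
      then show ?case using e by simp
    qed
  qed
  show ?thesis
  proof (rule tendstoI)
    fix e :: real assume e: "e > 0"
    from lower[OF e] upper[OF e]
    show "\<forall>\<^sub>F n in sequentially. dist (optimal_value M T (Fn n) \<gamma> (Xn n)) (optimal_value M T F \<gamma> X) < e"
      by eventually_elim (simp add: dist_real_def abs_less_iff)
  qed
qed

end
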